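(* Let $k$ be a field, $A$ an associative $k$-algebra, $\mathcal{B}$ a $k$-linear category, and $i:\mathcal{B}\to {}_A\mathsf{Mod}$ a $k$-linear functor. Let ${}_{\mathcal{B}^{\mathrm{op}}}\mathsf{Mod}$ be the category of $k$-linear functors $\mathcal{B}^{\mathrm{op}}\to\mathsf{Vec}_k$. Then there is a left adjoint $|\cdot|:{}_{\mathcal{B}^{\mathrm{op}}}\mathsf{Mod}\to{}_A\mathsf{Mod}$ to the restricted Yoneda embedding $$Y:{}_A\mathsf{Mod}\to {}_{\mathcal{B}^{\mathrm{op}}}\mathsf{Mod},\qquad V\mapsto \operatorname{Hom}_A(i(\cdot),V).$$ Explicitly, for $F,G\in {}_{\mathcal{B}^{\mathrm{op}}}\mathsf{Mod}$ and a natural transformation $\theta:F\Rightarrow G$, $|F|$ is the coend $$|F|=\int^{B\in\mathcal{B}} i(B)\otimes_k F(B),$$ and $|\theta|$ is the map $$|\theta|=\int^{B\in\mathcal{B}} i(B)\otimes_k\theta_B.$$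
   Context: All categories are $k$-linear (enriched over the category $\mathsf{Vec}_k$ of $k$-vector spaces) and functors are $k$-linear on hom spaces. ${}_A\mathsf{Mod}$ is the category of left $A$-modules. The left $A$-module structure on $i(B)\otimes_k F(B)$ comes from the factor $i(B)$, and the coend is taken in ${}_A\mathsf{Mod}$; concretely, $|F|$ is the quotient of $\bigoplus_{B\in\mathcal{B}} i(B)\otimes_k F(B)$ by the submodule generated by all $i(f)(b)\otimes v-b\otimes F(f)(v)$, where $f:B\to B'$ is a morphism of $\mathcal{B}$, $b\in i(B)$, $v\in F(B')$. *)

theory Defs
  imports "HOL-Algebra.Module" "HOL-Algebra.AbelCoset"
begin

section \<open>Modules over a possibly noncommutative ring\<close>

text \<open>
  Modules, vector spaces and algebras are encoded in the record
  \<^typ>\<open>('a, 'b) module\<close> of \<^theory>\<open>HOL-Algebra.Module\<close>.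
  For modules and vector spaces the fields \<^const>\<open>mult\<close> and \<^const>\<open>one\<close> of that record carry
  no information. Linear maps are extensional functions on the carrier.
\<close>

text \<open>The locale \<^locale>\<open>module\<close> of the library assumes that the ring is commutative.\<close>

locale left_module = R?: ring R + M?: abelian_group M
  for R :: "('a, 'x) ring_scheme" (structure) and M :: "('a, 'b, 'y) module_scheme" (structure) +
  assumes smult_closed:
      "\<lbrakk>a \<in> carrier R; x \<in> carrier M\<rbrakk> \<Longrightarrow> a \<odot>\<^bsub>M\<^esub> x \<in> carrier M"
    and smult_l_distr:
      "\<lbrakk>a \<in> carrier R; b \<in> carrier R; x \<in> carrier M\<rbrakk> \<Longrightarrow>
        (a \<oplus>\<^bsub>R\<^esub> b) \<odot>\<^bsub>M\<^esub> x = a \<odot>\<^bsub>M\<^esub> x \<oplus>\<^bsub>M\<^esub> b \<odot>\<^bsub>M\<^esub> x"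
    and smult_r_distr:
      "\<lbrakk>a \<in> carrier R; x \<in> carrier M; y \<in> carrier M\<rbrakk> \<Longrightarrow>
        a \<odot>\<^bsub>M\<^esub> (x \<oplus>\<^bsub>M\<^esub> y) = a \<odot>\<^bsub>M\<^esub> x \<oplus>\<^bsub>M\<^esub> a \<odot>\<^bsub>M\<^esub> y"
    and smult_assoc:
      "\<lbrakk>a \<in> carrier R; b \<in> carrier R; x \<in> carrier M\<rbrakk> \<Longrightarrow>
        (a \<otimes>\<^bsub>R\<^esub> b) \<odot>\<^bsub>M\<^esub> x = a \<odot>\<^bsub>M\<^esub> (b \<odot>\<^bsub>M\<^esub> x)"
    and smult_one:
      "x \<in> carrier M \<Longrightarrow> \<one>\<^bsub>R\<^esub> \<odot>\<^bsub>M\<^esub> x = x"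

text \<open>
  Unital associative algebras; the locale \<^locale>\<open>algebra\<close> of the library is restricted to
  commutative ones.
\<close>

locale assoc_algebra = module K A + ring A
  for K :: "('k, 'x) ring_scheme" and A :: "('k, 'a, 'y) module_scheme" +
  assumes smult_mult_left:
      "\<lbrakk>c \<in> carrier K; x \<in> carrier A; y \<in> carrier A\<rbrakk> \<Longrightarrow>
        (c \<odot>\<^bsub>A\<^esub> x) \<otimes>\<^bsub>A\<^esub> y = c \<odot>\<^bsub>A\<^esub> (x \<otimes>\<^bsub>A\<^esub> y)"
    and smult_mult_right:
      "\<lbrakk>c \<in> carrier K; x \<in> carrier A; y \<in> carrier A\<rbrakk> \<Longrightarrow>
        x \<otimes>\<^bsub>A\<^esub> (c \<odot>\<^bsub>A\<^esub> y) = c \<odot>\<^bsub>A\<^esub> (x \<otimes>\<^bsub>A\<^esub> y)"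

definition linear_map ::
    "('a, 'x) ring_scheme \<Rightarrow> ('a, 'b) module \<Rightarrow> ('a, 'c) module \<Rightarrow> ('b \<Rightarrow> 'c) \<Rightarrow> bool"
  where "linear_map R M N h \<longleftrightarrow>
    h \<in> carrier M \<rightarrow> carrier N \<and>
    (\<forall>x\<in>carrier M. \<forall>y\<in>carrier M. h (x \<oplus>\<^bsub>M\<^esub> y) = h x \<oplus>\<^bsub>N\<^esub> h y) \<and>
    (\<forall>a\<in>carrier R. \<forall>x\<in>carrier M. h (a \<odot>\<^bsub>M\<^esub> x) = a \<odot>\<^bsub>N\<^esub> h x)"

definition linear_maps ::
    "('a, 'x) ring_scheme \<Rightarrow> ('a, 'b) module \<Rightarrow> ('a, 'c) module \<Rightarrow> ('b \<Rightarrow> 'c) set"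
  where "linear_maps R M N = {h \<in> extensional (carrier M). linear_map R M N h}"

text \<open>The vector space underlying an \<open>A\<close>-module: scalars act through \<open>c \<mapsto> c \<cdot> 1\<^sub>A\<close>.\<close>

definition scalars :: "('k, 'a) module \<Rightarrow> ('a, 'm) module \<Rightarrow> ('k, 'm) module"
  where "scalars A M =
    \<lparr>carrier = carrier M, mult = mult M, one = one M, zero = zero M, add = add M,
     smult = (\<lambda>c x. (c \<odot>\<^bsub>A\<^esub> \<one>\<^bsub>A\<^esub>) \<odot>\<^bsub>M\<^esub> x)\<rparr>"

definition pointwise_module ::
    "'s set \<Rightarrow> ('k, 'n) module \<Rightarrow> ('s \<Rightarrow> 'n) set \<Rightarrow> ('k, 's \<Rightarrow> 'n) module"
  where "pointwise_module S N H =
    \<lparr>carrier = H, mult = undefined, one = undefined,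
     zero = (\<lambda>x\<in>S. \<zero>\<^bsub>N\<^esub>),
     add = (\<lambda>f g. \<lambda>x\<in>S. f x \<oplus>\<^bsub>N\<^esub> g x),
     smult = (\<lambda>c f. \<lambda>x\<in>S. c \<odot>\<^bsub>N\<^esub> f x)\<rparr>"

text \<open>
  \<open>Hom\<^sub>k(U, W)\<close> for vector spaces and \<open>Hom\<^sub>A(M, N)\<close> for \<open>A\<close>-modules, both as
  vector spaces. The carrier types of source and target may differ.
\<close>

definition Hom_Vec ::
    "'k ring \<Rightarrow> ('k, 'u) module \<Rightarrow> ('k, 'w) module \<Rightarrow> ('k, 'u \<Rightarrow> 'w) module"
  where "Hom_Vec K U W = pointwise_module (carrier U) W (linear_maps K U W)"

definition Hom_Mod ::
    "('k, 'a) module \<Rightarrow> ('a, 'm) module \<Rightarrow> ('a, 'n) module \<Rightarrow> ('k, 'm \<Rightarrow> 'n) module"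
  where "Hom_Mod A M N = pointwise_module (carrier M) (scalars A N) (linear_maps A M N)"


section \<open>Linear categories and linear functors\<close>

text \<open>
  Hom spaces of different pairs of objects need not be disjoint, so composition and the action
  of a functor on morphisms are indexed by objects:
  \<open>Cmp C X Y Z g f\<close> is \<open>g \<circ> f\<close> for \<open>f : X \<rightarrow> Y\<close> and \<open>g : Y \<rightarrow> Z\<close>, and
  \<open>farr F X Y\<close> is the action on \<open>Hom C X Y\<close>.
\<close>

record ('o, 'm, 'k) lincat =
  Ob :: "'o set"
  Hom :: "'o \<Rightarrow> 'o \<Rightarrow> ('k, 'm) module"
  Ident :: "'o \<Rightarrow> 'm"
  Cmp :: "'o \<Rightarrow> 'o \<Rightarrow> 'o \<Rightarrow> 'm \<Rightarrow> 'm \<Rightarrow> 'm"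

locale linear_category =
  fixes K :: "'k ring" and C :: "('o, 'm, 'k) lincat"
  assumes hom_space: "\<lbrakk>X \<in> Ob C; Y \<in> Ob C\<rbrakk> \<Longrightarrow> module K (Hom C X Y)"
    and ident_in: "X \<in> Ob C \<Longrightarrow> Ident C X \<in> carrier (Hom C X X)"
    and comp_linear_left:
      "\<lbrakk>X \<in> Ob C; Y \<in> Ob C; Z \<in> Ob C; f \<in> carrier (Hom C X Y)\<rbrakk> \<Longrightarrow>
        linear_map K (Hom C Y Z) (Hom C X Z) (\<lambda>g. Cmp C X Y Z g f)"
    and comp_linear_right:
      "\<lbrakk>X \<in> Ob C; Y \<in> Ob C; Z \<in> Ob C; g \<in> carrier (Hom C Y Z)\<rbrakk> \<Longrightarrow>
        linear_map K (Hom C X Y) (Hom C X Z) (\<lambda>f. Cmp C X Y Z g f)"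
    and comp_ident_left:
      "\<lbrakk>X \<in> Ob C; Y \<in> Ob C; f \<in> carrier (Hom C X Y)\<rbrakk> \<Longrightarrow> Cmp C X Y Y (Ident C Y) f = f"
    and comp_ident_right:
      "\<lbrakk>X \<in> Ob C; Y \<in> Ob C; f \<in> carrier (Hom C X Y)\<rbrakk> \<Longrightarrow> Cmp C X X Y f (Ident C X) = f"
    and comp_assoc:
      "\<lbrakk>W \<in> Ob C; X \<in> Ob C; Y \<in> Ob C; Z \<in> Ob C;
        f \<in> carrier (Hom C W X); g \<in> carrier (Hom C X Y); h \<in> carrier (Hom C Y Z)\<rbrakk> \<Longrightarrow>
        Cmp C W Y Z h (Cmp C W X Y g f) = Cmp C W X Z (Cmp C X Y Z h g) f"

record ('o, 'm, 'p, 'n) linfun =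
  fobj :: "'o \<Rightarrow> 'p"
  farr :: "'o \<Rightarrow> 'o \<Rightarrow> 'm \<Rightarrow> 'n"

locale linear_functor = C: linear_category K C + D: linear_category K D
  for K :: "'k ring" and C :: "('o, 'm, 'k) lincat" and D :: "('p, 'n, 'k) lincat" +
  fixes F :: "('o, 'm, 'p, 'n) linfun"
  assumes fobj_in: "X \<in> Ob C \<Longrightarrow> fobj F X \<in> Ob D"
    and farr_linear:
      "\<lbrakk>X \<in> Ob C; Y \<in> Ob C\<rbrakk> \<Longrightarrow>
        linear_map K (Hom C X Y) (Hom D (fobj F X) (fobj F Y)) (farr F X Y)"
    and farr_ident: "X \<in> Ob C \<Longrightarrow> farr F X X (Ident C X) = Ident D (fobj F X)"
    and farr_comp:
      "\<lbrakk>X \<in> Ob C; Y \<in> Ob C; Z \<in> Ob C; f \<in> carrier (Hom C X Y); g \<in> carrier (Hom C Y Z)\<rbrakk> \<Longrightarrow>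
        farr F X Z (Cmp C X Y Z g f) =
        Cmp D (fobj F X) (fobj F Y) (fobj F Z) (farr F Y Z g) (farr F X Y f)"

definition op_cat :: "('o, 'm, 'k) lincat \<Rightarrow> ('o, 'm, 'k) lincat"
  where "op_cat C =
    \<lparr>Ob = Ob C, Hom = (\<lambda>X Y. Hom C Y X), Ident = Ident C,
     Cmp = (\<lambda>X Y Z g f. Cmp C Z Y X f g)\<rparr>"

text \<open>
  HOL has no type of all vector spaces or all modules. The categories below are therefore
  polymorphic in the carrier type of their objects, which plays the role of a universe; statements
  about them hold for every instance of that type.
\<close>

definition VecCat :: "'k ring \<Rightarrow> (('k, 'v) module, 'v \<Rightarrow> 'v, 'k) lincat"
  where "VecCat K =
    \<lparr>Ob = {V. module K V}, Hom = Hom_Vec K, Ident = (\<lambda>V. \<lambda>x\<in>carrier V. x),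
     Cmp = (\<lambda>U V W g f. compose (carrier U) g f)\<rparr>"

definition ModCat :: "('k, 'a) module \<Rightarrow> (('a, 'v) module, 'v \<Rightarrow> 'v, 'k) lincat"
  where "ModCat A =
    \<lparr>Ob = {V. left_module A V}, Hom = Hom_Mod A, Ident = (\<lambda>V. \<lambda>x\<in>carrier V. x),
     Cmp = (\<lambda>U V W g f. compose (carrier U) g f)\<rparr>"

type_synonym ('o, 'm, 'k, 'v) presheaf = "('o, 'm, ('k, 'v) module, 'v \<Rightarrow> 'v) linfun"

definition nat_comp ::
    "('o, 'm, 'k) lincat \<Rightarrow> ('o, 'm, 'k, 'u) presheaf \<Rightarrow>
     ('o \<Rightarrow> 'v \<Rightarrow> 'w) \<Rightarrow> ('o \<Rightarrow> 'u \<Rightarrow> 'v) \<Rightarrow> 'o \<Rightarrow> 'u \<Rightarrow> 'w"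
  where "nat_comp B F \<eta> \<theta> = (\<lambda>b\<in>Ob B. compose (carrier (fobj F b)) (\<eta> b) (\<theta> b))"

text \<open>The vector space of natural transformations; the value types may again differ.\<close>

definition Hom_PSh ::
    "'k ring \<Rightarrow> ('o, 'm, 'k) lincat \<Rightarrow> ('o, 'm, 'k, 'u) presheaf \<Rightarrow> ('o, 'm, 'k, 'v) presheaf \<Rightarrow>
     ('k, 'o \<Rightarrow> 'u \<Rightarrow> 'v) module"
  where "Hom_PSh K B F G =
    (let H = (\<lambda>b. Hom_Vec K (fobj F b) (fobj G b)) in
    \<lparr>carrier =
       {\<theta> \<in> \<Pi>\<^sub>E b\<in>Ob B. carrier (H b).
         \<forall>b\<in>Ob B. \<forall>b'\<in>Ob B. \<forall>f\<in>carrier (Hom B b b').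
           compose (carrier (fobj F b')) (\<theta> b) (farr F b' b f) =
           compose (carrier (fobj F b')) (farr G b' b f) (\<theta> b')},
     mult = undefined, one = undefined,
     zero = (\<lambda>b\<in>Ob B. \<zero>\<^bsub>H b\<^esub>),
     add = (\<lambda>\<theta> \<eta>. \<lambda>b\<in>Ob B. \<theta> b \<oplus>\<^bsub>H b\<^esub> \<eta> b),
     smult = (\<lambda>c \<theta>. \<lambda>b\<in>Ob B. c \<odot>\<^bsub>H b\<^esub> \<theta> b)\<rparr>)"

definition PShCat ::
    "'k ring \<Rightarrow> ('o, 'm, 'k) lincat \<Rightarrow>
     (('o, 'm, 'k, 'v) presheaf, 'o \<Rightarrow> 'v \<Rightarrow> 'v, 'k) lincat"
  where "PShCat K B =
    \<lparr>Ob = {F. linear_functor K (op_cat B) (VecCat K) F}, Hom = Hom_PSh K B,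
     Ident = (\<lambda>F. \<lambda>b\<in>Ob B. \<lambda>x\<in>carrier (fobj F b). x),
     Cmp = (\<lambda>F G H \<eta> \<theta>. nat_comp B F \<eta> \<theta>)\<rparr>"


section \<open>The restricted Yoneda embedding\<close>

type_synonym ('o, 'm, 'a, 'i) modfun = "('o, 'm, ('a, 'i) module, 'i \<Rightarrow> 'i) linfun"

definition yoneda_obj ::
    "('k, 'a) module \<Rightarrow> ('o, 'm, 'a, 'i) modfun \<Rightarrow> ('a, 'v) module \<Rightarrow>
     ('o, 'm, 'k, 'i \<Rightarrow> 'v) presheaf"
  where "yoneda_obj A i V =
    \<lparr>fobj = (\<lambda>b. Hom_Mod A (fobj i b) V),
     farr = (\<lambda>b' b f. \<lambda>\<phi>\<in>carrier (Hom_Mod A (fobj i b') V).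
       compose (carrier (fobj i b)) \<phi> (farr i b b' f))\<rparr>"

definition yoneda ::
    "('k, 'a) module \<Rightarrow> ('o, 'm, 'k) lincat \<Rightarrow> ('o, 'm, 'a, 'i) modfun \<Rightarrow>
     (('a, 'v) module, 'v \<Rightarrow> 'v, ('o, 'm, 'k, 'i \<Rightarrow> 'v) presheaf,
      'o \<Rightarrow> ('i \<Rightarrow> 'v) \<Rightarrow> ('i \<Rightarrow> 'v)) linfun"
  where "yoneda A B i =
    \<lparr>fobj = yoneda_obj A i,
     farr = (\<lambda>V W g. \<lambda>b\<in>Ob B. \<lambda>\<phi>\<in>carrier (Hom_Mod A (fobj i b) V).
       compose (carrier (fobj i b)) g \<phi>)\<rparr>"


section \<open>Quotients, direct sums and tensor products\<close>

definition span_module :: "('a, 'b) module \<Rightarrow> ('a, 'x) ring_scheme \<Rightarrow> 'b set \<Rightarrow> 'b set"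
  where "span_module M R S = \<Inter>{N. submodule N R M \<and> S \<subseteq> N}"

definition quot_module :: "('a, 'b) module \<Rightarrow> 'b set \<Rightarrow> ('a, 'b set) module"
  where "quot_module M N =
    \<lparr>carrier = a_rcosets\<^bsub>M\<^esub> N, mult = undefined, one = undefined,
     zero = N, add = set_add M,
     smult = (\<lambda>a C. \<Union>x\<in>C. N +>\<^bsub>M\<^esub> (a \<odot>\<^bsub>M\<^esub> x))\<rparr>"

text \<open>
  The map of cosets induced by a map \<open>h\<close> into \<open>M'\<close>: the coset of \<open>x\<close> goes to the coset of
  \<open>h x\<close> modulo \<open>N'\<close>. When \<open>h\<close> respects the submodules, all members of the union coincide.
\<close>

definition quot_map :: "('a, 'c) module \<Rightarrow> 'c set \<Rightarrow> ('b \<Rightarrow> 'c) \<Rightarrow> 'b set \<Rightarrow> 'c set"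
  where "quot_map M' N' h C = (\<Union>x\<in>C. N' +>\<^bsub>M'\<^esub> h x)"

definition direct_sum :: "'o set \<Rightarrow> ('o \<Rightarrow> ('a, 'b) module) \<Rightarrow> ('a, 'o \<Rightarrow> 'b) module"
  where "direct_sum I M =
    \<lparr>carrier = {x \<in> \<Pi>\<^sub>E j\<in>I. carrier (M j). finite {j \<in> I. x j \<noteq> \<zero>\<^bsub>M j\<^esub>}},
     mult = undefined, one = undefined,
     zero = (\<lambda>j\<in>I. \<zero>\<^bsub>M j\<^esub>),
     add = (\<lambda>x y. \<lambda>j\<in>I. x j \<oplus>\<^bsub>M j\<^esub> y j),
     smult = (\<lambda>a x. \<lambda>j\<in>I. a \<odot>\<^bsub>M j\<^esub> x j)\<rparr>"

definition sum_inj :: "'o set \<Rightarrow> ('o \<Rightarrow> ('a, 'b) module) \<Rightarrow> 'o \<Rightarrow> 'b \<Rightarrow> 'o \<Rightarrow> 'b"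
  where "sum_inj I M j t = (\<lambda>l\<in>I. if l = j then t else \<zero>\<^bsub>M l\<^esub>)"

definition free_module :: "'k ring \<Rightarrow> 's set \<Rightarrow> ('k, 's \<Rightarrow> 'k) module"
  where "free_module K S =
    \<lparr>carrier = {c. (\<forall>p. c p \<in> carrier K) \<and> {p. c p \<noteq> \<zero>\<^bsub>K\<^esub>} \<subseteq> S \<and> finite {p. c p \<noteq> \<zero>\<^bsub>K\<^esub>}},
     mult = undefined, one = undefined,
     zero = (\<lambda>p. \<zero>\<^bsub>K\<^esub>),
     add = (\<lambda>c d p. c p \<oplus>\<^bsub>K\<^esub> d p),
     smult = (\<lambda>r c p. r \<otimes>\<^bsub>K\<^esub> c p)\<rparr>"

definition free_gen :: "'k ring \<Rightarrow> 's \<Rightarrow> 's \<Rightarrow> 'k"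
  where "free_gen K s = (\<lambda>p. if p = s then \<one>\<^bsub>K\<^esub> else \<zero>\<^bsub>K\<^esub>)"

definition free_map :: "'k ring \<Rightarrow> ('s \<Rightarrow> 't) \<Rightarrow> ('s \<Rightarrow> 'k) \<Rightarrow> 't \<Rightarrow> 'k"
  where "free_map K h c = (\<lambda>q. \<Oplus>\<^bsub>K\<^esub>p\<in>{p. c p \<noteq> \<zero>\<^bsub>K\<^esub> \<and> h p = q}. c p)"

definition tensor_rel :: "'k ring \<Rightarrow> ('k, 'm) module \<Rightarrow> ('k, 'n) module \<Rightarrow> ('m \<times> 'n \<Rightarrow> 'k) set"
  where "tensor_rel K M N =
    (let E = free_module K (carrier M \<times> carrier N); \<delta> = free_gen K in
     span_module E K
      ({\<delta> (x \<oplus>\<^bsub>M\<^esub> x', y) \<ominus>\<^bsub>E\<^esub> (\<delta> (x, y) \<oplus>\<^bsub>E\<^esub> \<delta> (x', y)) | x x' y.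
          x \<in> carrier M \<and> x' \<in> carrier M \<and> y \<in> carrier N} \<union>
       {\<delta> (x, y \<oplus>\<^bsub>N\<^esub> y') \<ominus>\<^bsub>E\<^esub> (\<delta> (x, y) \<oplus>\<^bsub>E\<^esub> \<delta> (x, y')) | x y y'.
          x \<in> carrier M \<and> y \<in> carrier N \<and> y' \<in> carrier N} \<union>
       {\<delta> (c \<odot>\<^bsub>M\<^esub> x, y) \<ominus>\<^bsub>E\<^esub> (c \<odot>\<^bsub>E\<^esub> \<delta> (x, y)) | c x y.
          c \<in> carrier K \<and> x \<in> carrier M \<and> y \<in> carrier N} \<union>
       {\<delta> (x, c \<odot>\<^bsub>N\<^esub> y) \<ominus>\<^bsub>E\<^esub> (c \<odot>\<^bsub>E\<^esub> \<delta> (x, y)) | c x y.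
          c \<in> carrier K \<and> x \<in> carrier M \<and> y \<in> carrier N}))"

type_synonym ('k, 'm, 'n) tensor = "('m \<times> 'n \<Rightarrow> 'k) set"

definition tensor ::
    "'k ring \<Rightarrow> ('k, 'm) module \<Rightarrow> ('k, 'n) module \<Rightarrow> ('k, ('k, 'm, 'n) tensor) module"
  where "tensor K M N = quot_module (free_module K (carrier M \<times> carrier N)) (tensor_rel K M N)"

definition pure_tensor ::
    "'k ring \<Rightarrow> ('k, 'm) module \<Rightarrow> ('k, 'n) module \<Rightarrow> 'm \<Rightarrow> 'n \<Rightarrow> ('k, 'm, 'n) tensor"
  where "pure_tensor K M N x y =
    tensor_rel K M N +>\<^bsub>free_module K (carrier M \<times> carrier N)\<^esub> free_gen K (x, y)"

definition tensor_map ::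
    "'k ring \<Rightarrow> ('k, 'm) module \<Rightarrow> ('k, 'n) module \<Rightarrow> ('k, 'm') module \<Rightarrow> ('k, 'n') module \<Rightarrow>
     ('m \<Rightarrow> 'm') \<Rightarrow> ('n \<Rightarrow> 'n') \<Rightarrow> ('k, 'm, 'n) tensor \<Rightarrow> ('k, 'm', 'n') tensor"
  where "tensor_map K M N M' N' f g =
    (\<lambda>t\<in>carrier (tensor K M N).
      quot_map (free_module K (carrier M' \<times> carrier N')) (tensor_rel K M' N')
        (free_map K (map_prod f g)) t)"

text \<open>\<open>M \<otimes>\<^sub>k U\<close> as a left \<open>A\<close>-module through the factor \<open>M\<close>.\<close>

definition tensor_left ::
    "'k ring \<Rightarrow> ('k, 'a) module \<Rightarrow> ('a, 'm) module \<Rightarrow> ('k, 'n) module \<Rightarrow>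
     ('a, ('k, 'm, 'n) tensor) module"
  where "tensor_left K A M U =
    (let T = tensor K (scalars A M) U in
    \<lparr>carrier = carrier T, mult = undefined, one = undefined, zero = zero T, add = add T,
     smult = (\<lambda>a. tensor_map K (scalars A M) U (scalars A M) U (\<lambda>x. a \<odot>\<^bsub>M\<^esub> x) (\<lambda>u. u))\<rparr>)"


section \<open>The coend\<close>

context
  fixes K :: "'k ring" and A :: "('k, 'a) module" and B :: "('o, 'm, 'k) lincat"
    and i :: "('o, 'm, 'a, 'i) modfun"
begin

text \<open>\<open>integrand F b b'\<close> is \<open>i(b) \<otimes>\<^sub>k F(b')\<close>, covariant in \<open>b\<close> and contravariant in \<open>b'\<close>.\<close>

definition integrand ::
    "('o, 'm, 'k, 'f) presheaf \<Rightarrow> 'o \<Rightarrow> 'o \<Rightarrow> ('a, ('k, 'i, 'f) tensor) module"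
  where "integrand F b b' = tensor_left K A (fobj i b) (fobj F b')"

definition integrand_left ::
    "('o, 'm, 'k, 'f) presheaf \<Rightarrow> 'o \<Rightarrow> 'o \<Rightarrow> 'm \<Rightarrow> ('k, 'i, 'f) tensor \<Rightarrow> ('k, 'i, 'f) tensor"
  where "integrand_left F b b' f =
    tensor_map K (scalars A (fobj i b)) (fobj F b') (scalars A (fobj i b')) (fobj F b')
      (farr i b b' f) (\<lambda>v. v)"

definition integrand_right ::
    "('o, 'm, 'k, 'f) presheaf \<Rightarrow> 'o \<Rightarrow> 'o \<Rightarrow> 'm \<Rightarrow> ('k, 'i, 'f) tensor \<Rightarrow> ('k, 'i, 'f) tensor"
  where "integrand_right F b b' f =
    tensor_map K (scalars A (fobj i b)) (fobj F b') (scalars A (fobj i b)) (fobj F b)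
      (\<lambda>x. x) (farr F b' b f)"

definition integrand_map ::
    "('o, 'm, 'k, 'f) presheaf \<Rightarrow> ('o, 'm, 'k, 'g) presheaf \<Rightarrow> ('o \<Rightarrow> 'f \<Rightarrow> 'g) \<Rightarrow> 'o \<Rightarrow>
     ('k, 'i, 'f) tensor \<Rightarrow> ('k, 'i, 'g) tensor"
  where "integrand_map F G \<theta> b =
    tensor_map K (scalars A (fobj i b)) (fobj F b) (scalars A (fobj i b)) (fobj G b)
      (\<lambda>x. x) (\<theta> b)"

definition cowedge ::
    "('o, 'm, 'k, 'f) presheaf \<Rightarrow> ('a, 'v) module \<Rightarrow> ('o \<Rightarrow> ('k, 'i, 'f) tensor \<Rightarrow> 'v) \<Rightarrow> bool"
  where "cowedge F V \<omega> \<longleftrightarrow>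
    left_module A V \<and>
    \<omega> \<in> (\<Pi>\<^sub>E b\<in>Ob B. carrier (Hom_Mod A (integrand F b b) V)) \<and>
    (\<forall>b\<in>Ob B. \<forall>b'\<in>Ob B. \<forall>f\<in>carrier (Hom B b b').
      compose (carrier (integrand F b b')) (\<omega> b') (integrand_left F b b' f) =
      compose (carrier (integrand F b b')) (\<omega> b) (integrand_right F b b' f))"

text \<open>
  A coend is a universal cowedge. The type argument is the carrier type of the modules against
  which universality is tested.
\<close>

definition is_coend ::
    "'v itself \<Rightarrow> ('o, 'm, 'k, 'f) presheaf \<Rightarrow> ('a, 'c) module \<Rightarrow>
     ('o \<Rightarrow> ('k, 'i, 'f) tensor \<Rightarrow> 'c) \<Rightarrow> bool"
  where "is_coend _ F C \<iota> \<longleftrightarrow>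
    cowedge F C \<iota> \<and>
    (\<forall>(V :: ('a, 'v) module) \<omega>. cowedge F V \<omega> \<longrightarrow>
      (\<exists>!u. u \<in> carrier (Hom_Mod A C V) \<and>
        (\<forall>b\<in>Ob B. compose (carrier (integrand F b b)) u (\<iota> b) = \<omega> b)))"

definition integrand_sum ::
    "('o, 'm, 'k, 'f) presheaf \<Rightarrow> ('a, 'o \<Rightarrow> ('k, 'i, 'f) tensor) module"
  where "integrand_sum F = direct_sum (Ob B) (\<lambda>b. integrand F b b)"

definition sum_pure ::
    "('o, 'm, 'k, 'f) presheaf \<Rightarrow> 'o \<Rightarrow> 'i \<Rightarrow> 'f \<Rightarrow> 'o \<Rightarrow> ('k, 'i, 'f) tensor"
  where "sum_pure F b x v =
    sum_inj (Ob B) (\<lambda>b. integrand F b b) b (pure_tensor K (scalars A (fobj i b)) (fobj F b) x v)"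

definition coend_rel :: "('o, 'm, 'k, 'f) presheaf \<Rightarrow> ('o \<Rightarrow> ('k, 'i, 'f) tensor) set"
  where "coend_rel F =
    span_module (integrand_sum F) A
      {sum_pure F b' (farr i b b' f x) v \<ominus>\<^bsub>integrand_sum F\<^esub> sum_pure F b x (farr F b' b f v)
        | b b' f x v. b \<in> Ob B \<and> b' \<in> Ob B \<and> f \<in> carrier (Hom B b b') \<and>
            x \<in> carrier (fobj i b) \<and> v \<in> carrier (fobj F b')}"

definition coend :: "('o, 'm, 'k, 'f) presheaf \<Rightarrow> ('a, ('o \<Rightarrow> ('k, 'i, 'f) tensor) set) module"
  where "coend F = quot_module (integrand_sum F) (coend_rel F)"

definition coend_inj ::
    "('o, 'm, 'k, 'f) presheaf \<Rightarrow> 'o \<Rightarrow> ('k, 'i, 'f) tensor \<Rightarrow> ('o \<Rightarrow> ('k, 'i, 'f) tensor) set"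
  where "coend_inj F = (\<lambda>b\<in>Ob B. \<lambda>t\<in>carrier (integrand F b b).
    coend_rel F +>\<^bsub>integrand_sum F\<^esub> sum_inj (Ob B) (\<lambda>b. integrand F b b) b t)"

definition coend_map ::
    "('o, 'm, 'k, 'f) presheaf \<Rightarrow> ('o, 'm, 'k, 'g) presheaf \<Rightarrow> ('o \<Rightarrow> 'f \<Rightarrow> 'g) \<Rightarrow>
     ('o \<Rightarrow> ('k, 'i, 'f) tensor) set \<Rightarrow> ('o \<Rightarrow> ('k, 'i, 'g) tensor) set"
  where "coend_map F G \<theta> = (\<lambda>C\<in>carrier (coend F).
    quot_map (integrand_sum G) (coend_rel G) (\<lambda>x. \<lambda>b\<in>Ob B. integrand_map F G \<theta> b (x b)) C)"

definition realization ::
    "(('o, 'm, 'k, 'f) presheaf, 'o \<Rightarrow> 'f \<Rightarrow> 'f,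
      ('a, ('o \<Rightarrow> ('k, 'i, 'f) tensor) set) module,
      ('o \<Rightarrow> ('k, 'i, 'f) tensor) set \<Rightarrow> ('o \<Rightarrow> ('k, 'i, 'f) tensor) set) linfun"
  where "realization = \<lparr>fobj = coend, farr = coend_map\<rparr>"


section \<open>The adjunction\<close>

definition adj_transpose ::
    "('o, 'm, 'k, 'f) presheaf \<Rightarrow> ('a, 'v) module \<Rightarrow>
     (('o \<Rightarrow> ('k, 'i, 'f) tensor) set \<Rightarrow> 'v) \<Rightarrow> 'o \<Rightarrow> 'f \<Rightarrow> 'i \<Rightarrow> 'v"
  where "adj_transpose F V \<phi> =
    (\<lambda>b\<in>Ob B. \<lambda>v\<in>carrier (fobj F b). \<lambda>x\<in>carrier (fobj i b).
      \<phi> (coend_inj F b (pure_tensor K (scalars A (fobj i b)) (fobj F b) x v)))"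

end

text \<open>
  \<open>L\<close> is left adjoint to \<open>R\<close> via \<open>\<Phi>\<close>: isomorphisms of vector spaces
  \<open>\<Phi> F V : Hom\<^sub>A(L F, V) \<rightarrow> Nat(F, R V)\<close> natural in \<open>F\<close> and \<open>V\<close>. Both functors change the
  carrier type, so \<open>L F\<close> and \<open>V\<close> (and likewise \<open>F\<close> and \<open>R V\<close>) have different carrier types, and
  the hom spaces are those between modules, or presheaves, on different carrier types.
\<close>

definition adjunction ::
    "'k ring \<Rightarrow> ('k, 'a) module \<Rightarrow> ('o, 'm, 'k) lincat \<Rightarrow>
     (('o, 'm, 'k, 'f) presheaf, 'o \<Rightarrow> 'f \<Rightarrow> 'f, ('a, 'c) module, 'c \<Rightarrow> 'c) linfun \<Rightarrow>
     (('a, 'v) module, 'v \<Rightarrow> 'v, ('o, 'm, 'k, 'p) presheaf, 'o \<Rightarrow> 'p \<Rightarrow> 'p) linfun \<Rightarrow>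
     (('o, 'm, 'k, 'f) presheaf \<Rightarrow> ('a, 'v) module \<Rightarrow> ('c \<Rightarrow> 'v) \<Rightarrow> 'o \<Rightarrow> 'f \<Rightarrow> 'p) \<Rightarrow> bool"
  where "adjunction K A B L R \<Phi> \<longleftrightarrow>
    linear_functor K (PShCat K B) (ModCat A) L \<and>
    linear_functor K (ModCat A) (PShCat K B) R \<and>
    (\<forall>F\<in>Ob (PShCat K B). \<forall>V\<in>Ob (ModCat A).
      linear_map K (Hom_Mod A (fobj L F) V) (Hom_PSh K B F (fobj R V)) (\<Phi> F V) \<and>
      bij_betw (\<Phi> F V)
        (carrier (Hom_Mod A (fobj L F) V)) (carrier (Hom_PSh K B F (fobj R V)))) \<and>
    (\<forall>F\<in>Ob (PShCat K B). \<forall>G\<in>Ob (PShCat K B). \<forall>V\<in>Ob (ModCat A).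
      \<forall>\<theta>\<in>carrier (Hom_PSh K B F G). \<forall>\<phi>\<in>carrier (Hom_Mod A (fobj L G) V).
        \<Phi> F V (compose (carrier (fobj L F)) \<phi> (farr L F G \<theta>)) = nat_comp B F (\<Phi> G V \<phi>) \<theta>) \<and>
    (\<forall>F\<in>Ob (PShCat K B). \<forall>V\<in>Ob (ModCat A). \<forall>W\<in>Ob (ModCat A).
      \<forall>g\<in>carrier (Hom_Mod A V W). \<forall>\<phi>\<in>carrier (Hom_Mod A (fobj L F) V).
        \<Phi> F W (compose (carrier (fobj L F)) g \<phi>) = nat_comp B F (farr R V W g) (\<Phi> F V \<phi>))"

end

theory Submission
  imports Defs
begin

text \<open>
  An \<open>A\<close>-linear map \<open>|F| \<rightarrow> V\<close> is a family of maps \<open>\<beta> b : i(b) \<times> F(b) \<rightarrow> V\<close> that is \<open>A\<close>-linear in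
  the first variable, \<open>k\<close>-linear in the second one and dinatural in \<open>b\<close>, i.e.
  \<open>\<beta> b' (i(f) x, v) = \<beta> b (x, F(f) v)\<close>. Read with the variables in the other order, such a family
  assigns to \<open>v \<in> F(b)\<close> an \<open>A\<close>-linear map \<open>\<beta> b (-, v) : i(b) \<rightarrow> V\<close>, linearly in \<open>v\<close> and naturally in
  \<open>b\<close>; that is, it is a natural transformation from \<open>F\<close> to \<open>Y V = Hom\<^sub>A(i(-), V)\<close>. This exchange of
  variables is the adjunction.

  The first description of maps out of \<open>|F|\<close> combines the universal properties of free modules,
  direct sums, quotients and tensor products (\<open>free_module_lift\<close>, \<open>direct_sum_lift\<close>,
  \<open>quot_module_lift\<close>, \<open>tensor_lift\<close>, \<open>tensor_left_lift\<close>). The result is the pair \<open>coend_lift\<close>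
  (existence) and \<open>coend_linear_ext\<close> (uniqueness): linear maps out of \<open>|F|\<close> can be prescribed by
  such families on the classes \<open>coend_gen F b x v\<close> of the pure tensors \<open>x \<otimes> v\<close>, and they are
  determined by their values there.

  All further claims reduce to computations on these classes. The map \<open>|\<theta>|\<close> sends
  \<open>coend_gen F b x v\<close> to \<open>coend_gen G b x (\<theta> b v)\<close>, from which functoriality, linearity in \<open>\<theta>\<close> and the
  compatibility with the coend injections can be read off; a cowedge is such a family in which the
  pairs have been replaced by tensors (\<open>cowedge_iff\<close>); and the transpose of \<open>\<phi>\<close> is
  \<open>b, v, x \<mapsto> \<phi> (coend_gen F b x v)\<close>.
\<close>


section \<open>Left modules, linear maps and submodules\<close>

lemma (in left_module) smult_l_null: "x \<in> carrier M \<Longrightarrow> \<zero>\<^bsub>R\<^esub> \<odot>\<^bsub>M\<^esub> x = \<zero>\<^bsub>M\<^esub>"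
  by (metis M.add.r_cancel_one R.l_zero R.zero_closed smult_closed smult_l_distr)

lemma (in left_module) smult_r_null: "a \<in> carrier R \<Longrightarrow> a \<odot>\<^bsub>M\<^esub> \<zero>\<^bsub>M\<^esub> = \<zero>\<^bsub>M\<^esub>"
  by (metis M.add.r_cancel_one M.l_zero M.zero_closed smult_closed smult_r_distr)

lemma (in left_module) smult_minus_one:
  assumes "x \<in> carrier M"
  shows "(\<ominus>\<^bsub>R\<^esub> \<one>\<^bsub>R\<^esub>) \<odot>\<^bsub>M\<^esub> x = \<ominus>\<^bsub>M\<^esub> x"
proof -
  have "(\<ominus>\<^bsub>R\<^esub> \<one>\<^bsub>R\<^esub>) \<odot>\<^bsub>M\<^esub> x \<oplus>\<^bsub>M\<^esub> x = (\<ominus>\<^bsub>R\<^esub> \<one>\<^bsub>R\<^esub> \<oplus>\<^bsub>R\<^esub> \<one>\<^bsub>R\<^esub>) \<odot>\<^bsub>M\<^esub> x"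
    using assms by (simp add: smult_l_distr smult_one)
  then show ?thesis
    using assms M.minus_equality[of "(\<ominus>\<^bsub>R\<^esub> \<one>\<^bsub>R\<^esub>) \<odot>\<^bsub>M\<^esub> x" x]
    by (simp add: R.l_neg smult_l_null smult_closed)
qed

lemma module_imp_left_module:
  assumes "module K V"
  shows "left_module K V"
proof -
  interpret module K V by fact
  show ?thesis
    by (intro left_module.intro left_module_axioms.intro R.ring_axioms M.abelian_group_axioms
        smult_closed smult_l_distr smult_r_distr smult_assoc1 smult_one)
qed

lemma left_module_imp_module:
  assumes "cring K" "left_module K V"
  shows "module K V"
proof -
  interpret left_module K V by fact
  show ?thesis
    by (intro moduleI assms(1) M.abelian_group_axioms
        smult_closed smult_l_distr smult_r_distr smult_assoc smult_one)
qed

lemma linear_mapI: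
  assumes "\<And>x. x \<in> carrier M \<Longrightarrow> h x \<in> carrier N"
    and "\<And>x y. x \<in> carrier M \<Longrightarrow> y \<in> carrier M \<Longrightarrow> h (x \<oplus>\<^bsub>M\<^esub> y) = h x \<oplus>\<^bsub>N\<^esub> h y"
    and "\<And>a x. a \<in> carrier R \<Longrightarrow> x \<in> carrier M \<Longrightarrow> h (a \<odot>\<^bsub>M\<^esub> x) = a \<odot>\<^bsub>N\<^esub> h x"
  shows "linear_map R M N h"
  using assms by (auto simp: linear_map_def)

lemma linear_mapD:
  assumes "linear_map R M N h"
  shows "x \<in> carrier M \<Longrightarrow> h x \<in> carrier N"
    and "x \<in> carrier M \<Longrightarrow> y \<in> carrier M \<Longrightarrow> h (x \<oplus>\<^bsub>M\<^esub> y) = h x \<oplus>\<^bsub>N\<^esub> h y"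
    and "a \<in> carrier R \<Longrightarrow> x \<in> carrier M \<Longrightarrow> h (a \<odot>\<^bsub>M\<^esub> x) = a \<odot>\<^bsub>N\<^esub> h x"
  using assms by (auto simp: linear_map_def)

lemma linear_map_zero:
  assumes "left_module R M" "left_module R N" "linear_map R M N h"
  shows "h \<zero>\<^bsub>M\<^esub> = \<zero>\<^bsub>N\<^esub>"
proof -
  interpret M: left_module R M by fact
  interpret N: left_module R N by fact
  have "h (\<zero>\<^bsub>R\<^esub> \<odot>\<^bsub>M\<^esub> \<zero>\<^bsub>M\<^esub>) = \<zero>\<^bsub>R\<^esub> \<odot>\<^bsub>N\<^esub> h \<zero>\<^bsub>M\<^esub>"
    by (intro linear_mapD(3)[OF assms(3)]) auto
  then show ?thesis
    by (simp add: M.smult_r_null N.smult_l_null linear_mapD(1)[OF assms(3)])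
qed

lemma linear_map_minus:
  assumes "left_module R M" "left_module R N" "linear_map R M N h"
    and "x \<in> carrier M" "y \<in> carrier M"
  shows "h (x \<ominus>\<^bsub>M\<^esub> y) = h x \<ominus>\<^bsub>N\<^esub> h y"
proof -
  interpret M: left_module R M by fact
  interpret N: left_module R N by fact
  have "h ((\<ominus>\<^bsub>R\<^esub> \<one>\<^bsub>R\<^esub>) \<odot>\<^bsub>M\<^esub> y) = (\<ominus>\<^bsub>R\<^esub> \<one>\<^bsub>R\<^esub>) \<odot>\<^bsub>N\<^esub> h y"
    using assms(5) by (intro linear_mapD(3)[OF assms(3)]) auto
  then have "h (\<ominus>\<^bsub>M\<^esub> y) = \<ominus>\<^bsub>N\<^esub> h y"
    using assms(5) by (simp add: M.smult_minus_one N.smult_minus_one linear_mapD(1)[OF assms(3)])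
  then show ?thesis
    using assms(4,5) by (simp add: a_minus_def linear_mapD[OF assms(3)])
qed

lemma linear_map_ident: "linear_map R M M (\<lambda>x. x)"
  by (simp add: linear_map_def)

lemma linear_map_comp:
  assumes "linear_map R L M g" "linear_map R M N h"
  shows "linear_map R L N (\<lambda>x. h (g x))"
  using assms by (auto simp: linear_map_def Pi_iff)

lemma linear_map_cong:
  assumes "left_module R M" "\<And>x. x \<in> carrier M \<Longrightarrow> g x = h x"
  shows "linear_map R M N g \<longleftrightarrow> linear_map R M N h"
proof -
  interpret M: left_module R M by fact
  show ?thesis
    using assms(2) by (simp add: linear_map_def Pi_iff M.smult_closed cong: ball_cong)
qed

lemma linear_map_into_zero:
  assumes "left_module R V"
  shows "linear_map R M V (\<lambda>_. \<zero>\<^bsub>V\<^esub>)"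
proof -
  interpret V: left_module R V by fact
  show ?thesis by (auto simp: linear_map_def V.smult_r_null)
qed

text \<open>Closure under negation comes for free, as \<open>\<ominus> x = (\<ominus> 1) \<odot> x\<close>.\<close>

lemma (in left_module) left_submoduleI:
  assumes "N \<subseteq> carrier M" "\<zero>\<^bsub>M\<^esub> \<in> N"
    and "\<And>x y. x \<in> N \<Longrightarrow> y \<in> N \<Longrightarrow> x \<oplus>\<^bsub>M\<^esub> y \<in> N"
    and "\<And>a x. a \<in> carrier R \<Longrightarrow> x \<in> N \<Longrightarrow> a \<odot>\<^bsub>M\<^esub> x \<in> N"
  shows "submodule N R M"
proof (intro submodule.intro subgroup.intro submodule_axioms.intro)
  fix x assume x: "x \<in> N"
  then have "\<ominus>\<^bsub>M\<^esub> x \<in> N"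
    using assms(4)[of "\<ominus>\<^bsub>R\<^esub> \<one>\<^bsub>R\<^esub>" x] assms(1) smult_minus_one[of x] by auto
  then show "inv\<^bsub>add_monoid M\<^esub> x \<in> N" by (simp add: a_inv_def)
qed (use assms in auto)

lemma submoduleD:
  assumes "submodule N R M"
  shows "N \<subseteq> carrier M" "\<zero>\<^bsub>M\<^esub> \<in> N"
    and "x \<in> N \<Longrightarrow> y \<in> N \<Longrightarrow> x \<oplus>\<^bsub>M\<^esub> y \<in> N"
    and "a \<in> carrier R \<Longrightarrow> x \<in> N \<Longrightarrow> a \<odot>\<^bsub>M\<^esub> x \<in> N"
    and "x \<in> N \<Longrightarrow> \<ominus>\<^bsub>M\<^esub> x \<in> N"
proof -
  interpret submodule N R M by fact
  show "N \<subseteq> carrier M" "\<zero>\<^bsub>M\<^esub> \<in> N"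
    "x \<in> N \<Longrightarrow> y \<in> N \<Longrightarrow> x \<oplus>\<^bsub>M\<^esub> y \<in> N"
    "a \<in> carrier R \<Longrightarrow> x \<in> N \<Longrightarrow> a \<odot>\<^bsub>M\<^esub> x \<in> N"
    using subset one_closed m_closed smult_closed by auto
  show "x \<in> N \<Longrightarrow> \<ominus>\<^bsub>M\<^esub> x \<in> N"
    using m_inv_closed by (simp add: a_inv_def)
qed

lemma (in left_module) abelian_subgroup_submodule:
  "submodule N R M \<Longrightarrow> abelian_subgroup N M"
  by (intro abelian_subgroupI3 additive_subgroup.intro submodule.axioms(1) M.abelian_group_axioms)

lemma submodule_preimage:
  assumes "left_module R M" "left_module R N" "linear_map R M N h" "submodule H R N"
  shows "submodule {x \<in> carrier M. h x \<in> H} R M"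
proof -
  interpret M: left_module R M by fact
  show ?thesis
    using submoduleD[OF assms(4)] linear_mapD[OF assms(3)] linear_map_zero[OF assms(1-3)]
    by (intro M.left_submoduleI) (auto simp: M.smult_closed)
qed

lemma submodule_equalizer:
  assumes "left_module R M" "left_module R N" "linear_map R M N h" "linear_map R M N g"
  shows "submodule {x \<in> carrier M. h x = g x} R M"
proof -
  interpret M: left_module R M by fact
  show ?thesis
    using linear_mapD[OF assms(3)] linear_mapD[OF assms(4)]
      linear_map_zero[OF assms(1-3)] linear_map_zero[OF assms(1,2,4)]
    by (intro M.left_submoduleI) (auto simp: M.smult_closed)
qed

lemma submodule_span:
  assumes "left_module R M" "S \<subseteq> carrier M"
  shows "submodule (span_module M R S) R M"
proof -
  interpret left_module R M by fact
  have "submodule (carrier M) R M"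
    by (intro left_submoduleI) (auto simp: smult_closed)
  then show ?thesis
    unfolding span_module_def using assms
    by (intro left_submoduleI) (auto intro: submoduleD(2) submoduleD(3) submoduleD(4))
qed

lemma span_module_superset: "S \<subseteq> span_module M R S"
  by (auto simp: span_module_def)

lemma span_module_least: "submodule N R M \<Longrightarrow> S \<subseteq> N \<Longrightarrow> span_module M R S \<subseteq> N"
  by (auto simp: span_module_def)

text \<open>
  Preimages of submodules are submodules, so a linear map only has to be checked on generators.
\<close>

lemma linear_map_span:
  assumes "left_module R M" "left_module R N" "linear_map R M N h" "submodule H R N"
    and "S \<subseteq> carrier M" "\<And>s. s \<in> S \<Longrightarrow> h s \<in> H" and "x \<in> span_module M R S"
  shows "h x \<in> H"
  using span_module_least[OF submodule_preimage[OF assms(1-4)], of S] assms(5-7) by blast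

lemma submodule_zero:
  assumes "left_module R N"
  shows "submodule {\<zero>\<^bsub>N\<^esub>} R N"
proof -
  interpret N: left_module R N by fact
  show ?thesis by (intro N.left_submoduleI) (auto simp: N.smult_r_null)
qed


section \<open>Quotient modules\<close>

lemma quot_module_simps:
  "carrier (quot_module M N) = (\<lambda>x. N +>\<^bsub>M\<^esub> x) ` carrier M"
  "zero (quot_module M N) = N"
  "add (quot_module M N) = set_add M"
  "smult (quot_module M N) a C = (\<Union>x\<in>C. N +>\<^bsub>M\<^esub> (a \<odot>\<^bsub>M\<^esub> x))"
  by (auto simp: quot_module_def A_RCOSETS_def')

text \<open>
  The induced map on cosets is well defined as soon as \<open>h\<close> carries \<open>N\<close> into \<open>N'\<close>: all members
  of the defining union are then the same coset.
\<close>

lemma quot_map_coset: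
  assumes M: "left_module R M" and M': "left_module R M'"
    and h: "linear_map R M M' h" and N: "submodule N R M" and N': "submodule N' R M'"
    and hN: "\<And>n. n \<in> N \<Longrightarrow> h n \<in> N'" and x: "x \<in> carrier M"
  shows "quot_map M' N' h (N +>\<^bsub>M\<^esub> x) = N' +>\<^bsub>M'\<^esub> h x"
proof -
  interpret M: left_module R M by fact
  interpret M': left_module R M' by fact
  interpret N: abelian_subgroup N M by (rule M.abelian_subgroup_submodule[OF N])
  interpret N': abelian_subgroup N' M' by (rule M'.abelian_subgroup_submodule[OF N'])
  have "N' +>\<^bsub>M'\<^esub> h y = N' +>\<^bsub>M'\<^esub> h x" if y: "y \<in> N +>\<^bsub>M\<^esub> x" for y
  proof -
    obtain n where n: "n \<in> N" "y = n \<oplus>\<^bsub>M\<^esub> x"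
      using y by (auto simp: a_r_coset_def')
    have "n \<in> carrier M" using n by simp
    then have "h y = h n \<oplus>\<^bsub>M'\<^esub> h x" using n x by (simp add: linear_mapD[OF h])
    then have "h y \<in> N' +>\<^bsub>M'\<^esub> h x" using hN[OF n(1)] by (auto simp: a_r_coset_def')
    then show ?thesis
      by (rule N'.a_repr_independence'[OF _ linear_mapD(1)[OF h x], symmetric])
  qed
  moreover have "x \<in> N +>\<^bsub>M\<^esub> x" using x by (rule N.a_rcos_self)
  ultimately show ?thesis unfolding quot_map_def by (intro UN_constant_eq ballI)
qed

context
  fixes R :: "('a, 'x) ring_scheme" and M :: "('a, 'b) module"
  assumes left_module: "left_module R M"
begin

interpretation left_module R M by (rule left_module)

lemma coset_eq_iff:
  assumes "submodule N R M" "x \<in> carrier M" "y \<in> carrier M"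
  shows "N +>\<^bsub>M\<^esub> x = N +>\<^bsub>M\<^esub> y \<longleftrightarrow> x \<ominus>\<^bsub>M\<^esub> y \<in> N"
proof -
  interpret N: abelian_subgroup N M by (rule abelian_subgroup_submodule) fact
  show ?thesis
    using N.a_rcos_module[OF assms(3,2)] assms N.a_repr_independence' N.a_repr_independenceD
    by (metis a_minus_def)
qed

lemma quot_smult_coset:
  assumes "submodule N R M" "a \<in> carrier R" "x \<in> carrier M"
  shows "a \<odot>\<^bsub>quot_module M N\<^esub> (N +>\<^bsub>M\<^esub> x) = N +>\<^bsub>M\<^esub> (a \<odot>\<^bsub>M\<^esub> x)"
proof -
  interpret N: abelian_subgroup N M by (rule abelian_subgroup_submodule) fact
  have "N +>\<^bsub>M\<^esub> (a \<odot>\<^bsub>M\<^esub> y) = N +>\<^bsub>M\<^esub> (a \<odot>\<^bsub>M\<^esub> x)" if y: "y \<in> N +>\<^bsub>M\<^esub> x" for y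
  proof -
    obtain n where n: "n \<in> N" "y = n \<oplus>\<^bsub>M\<^esub> x"
      using y by (auto simp: a_r_coset_def')
    then have "a \<odot>\<^bsub>M\<^esub> y = a \<odot>\<^bsub>M\<^esub> n \<oplus>\<^bsub>M\<^esub> a \<odot>\<^bsub>M\<^esub> x"
      using assms by (simp add: smult_r_distr)
    moreover have "a \<odot>\<^bsub>M\<^esub> n \<in> N" using submoduleD(4)[OF assms(1,2) n(1)] .
    ultimately have "a \<odot>\<^bsub>M\<^esub> y \<in> N +>\<^bsub>M\<^esub> (a \<odot>\<^bsub>M\<^esub> x)" by (auto simp: a_r_coset_def')
    then show ?thesis
      by (rule N.a_repr_independence'[OF _ smult_closed[OF assms(2,3)], symmetric])
  qed
  moreover have "x \<in> N +>\<^bsub>M\<^esub> x" using assms(3) by (rule N.a_rcos_self)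
  ultimately show ?thesis unfolding quot_module_simps by (intro UN_constant_eq ballI)
qed

lemma quot_add_coset:
  assumes "submodule N R M" "x \<in> carrier M" "y \<in> carrier M"
  shows "(N +>\<^bsub>M\<^esub> x) \<oplus>\<^bsub>quot_module M N\<^esub> (N +>\<^bsub>M\<^esub> y) = N +>\<^bsub>M\<^esub> (x \<oplus>\<^bsub>M\<^esub> y)"
  using abelian_subgroup.a_rcos_sum[OF abelian_subgroup_submodule[OF assms(1)] assms(2,3)]
  by (simp add: quot_module_simps)

lemma quot_zero_coset:
  assumes "submodule N R M"
  shows "\<zero>\<^bsub>quot_module M N\<^esub> = N +>\<^bsub>M\<^esub> \<zero>\<^bsub>M\<^esub>"
  using submoduleD(1)[OF assms] by (simp add: quot_module_simps)

lemma left_module_quot: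
  assumes N: "submodule N R M"
  shows "left_module R (quot_module M N)"
proof -
  let ?Q = "quot_module M N"
  note [simp] = quot_add_coset[OF N] quot_smult_coset[OF N] quot_zero_coset[OF N] smult_closed
  have carr: "C \<in> carrier ?Q \<longleftrightarrow> (\<exists>x\<in>carrier M. C = N +>\<^bsub>M\<^esub> x)" for C
    by (auto simp: quot_module_simps)
  have "abelian_group ?Q"
  proof (rule abelian_groupI)
    fix C assume "C \<in> carrier ?Q"
    then obtain x where x: "x \<in> carrier M" "C = N +>\<^bsub>M\<^esub> x" by (auto simp: carr)
    have "(N +>\<^bsub>M\<^esub> (\<ominus>\<^bsub>M\<^esub> x)) \<oplus>\<^bsub>?Q\<^esub> C = \<zero>\<^bsub>?Q\<^esub>"
      using x by (simp add: M.l_neg)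
    moreover have "N +>\<^bsub>M\<^esub> (\<ominus>\<^bsub>M\<^esub> x) \<in> carrier ?Q"
      using x unfolding carr by (intro bexI[where x = "\<ominus>\<^bsub>M\<^esub> x"] refl M.a_inv_closed)
    ultimately show "\<exists>D\<in>carrier ?Q. D \<oplus>\<^bsub>?Q\<^esub> C = \<zero>\<^bsub>?Q\<^esub>" by blast
  qed (auto simp: carr M.a_ac)
  then show ?thesis
    by (intro left_module.intro left_module_axioms.intro R.ring_axioms)
      (auto simp: carr smult_l_distr smult_r_distr smult_assoc smult_one)
qed

lemma linear_map_coset:
  assumes "submodule N R M"
  shows "linear_map R M (quot_module M N) (\<lambda>x. N +>\<^bsub>M\<^esub> x)"
  using assms by (intro linear_mapI) (auto simp: quot_add_coset quot_smult_coset quot_module_simps(1))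

end

lemma linear_map_quot_map:
  assumes M: "left_module R M" and M': "left_module R M'"
    and h: "linear_map R M M' h" and N: "submodule N R M" and N': "submodule N' R M'"
    and hN: "\<And>n. n \<in> N \<Longrightarrow> h n \<in> N'"
  shows "linear_map R (quot_module M N) (quot_module M' N') (quot_map M' N' h)"
proof -
  interpret M: left_module R M by fact
  interpret M': left_module R M' by fact
  note q = quot_map_coset[OF assms]
  note [simp] = linear_mapD[OF h] M.smult_closed q quot_add_coset[OF M N] quot_add_coset[OF M' N']
    quot_smult_coset[OF M N] quot_smult_coset[OF M' N']
  show ?thesis
    by (intro linear_mapI) (auto simp: quot_module_simps(1))
qed

lemma quot_module_lift:
  assumes M: "left_module R M" and V: "left_module R V"
    and h: "linear_map R M V h" and N: "submodule N R M"
    and hN: "\<And>n. n \<in> N \<Longrightarrow> h n = \<zero>\<^bsub>V\<^esub>"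
  obtains u where "linear_map R (quot_module M N) V u"
    and "\<And>x. x \<in> carrier M \<Longrightarrow> u (N +>\<^bsub>M\<^esub> x) = h x"
proof -
  interpret M: left_module R M by fact
  interpret V: left_module R V by fact
  interpret N: abelian_subgroup N M by (rule M.abelian_subgroup_submodule[OF N])
  define u where "u C = the_elem (h ` C)" for C
  have u: "u (N +>\<^bsub>M\<^esub> x) = h x" if x: "x \<in> carrier M" for x
  proof -
    have "h y = h x" if y: "y \<in> N +>\<^bsub>M\<^esub> x" for y
    proof -
      obtain n where n: "n \<in> N" "y = n \<oplus>\<^bsub>M\<^esub> x"
        using y by (auto simp: a_r_coset_def')
      have "n \<in> carrier M" using n by simp
      then show ?thesis using n x hN[OF n(1)] by (simp add: linear_mapD[OF h])
    qed
    moreover have "x \<in> N +>\<^bsub>M\<^esub> x" using x by (rule N.a_rcos_self)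
    ultimately show ?thesis unfolding u_def by (intro the_elem_image_unique) blast
  qed
  note [simp] = linear_mapD[OF h] M.smult_closed u quot_add_coset[OF M N] quot_smult_coset[OF M N]
  have "linear_map R (quot_module M N) V u"
    by (intro linear_mapI) (auto simp: quot_module_simps(1))
  from that[OF this u] show ?thesis .
qed

section \<open>Modules of families, direct sums and free modules\<close>

text \<open>
  Spaces of maps, of natural transformations and direct sums all consist of families with
  componentwise operations, and are modules for the same reason.
\<close>

lemma left_module_family:
  fixes P :: "('a, 'j \<Rightarrow> 'b) module" and M :: "'j \<Rightarrow> ('a, 'b) module"
  assumes R: "ring R" and M: "\<And>j. j \<in> I \<Longrightarrow> left_module R (M j)"
    and carr: "carrier P \<subseteq> (\<Pi>\<^sub>E j\<in>I. carrier (M j))"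
    and zero: "\<zero>\<^bsub>P\<^esub> \<in> carrier P" "\<zero>\<^bsub>P\<^esub> = (\<lambda>j\<in>I. \<zero>\<^bsub>M j\<^esub>)"
    and add: "\<And>x y. x \<in> carrier P \<Longrightarrow> y \<in> carrier P \<Longrightarrow> x \<oplus>\<^bsub>P\<^esub> y \<in> carrier P"
      "\<And>x y. x \<in> carrier P \<Longrightarrow> y \<in> carrier P \<Longrightarrow> x \<oplus>\<^bsub>P\<^esub> y = (\<lambda>j\<in>I. x j \<oplus>\<^bsub>M j\<^esub> y j)"
    and smult: "\<And>a x. a \<in> carrier R \<Longrightarrow> x \<in> carrier P \<Longrightarrow> a \<odot>\<^bsub>P\<^esub> x \<in> carrier P"
      "\<And>a x. a \<in> carrier R \<Longrightarrow> x \<in> carrier P \<Longrightarrow> a \<odot>\<^bsub>P\<^esub> x = (\<lambda>j\<in>I. a \<odot>\<^bsub>M j\<^esub> x j)"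
  shows "left_module R P"
proof -
  interpret R: ring R by fact
  have ab: "abelian_group (M j)" if "j \<in> I" for j
    using M[OF that] by (rule left_module.axioms)
  have comp: "x j \<in> carrier (M j)" if "x \<in> carrier P" "j \<in> I" for x j
    using that carr by auto
  have ext: "x = y \<longleftrightarrow> (\<forall>j\<in>I. x j = y j)" if "x \<in> carrier P" "y \<in> carrier P" for x y
    using that carr by (auto simp: PiE_iff intro!: extensionalityI[of x I y])
  have addj: "(x \<oplus>\<^bsub>P\<^esub> y) j = x j \<oplus>\<^bsub>M j\<^esub> y j" if "x \<in> carrier P" "y \<in> carrier P" "j \<in> I" for x y j
    using that by (simp add: add(2))
  have smultj: "(a \<odot>\<^bsub>P\<^esub> x) j = a \<odot>\<^bsub>M j\<^esub> x j" if "a \<in> carrier R" "x \<in> carrier P" "j \<in> I" for a x j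
    using that by (simp add: smult(2))
  have zeroj: "\<zero>\<^bsub>P\<^esub> j = \<zero>\<^bsub>M j\<^esub>" if "j \<in> I" for j
    using that by (simp add: zero(2))
  note [simp] = ext add(1) smult(1) zero(1) addj smultj zeroj comp
  have "abelian_group P"
  proof (rule abelian_groupI)
    fix x y z assume xyz: "x \<in> carrier P" "y \<in> carrier P" "z \<in> carrier P"
    show "x \<oplus>\<^bsub>P\<^esub> y \<oplus>\<^bsub>P\<^esub> z = x \<oplus>\<^bsub>P\<^esub> (y \<oplus>\<^bsub>P\<^esub> z)"
      using xyz by (simp add: abelian_monoid.a_assoc[OF abelian_group.axioms(1)[OF ab]])
  next
    fix x y assume xy: "x \<in> carrier P" "y \<in> carrier P"
    show "x \<oplus>\<^bsub>P\<^esub> y = y \<oplus>\<^bsub>P\<^esub> x"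
      using xy by (simp add: abelian_monoid.a_comm[OF abelian_group.axioms(1)[OF ab]])
  next
    fix x assume x: "x \<in> carrier P"
    show "\<zero>\<^bsub>P\<^esub> \<oplus>\<^bsub>P\<^esub> x = x"
      using x by (simp add: abelian_monoid.l_zero[OF abelian_group.axioms(1)[OF ab]])
    have "(\<ominus>\<^bsub>R\<^esub> \<one>\<^bsub>R\<^esub>) \<odot>\<^bsub>P\<^esub> x \<oplus>\<^bsub>P\<^esub> x = \<zero>\<^bsub>P\<^esub>"
      using x by (simp add: left_module.smult_minus_one[OF M] abelian_group.l_neg[OF ab])
    then show "\<exists>y\<in>carrier P. y \<oplus>\<^bsub>P\<^esub> x = \<zero>\<^bsub>P\<^esub>"
      using smult(1)[of "\<ominus>\<^bsub>R\<^esub> \<one>\<^bsub>R\<^esub>" x] x by blast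
  qed auto
  then show ?thesis
    by (intro left_module.intro left_module_axioms.intro R.ring_axioms)
      (auto simp: left_module.smult_l_distr[OF M] left_module.smult_r_distr[OF M]
        left_module.smult_assoc[OF M] left_module.smult_one[OF M])
qed

lemma direct_sum_simps:
  "x \<in> carrier (direct_sum I M) \<longleftrightarrow>
    x \<in> (\<Pi>\<^sub>E j\<in>I. carrier (M j)) \<and> finite {j \<in> I. x j \<noteq> \<zero>\<^bsub>M j\<^esub>}"
  "\<zero>\<^bsub>direct_sum I M\<^esub> = (\<lambda>j\<in>I. \<zero>\<^bsub>M j\<^esub>)"
  "x \<oplus>\<^bsub>direct_sum I M\<^esub> y = (\<lambda>j\<in>I. x j \<oplus>\<^bsub>M j\<^esub> y j)"
  "a \<odot>\<^bsub>direct_sum I M\<^esub> x = (\<lambda>j\<in>I. a \<odot>\<^bsub>M j\<^esub> x j)"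
  by (auto simp: direct_sum_def)

context
  fixes R :: "('a, 'x) ring_scheme" and I :: "'j set" and M :: "'j \<Rightarrow> ('a, 'b) module"
  assumes R: "ring R" and M: "\<And>j. j \<in> I \<Longrightarrow> left_module R (M j)"
begin

lemma summand_simps:
  assumes "j \<in> I"
  shows "\<zero>\<^bsub>M j\<^esub> \<in> carrier (M j)"
    and "x \<in> carrier (M j) \<Longrightarrow> \<zero>\<^bsub>M j\<^esub> \<oplus>\<^bsub>M j\<^esub> x = x"
    and "x \<in> carrier (M j) \<Longrightarrow> x \<oplus>\<^bsub>M j\<^esub> \<zero>\<^bsub>M j\<^esub> = x"
    and "x \<in> carrier (M j) \<Longrightarrow> y \<in> carrier (M j) \<Longrightarrow> x \<oplus>\<^bsub>M j\<^esub> y \<in> carrier (M j)"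
    and "a \<in> carrier R \<Longrightarrow> x \<in> carrier (M j) \<Longrightarrow> a \<odot>\<^bsub>M j\<^esub> x \<in> carrier (M j)"
    and "a \<in> carrier R \<Longrightarrow> a \<odot>\<^bsub>M j\<^esub> \<zero>\<^bsub>M j\<^esub> = \<zero>\<^bsub>M j\<^esub>"
proof -
  interpret left_module R "M j" by (rule M) fact
  show "\<zero>\<^bsub>M j\<^esub> \<in> carrier (M j)" "x \<in> carrier (M j) \<Longrightarrow> \<zero>\<^bsub>M j\<^esub> \<oplus>\<^bsub>M j\<^esub> x = x"
    "x \<in> carrier (M j) \<Longrightarrow> x \<oplus>\<^bsub>M j\<^esub> \<zero>\<^bsub>M j\<^esub> = x"
    "x \<in> carrier (M j) \<Longrightarrow> y \<in> carrier (M j) \<Longrightarrow> x \<oplus>\<^bsub>M j\<^esub> y \<in> carrier (M j)"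
    "a \<in> carrier R \<Longrightarrow> x \<in> carrier (M j) \<Longrightarrow> a \<odot>\<^bsub>M j\<^esub> x \<in> carrier (M j)"
    "a \<in> carrier R \<Longrightarrow> a \<odot>\<^bsub>M j\<^esub> \<zero>\<^bsub>M j\<^esub> = \<zero>\<^bsub>M j\<^esub>"
    by (simp_all add: smult_r_null smult_closed)
qed

lemma left_module_direct_sum: "left_module R (direct_sum I M)"
proof (rule left_module_family[where I = I and M = M, OF R M])
  let ?D = "direct_sum I M"
  show "carrier ?D \<subseteq> (\<Pi>\<^sub>E j\<in>I. carrier (M j))"
    by (auto simp: direct_sum_simps)
  show "\<zero>\<^bsub>?D\<^esub> \<in> carrier ?D"
    by (auto simp: direct_sum_simps summand_simps)
  fix x y assume xy: "x \<in> carrier ?D" "y \<in> carrier ?D"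
  have "{j \<in> I. (\<lambda>j\<in>I. x j \<oplus>\<^bsub>M j\<^esub> y j) j \<noteq> \<zero>\<^bsub>M j\<^esub>}
      \<subseteq> {j \<in> I. x j \<noteq> \<zero>\<^bsub>M j\<^esub>} \<union> {j \<in> I. y j \<noteq> \<zero>\<^bsub>M j\<^esub>}"
    using summand_simps by auto
  then have "finite {j \<in> I. (\<lambda>j\<in>I. x j \<oplus>\<^bsub>M j\<^esub> y j) j \<noteq> \<zero>\<^bsub>M j\<^esub>}"
    by (rule finite_subset) (use xy in \<open>auto simp: direct_sum_simps\<close>)
  then show "x \<oplus>\<^bsub>?D\<^esub> y \<in> carrier ?D"
    using xy unfolding direct_sum_simps by (auto simp: summand_simps PiE_iff)
next
  let ?D = "direct_sum I M"
  fix a x assume ax: "a \<in> carrier R" "x \<in> carrier ?D"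
  have "{j \<in> I. (\<lambda>j\<in>I. a \<odot>\<^bsub>M j\<^esub> x j) j \<noteq> \<zero>\<^bsub>M j\<^esub>} \<subseteq> {j \<in> I. x j \<noteq> \<zero>\<^bsub>M j\<^esub>}"
    using summand_simps ax by auto
  then have "finite {j \<in> I. (\<lambda>j\<in>I. a \<odot>\<^bsub>M j\<^esub> x j) j \<noteq> \<zero>\<^bsub>M j\<^esub>}"
    by (rule finite_subset) (use ax in \<open>auto simp: direct_sum_simps\<close>)
  then show "a \<odot>\<^bsub>?D\<^esub> x \<in> carrier ?D"
    using ax unfolding direct_sum_simps by (auto simp: summand_simps PiE_iff)
qed (auto simp: direct_sum_simps)

lemma linear_map_sum_inj:
  assumes "j \<in> I"
  shows "linear_map R (M j) (direct_sum I M) (sum_inj I M j)"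
proof (rule linear_mapI)
  fix t assume "t \<in> carrier (M j)"
  moreover have "{l \<in> I. (\<lambda>l\<in>I. if l = j then t else \<zero>\<^bsub>M l\<^esub>) l \<noteq> \<zero>\<^bsub>M l\<^esub>} \<subseteq> {j}"
    by auto
  then have "finite {l \<in> I. (\<lambda>l\<in>I. if l = j then t else \<zero>\<^bsub>M l\<^esub>) l \<noteq> \<zero>\<^bsub>M l\<^esub>}"
    by (rule finite_subset) simp
  ultimately show "sum_inj I M j t \<in> carrier (direct_sum I M)"
    unfolding direct_sum_simps sum_inj_def by (auto simp: summand_simps)
qed (auto simp: direct_sum_simps sum_inj_def summand_simps fun_eq_iff)

text \<open>
  Induction on the support: clearing one coordinate of \<open>x\<close> subtracts a member of that summand.
\<close>

lemma direct_sum_generated: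
  assumes H: "submodule H R (direct_sum I M)"
    and inj: "\<And>j t. j \<in> I \<Longrightarrow> t \<in> carrier (M j) \<Longrightarrow> sum_inj I M j t \<in> H"
    and x: "x \<in> carrier (direct_sum I M)"
  shows "x \<in> H"
proof -
  have "\<forall>x \<in> carrier (direct_sum I M). {j \<in> I. x j \<noteq> \<zero>\<^bsub>M j\<^esub>} \<subseteq> S \<longrightarrow> x \<in> H" if "finite S" for S
    using that
  proof (induction S)
    case empty
    have "x = \<zero>\<^bsub>direct_sum I M\<^esub>"
      if "x \<in> carrier (direct_sum I M)" "{j \<in> I. x j \<noteq> \<zero>\<^bsub>M j\<^esub>} \<subseteq> {}" for x
      using that by (auto simp: direct_sum_simps PiE_iff intro!: extensionalityI[of x I])
    then show ?case using submoduleD(2)[OF H] by blast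
  next
    case (insert s S)
    show ?case
    proof (intro ballI impI)
      fix x assume x: "x \<in> carrier (direct_sum I M)" and
        supp: "{j \<in> I. x j \<noteq> \<zero>\<^bsub>M j\<^esub>} \<subseteq> insert s S"
      show "x \<in> H"
      proof (cases "s \<in> I")
        case False
        then show ?thesis using x supp insert.IH by blast
      next
        case s: True
        let ?y = "x(s := \<zero>\<^bsub>M s\<^esub>)"
        have "{j \<in> I. ?y j \<noteq> \<zero>\<^bsub>M j\<^esub>} \<subseteq> {j \<in> I. x j \<noteq> \<zero>\<^bsub>M j\<^esub>}" by auto
        then have "finite {j \<in> I. ?y j \<noteq> \<zero>\<^bsub>M j\<^esub>}"
          by (rule finite_subset) (use x in \<open>simp add: direct_sum_simps\<close>)
        then have y: "?y \<in> carrier (direct_sum I M)"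
          using x s summand_simps(1)[OF s] unfolding direct_sum_simps by (auto simp: PiE_iff extensional_def)
        moreover have "{j \<in> I. ?y j \<noteq> \<zero>\<^bsub>M j\<^esub>} \<subseteq> S" using supp by auto
        ultimately have "?y \<in> H" using insert.IH by blast
        moreover have xs: "x s \<in> carrier (M s)" using x s by (auto simp: direct_sum_simps)
        moreover have "x = ?y \<oplus>\<^bsub>direct_sum I M\<^esub> sum_inj I M s (x s)"
          using x y s by (intro extensionalityI[of x I])
            (auto simp: direct_sum_simps sum_inj_def summand_simps PiE_iff)
        ultimately show ?thesis using submoduleD(3)[OF H] inj[OF s xs] by metis
      qed
    qed
  qed
  then show ?thesis using x by (auto simp: direct_sum_simps)
qed

text \<open>
  The value at \<open>x\<close> is a sum over the support of \<open>x\<close>. For additivity, the three supports involved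
  are enlarged to one finite set, which adds only zero terms.
\<close>

lemma direct_sum_lift:
  assumes V: "left_module R V" and h: "\<And>j. j \<in> I \<Longrightarrow> linear_map R (M j) V (h j)"
  obtains u where "linear_map R (direct_sum I M) V u"
    and "\<And>j t. j \<in> I \<Longrightarrow> t \<in> carrier (M j) \<Longrightarrow> u (sum_inj I M j t) = h j t"
proof -
  interpret V: left_module R V by fact
  note D = linear_mapD[OF linear_map_sum_inj]
  define u where "u x = (\<Oplus>\<^bsub>V\<^esub>j\<in>{j \<in> I. x j \<noteq> \<zero>\<^bsub>M j\<^esub>}. h j (x j))" for x
  have hc: "h j (x j) \<in> carrier V" if "x \<in> carrier (direct_sum I M)" "j \<in> I" for x j
    using that linear_mapD(1)[OF h] by (auto simp: direct_sum_simps)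
  have u: "u x = (\<Oplus>\<^bsub>V\<^esub>j\<in>T. h j (x j))"
    if x: "x \<in> carrier (direct_sum I M)" and T: "finite T" "T \<subseteq> I" "{j \<in> I. x j \<noteq> \<zero>\<^bsub>M j\<^esub>} \<subseteq> T" for x T
    unfolding u_def using T x hc[OF x]
    by (intro V.add.finprod_mono_neutral_cong_left) (auto simp: linear_map_zero[OF M V h] subset_iff)
  have uc: "u x \<in> carrier V" if x: "x \<in> carrier (direct_sum I M)" for x
    unfolding u_def using hc[OF x] by (intro V.finsum_closed) auto
  have "linear_map R (direct_sum I M) V u"
  proof (rule linear_mapI)
    fix x y assume x: "x \<in> carrier (direct_sum I M)" and y: "y \<in> carrier (direct_sum I M)"
    let ?T = "{j \<in> I. x j \<noteq> \<zero>\<^bsub>M j\<^esub>} \<union> {j \<in> I. y j \<noteq> \<zero>\<^bsub>M j\<^esub>}"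
    have xy: "x \<oplus>\<^bsub>direct_sum I M\<^esub> y \<in> carrier (direct_sum I M)"
      using x y left_module_direct_sum
      by (intro abelian_monoid.a_closed abelian_group.axioms(1) left_module.axioms(2))
    have T: "finite ?T" "?T \<subseteq> I" using x y by (auto simp: direct_sum_simps)
    have sub: "{j \<in> I. (x \<oplus>\<^bsub>direct_sum I M\<^esub> y) j \<noteq> \<zero>\<^bsub>M j\<^esub>} \<subseteq> ?T"
      using summand_simps by (auto simp: direct_sum_simps)
    have "u (x \<oplus>\<^bsub>direct_sum I M\<^esub> y) = (\<Oplus>\<^bsub>V\<^esub>j\<in>?T. h j ((x \<oplus>\<^bsub>direct_sum I M\<^esub> y) j))"
      by (rule u[OF xy T sub])
    also have "\<dots> = (\<Oplus>\<^bsub>V\<^esub>j\<in>?T. h j (x j) \<oplus>\<^bsub>V\<^esub> h j (y j))"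
      using x y hc[OF x] hc[OF y]
      by (intro V.finsum_cong') (auto simp: direct_sum_simps PiE_iff linear_mapD(2)[OF h])
    also have "\<dots> = (\<Oplus>\<^bsub>V\<^esub>j\<in>?T. h j (x j)) \<oplus>\<^bsub>V\<^esub> (\<Oplus>\<^bsub>V\<^esub>j\<in>?T. h j (y j))"
      using hc[OF x] hc[OF y] by (intro V.finsum_addf) auto
    also have "\<dots> = u x \<oplus>\<^bsub>V\<^esub> u y"
      using u[OF x T] u[OF y T] by simp
    finally show "u (x \<oplus>\<^bsub>direct_sum I M\<^esub> y) = u x \<oplus>\<^bsub>V\<^esub> u y" .
  next
    fix a x assume a: "a \<in> carrier R" and x: "x \<in> carrier (direct_sum I M)"
    let ?T = "{j \<in> I. x j \<noteq> \<zero>\<^bsub>M j\<^esub>}"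
    have ax: "a \<odot>\<^bsub>direct_sum I M\<^esub> x \<in> carrier (direct_sum I M)"
      using a x left_module_direct_sum by (intro left_module.smult_closed)
    have T: "finite ?T" "?T \<subseteq> I" using x by (auto simp: direct_sum_simps)
    have sub: "{j \<in> I. (a \<odot>\<^bsub>direct_sum I M\<^esub> x) j \<noteq> \<zero>\<^bsub>M j\<^esub>} \<subseteq> ?T"
      using summand_simps a by (auto simp: direct_sum_simps)
    have "a \<odot>\<^bsub>V\<^esub> (\<Oplus>\<^bsub>V\<^esub>j\<in>S. h j (x j)) = (\<Oplus>\<^bsub>V\<^esub>j\<in>S. a \<odot>\<^bsub>V\<^esub> h j (x j))"
      if "finite S" "S \<subseteq> I" for S
      using that
    proof (induction S)
      case empty
      then show ?case using a by (simp add: V.smult_r_null)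
    next
      case (insert s S)
      then have "(\<lambda>j. h j (x j)) \<in> insert s S \<rightarrow> carrier V" using hc[OF x] by auto
      then show ?case
        using insert a by (simp add: Pi_iff V.smult_r_distr V.smult_closed)
    qed
    note scale = this[OF T]
    have "u (a \<odot>\<^bsub>direct_sum I M\<^esub> x) = (\<Oplus>\<^bsub>V\<^esub>j\<in>?T. h j ((a \<odot>\<^bsub>direct_sum I M\<^esub> x) j))"
      by (rule u[OF ax T sub])
    also have "\<dots> = (\<Oplus>\<^bsub>V\<^esub>j\<in>?T. a \<odot>\<^bsub>V\<^esub> h j (x j))"
      using a x hc[OF x]
      by (intro V.finsum_cong') (auto simp: direct_sum_simps PiE_iff linear_mapD(3)[OF h] V.smult_closed)
    also have "\<dots> = a \<odot>\<^bsub>V\<^esub> u x" using scale by (simp add: u_def)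
    finally show "u (a \<odot>\<^bsub>direct_sum I M\<^esub> x) = a \<odot>\<^bsub>V\<^esub> u x" .
  qed (rule uc)
  moreover have "u (sum_inj I M j t) = h j t" if j: "j \<in> I" and t: "t \<in> carrier (M j)" for j t
  proof -
    have "u (sum_inj I M j t) = (\<Oplus>\<^bsub>V\<^esub>l\<in>{j}. h l (sum_inj I M j t l))"
      using j t by (intro u D) (auto simp: sum_inj_def)
    also have "\<dots> = h j t"
      using j t linear_mapD(1)[OF h] by (simp add: sum_inj_def)
    finally show ?thesis .
  qed
  ultimately show ?thesis by (rule that)
qed

end

text \<open>
  Finite support is preserved because a linear map sends zero to zero.
\<close>

lemma linear_map_direct_sum_map:
  assumes R: "ring R" and M: "\<And>j. j \<in> I \<Longrightarrow> left_module R (M j)"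
    and N: "\<And>j. j \<in> I \<Longrightarrow> left_module R (N j)"
    and h: "\<And>j. j \<in> I \<Longrightarrow> linear_map R (M j) (N j) (h j)"
  shows "linear_map R (direct_sum I M) (direct_sum I N) (\<lambda>x. \<lambda>j\<in>I. h j (x j))"
    and "j \<in> I \<Longrightarrow> (\<lambda>l\<in>I. h l (sum_inj I M j t l)) = sum_inj I N j (h j t)"
proof -
  note z = linear_map_zero[OF M N h]
  show "linear_map R (direct_sum I M) (direct_sum I N) (\<lambda>x. \<lambda>j\<in>I. h j (x j))"
  proof (rule linear_mapI)
    fix x assume x: "x \<in> carrier (direct_sum I M)"
    have "{j \<in> I. (\<lambda>j\<in>I. h j (x j)) j \<noteq> \<zero>\<^bsub>N j\<^esub>} \<subseteq> {j \<in> I. x j \<noteq> \<zero>\<^bsub>M j\<^esub>}"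
      by (auto simp: z)
    then have "finite {j \<in> I. (\<lambda>j\<in>I. h j (x j)) j \<noteq> \<zero>\<^bsub>N j\<^esub>}"
      by (rule finite_subset) (use x in \<open>simp add: direct_sum_simps\<close>)
    then show "(\<lambda>j\<in>I. h j (x j)) \<in> carrier (direct_sum I N)"
      using x unfolding direct_sum_simps by (auto simp: PiE_iff linear_mapD(1)[OF h])
  qed (auto simp: direct_sum_simps PiE_iff linear_mapD[OF h] fun_eq_iff restrict_def)
  show "(\<lambda>l\<in>I. h l (sum_inj I M j t l)) = sum_inj I N j (h j t)" if "j \<in> I"
    by (auto simp: sum_inj_def z fun_eq_iff restrict_def)
qed

text \<open>
  A free module is the direct sum of copies of the ring; over the index set \<open>UNIV\<close> the summands
  outside \<open>S\<close> have to be trivial.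
\<close>

definition free_summand :: "'k ring \<Rightarrow> 's set \<Rightarrow> 's \<Rightarrow> ('k, 'k) module"
  where "free_summand K S p =
    \<lparr>carrier = (if p \<in> S then carrier K else {\<zero>\<^bsub>K\<^esub>}), mult = undefined, one = undefined,
     zero = \<zero>\<^bsub>K\<^esub>, add = add K, smult = mult K\<rparr>"

lemma free_module_direct_sum:
  assumes "ring K"
  shows "free_module K S = direct_sum UNIV (free_summand K S)"
proof -
  interpret ring K by fact
  have "c p \<in> carrier (free_summand K S p) \<longleftrightarrow> c p \<in> carrier K \<and> (c p \<noteq> \<zero>\<^bsub>K\<^esub> \<longrightarrow> p \<in> S)" for c p
    by (auto simp: free_summand_def)
  moreover have zero_summand: "\<zero>\<^bsub>free_summand K S p\<^esub> = \<zero>\<^bsub>K\<^esub>" for p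
    by (simp add: free_summand_def)
  ultimately have "carrier (free_module K S) = carrier (direct_sum UNIV (free_summand K S))"
    unfolding free_module_def direct_sum_def PiE_UNIV_domain Pi_iff
    by (simp add: zero_summand) blast
  then show ?thesis
    by (simp add: free_module_def direct_sum_def free_summand_def restrict_def)
qed

lemma free_gen_sum_inj: "free_gen K s = sum_inj UNIV (free_summand K S) s \<one>\<^bsub>K\<^esub>"
  by (auto simp: free_gen_def sum_inj_def free_summand_def)

lemma left_module_free_summand:
  assumes "ring K"
  shows "left_module K (free_summand K S p)"
proof -
  interpret ring K by fact
  have "\<exists>y\<in>if p \<in> S then carrier K else {\<zero>\<^bsub>K\<^esub>}. y \<oplus>\<^bsub>K\<^esub> x = \<zero>\<^bsub>K\<^esub>"
    if "x \<in> (if p \<in> S then carrier K else {\<zero>\<^bsub>K\<^esub>})" for x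
    using that by (intro bexI[of _ "\<ominus>\<^bsub>K\<^esub> x"]) (auto simp: l_neg split: if_splits)
  then show ?thesis
    by (intro left_module.intro left_module_axioms.intro abelian_groupI ring_axioms)
      (auto simp: free_summand_def a_ac l_distr r_distr m_assoc split: if_splits)
qed

lemma left_module_free: "ring K \<Longrightarrow> left_module K (free_module K S)"
  by (simp add: free_module_direct_sum) (intro left_module_direct_sum left_module_free_summand)

lemma free_gen_closed:
  assumes "ring K" "s \<in> S"
  shows "free_gen K s \<in> carrier (free_module K S)"
  using assms ring.ring_simprules(6)[OF assms(1)]
  unfolding free_module_direct_sum[OF assms(1)] free_gen_sum_inj[of K s S]
  by (intro linear_mapD(1)[OF linear_map_sum_inj[OF assms(1) left_module_free_summand[OF assms(1)]]])
    (simp_all add: free_summand_def)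

lemma free_module_lift:
  assumes V: "left_module K V" and g: "\<And>s. s \<in> S \<Longrightarrow> g s \<in> carrier V"
  obtains u where "linear_map K (free_module K S) V u"
    and "\<And>s. s \<in> S \<Longrightarrow> u (free_gen K s) = g s"
proof -
  interpret V: left_module K V by fact
  have K: "ring K" by (rule V.R.ring_axioms)
  have h: "linear_map K (free_summand K S p) V (\<lambda>r. if p \<in> S then r \<odot>\<^bsub>V\<^esub> g p else \<zero>\<^bsub>V\<^esub>)" for p
    by (rule linear_mapI) (auto simp: free_summand_def g V.smult_closed V.smult_l_distr
        V.smult_assoc V.smult_r_null)
  obtain u where u: "linear_map K (free_module K S) V u"
    "\<And>p r. r \<in> carrier (free_summand K S p) \<Longrightarrow>
      u (sum_inj UNIV (free_summand K S) p r) = (if p \<in> S then r \<odot>\<^bsub>V\<^esub> g p else \<zero>\<^bsub>V\<^esub>)"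
    using direct_sum_lift[where M = "free_summand K S", OF K left_module_free_summand[OF K] V h, of UNIV]
    unfolding free_module_direct_sum[OF K] by auto
  have "u (free_gen K s) = g s" if "s \<in> S" for s
    unfolding free_gen_sum_inj[of K s S] using that u(2)[of "\<one>\<^bsub>K\<^esub>" s] g
    by (simp add: free_summand_def V.smult_one)
  with u(1) show ?thesis by (rule that)
qed

lemma free_module_generated:
  assumes K: "ring K" and H: "submodule H K (free_module K S)"
    and gen: "\<And>s. s \<in> S \<Longrightarrow> free_gen K s \<in> H" and x: "x \<in> carrier (free_module K S)"
  shows "x \<in> H"
proof -
  interpret K: ring K by fact
  have "sum_inj UNIV (free_summand K S) p r \<in> H" if r: "r \<in> carrier (free_summand K S p)" for p r
  proof (cases "p \<in> S")
    case True
    then have "r \<odot>\<^bsub>free_module K S\<^esub> free_gen K p \<in> H"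
      using submoduleD(4)[OF H _ gen] r by (simp add: free_summand_def)
    also have "r \<odot>\<^bsub>free_module K S\<^esub> free_gen K p = sum_inj UNIV (free_summand K S) p r"
      using r True by (auto simp: free_module_def free_gen_def sum_inj_def free_summand_def)
    finally show ?thesis .
  next
    case False
    then have "sum_inj UNIV (free_summand K S) p r = \<zero>\<^bsub>free_module K S\<^esub>"
      using r by (auto simp: free_module_def sum_inj_def free_summand_def)
    then show ?thesis using submoduleD(2)[OF H] by simp
  qed
  then show ?thesis
    by (intro direct_sum_generated[where M = "free_summand K S", OF K left_module_free_summand[OF K],
          OF H[unfolded free_module_direct_sum[OF K]] _ x[unfolded free_module_direct_sum[OF K]]])
qed

text \<open>
  The sum over a fibre of \<open>h\<close> may be taken in any finite set that contains the support, so that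
  two elements can be compared over a common index set.
\<close>

lemma linear_map_free_map:
  assumes K: "ring K" and h: "\<And>s. s \<in> S \<Longrightarrow> h s \<in> T"
  shows "linear_map K (free_module K S) (free_module K T) (free_map K h)"
    and "s \<in> S \<Longrightarrow> free_map K h (free_gen K s) = free_gen K (h s)"
proof -
  interpret K: ring K by fact
  note F = free_module_def
  have fm: "free_map K h c q = (\<Oplus>\<^bsub>K\<^esub>p\<in>{p \<in> X. h p = q}. c p)"
    if "c \<in> carrier (free_module K S)" "finite X" "{p. c p \<noteq> \<zero>\<^bsub>K\<^esub>} \<subseteq> X" for c q X
    unfolding free_map_def using that
    by (intro K.add.finprod_mono_neutral_cong_left) (auto simp: F)
  have cK: "c p \<in> carrier K" if "c \<in> carrier (free_module K S)" for c p
    using that by (simp add: F)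
  have supp: "finite {p. c p \<noteq> \<zero>\<^bsub>K\<^esub>}" if "c \<in> carrier (free_module K S)" for c
    using that by (simp add: F)
  show "linear_map K (free_module K S) (free_module K T) (free_map K h)"
  proof (rule linear_mapI)
    fix c assume c: "c \<in> carrier (free_module K S)"
    have "{q. free_map K h c q \<noteq> \<zero>\<^bsub>K\<^esub>} \<subseteq> h ` {p. c p \<noteq> \<zero>\<^bsub>K\<^esub>}"
    proof
      fix q assume q: "q \<in> {q. free_map K h c q \<noteq> \<zero>\<^bsub>K\<^esub>}"
      show "q \<in> h ` {p. c p \<noteq> \<zero>\<^bsub>K\<^esub>}"
      proof (rule ccontr)
        assume "q \<notin> h ` {p. c p \<noteq> \<zero>\<^bsub>K\<^esub>}"
        then have "{p. c p \<noteq> \<zero>\<^bsub>K\<^esub> \<and> h p = q} = {}" by auto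
        with q show False by (simp add: free_map_def)
      qed
    qed
    moreover have "h ` {p. c p \<noteq> \<zero>\<^bsub>K\<^esub>} \<subseteq> T" using c h by (auto simp: F)
    moreover have "free_map K h c q \<in> carrier K" for q
      unfolding free_map_def using cK[OF c] by (intro K.finsum_closed) auto
    ultimately show "free_map K h c \<in> carrier (free_module K T)"
      using finite_subset[OF _ finite_imageI[OF supp[OF c]]] by (simp add: F subset_trans)
  next
    fix c d assume c: "c \<in> carrier (free_module K S)" and d: "d \<in> carrier (free_module K S)"
    let ?X = "{p. c p \<noteq> \<zero>\<^bsub>K\<^esub>} \<union> {p. d p \<noteq> \<zero>\<^bsub>K\<^esub>}"
    have X: "finite ?X" using supp c d by simp
    have cd: "c \<oplus>\<^bsub>free_module K S\<^esub> d \<in> carrier (free_module K S)"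
      using c d left_module_free[OF K]
      by (intro abelian_monoid.a_closed abelian_group.axioms(1) left_module.axioms(2))
    show "free_map K h (c \<oplus>\<^bsub>free_module K S\<^esub> d) = free_map K h c \<oplus>\<^bsub>free_module K T\<^esub> free_map K h d"
    proof
      fix q
      have "free_map K h (c \<oplus>\<^bsub>free_module K S\<^esub> d) q
          = (\<Oplus>\<^bsub>K\<^esub>p\<in>{p \<in> ?X. h p = q}. (c \<oplus>\<^bsub>free_module K S\<^esub> d) p)"
        by (rule fm[OF cd X]) (auto simp: F)
      also have "\<dots> = (\<Oplus>\<^bsub>K\<^esub>p\<in>{p \<in> ?X. h p = q}. c p) \<oplus>\<^bsub>K\<^esub> (\<Oplus>\<^bsub>K\<^esub>p\<in>{p \<in> ?X. h p = q}. d p)"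
        using cK[OF c] cK[OF d] by (simp add: F K.finsum_addf)
      also have "\<dots> = (free_map K h c \<oplus>\<^bsub>free_module K T\<^esub> free_map K h d) q"
        using fm[OF c X] fm[OF d X] by (simp add: F)
      finally show "free_map K h (c \<oplus>\<^bsub>free_module K S\<^esub> d) q = \<dots>" .
    qed
  next
    fix r c assume r: "r \<in> carrier K" and c: "c \<in> carrier (free_module K S)"
    let ?X = "{p. c p \<noteq> \<zero>\<^bsub>K\<^esub>}"
    have X: "finite ?X" using supp c by simp
    have rc: "r \<odot>\<^bsub>free_module K S\<^esub> c \<in> carrier (free_module K S)"
      using r c left_module_free[OF K] by (intro left_module.smult_closed)
    have sub: "{p. r \<otimes>\<^bsub>K\<^esub> c p \<noteq> \<zero>\<^bsub>K\<^esub>} \<subseteq> ?X"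
      using r by auto
    show "free_map K h (r \<odot>\<^bsub>free_module K S\<^esub> c) = r \<odot>\<^bsub>free_module K T\<^esub> free_map K h c"
    proof
      fix q
      have "free_map K h (r \<odot>\<^bsub>free_module K S\<^esub> c) q
          = (\<Oplus>\<^bsub>K\<^esub>p\<in>{p \<in> ?X. h p = q}. r \<otimes>\<^bsub>K\<^esub> c p)"
        using fm[OF rc X, of q] sub by (simp add: F)
      also have "\<dots> = r \<otimes>\<^bsub>K\<^esub> (\<Oplus>\<^bsub>K\<^esub>p\<in>{p \<in> ?X. h p = q}. c p)"
        using cK[OF c] r X by (intro K.finsum_rdistr[symmetric]) auto
      also have "\<dots> = (r \<odot>\<^bsub>free_module K T\<^esub> free_map K h c) q"
        using fm[OF c X] by (simp add: F)
      finally show "free_map K h (r \<odot>\<^bsub>free_module K S\<^esub> c) q = \<dots>" .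
    qed
  qed
  assume s: "s \<in> S"
  show "free_map K h (free_gen K s) = free_gen K (h s)"
  proof
    fix q
    have "free_map K h (free_gen K s) q = (\<Oplus>\<^bsub>K\<^esub>p\<in>{p \<in> {s}. h p = q}. free_gen K s p)"
      by (rule fm[OF free_gen_closed[OF K s]]) (auto simp: free_gen_def)
    also have "{p \<in> {s}. h p = q} = (if h s = q then {s} else {})" by auto
    finally show "free_map K h (free_gen K s) q = free_gen K (h s) q"
      by (auto simp: free_gen_def)
  qed
qed

section \<open>Tensor products\<close>

abbreviation tensor_free ::
    "'k ring \<Rightarrow> ('k, 'm) module \<Rightarrow> ('k, 'n) module \<Rightarrow> ('k, 'm \<times> 'n \<Rightarrow> 'k) module"
  where "tensor_free K M N \<equiv> free_module K (carrier M \<times> carrier N)"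

text \<open>
  Stated inductively, so that the four kinds of generators of \<^const>\<open>tensor_rel\<close> have introduction
  and case rules.
\<close>

inductive_set tensor_relators ::
    "'k ring \<Rightarrow> ('k, 'm) module \<Rightarrow> ('k, 'n) module \<Rightarrow> ('m \<times> 'n \<Rightarrow> 'k) set"
  for K :: "'k ring" and M :: "('k, 'm) module" and N :: "('k, 'n) module"
  where
    add_left: "\<lbrakk>x \<in> carrier M; x' \<in> carrier M; y \<in> carrier N\<rbrakk> \<Longrightarrow>
      free_gen K (x \<oplus>\<^bsub>M\<^esub> x', y) \<ominus>\<^bsub>tensor_free K M N\<^esub>
        (free_gen K (x, y) \<oplus>\<^bsub>tensor_free K M N\<^esub> free_gen K (x', y))
      \<in> tensor_relators K M N"
  | add_right: "\<lbrakk>x \<in> carrier M; y \<in> carrier N; y' \<in> carrier N\<rbrakk> \<Longrightarrow>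
      free_gen K (x, y \<oplus>\<^bsub>N\<^esub> y') \<ominus>\<^bsub>tensor_free K M N\<^esub>
        (free_gen K (x, y) \<oplus>\<^bsub>tensor_free K M N\<^esub> free_gen K (x, y'))
      \<in> tensor_relators K M N"
  | smult_left: "\<lbrakk>c \<in> carrier K; x \<in> carrier M; y \<in> carrier N\<rbrakk> \<Longrightarrow>
      free_gen K (c \<odot>\<^bsub>M\<^esub> x, y) \<ominus>\<^bsub>tensor_free K M N\<^esub>
        (c \<odot>\<^bsub>tensor_free K M N\<^esub> free_gen K (x, y))
      \<in> tensor_relators K M N"
  | smult_right: "\<lbrakk>c \<in> carrier K; x \<in> carrier M; y \<in> carrier N\<rbrakk> \<Longrightarrow>
      free_gen K (x, c \<odot>\<^bsub>N\<^esub> y) \<ominus>\<^bsub>tensor_free K M N\<^esub>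
        (c \<odot>\<^bsub>tensor_free K M N\<^esub> free_gen K (x, y))
      \<in> tensor_relators K M N"

lemma tensor_rel_span:
  "tensor_rel K M N =
    span_module (tensor_free K M N) K (tensor_relators K M N)"
  unfolding tensor_rel_def Let_def
  apply (rule arg_cong[of _ _ "span_module (tensor_free K M N) K"])
  apply (rule subset_antisym; rule subsetI)
  subgoal by (elim UnE) (blast intro: tensor_relators.intros)+
  subgoal by (erule tensor_relators.cases; blast)
  done

context
  fixes K :: "'k ring" and M :: "('k, 'm) module" and N :: "('k, 'n) module"
  assumes M: "left_module K M" and N: "left_module K N"
begin

interpretation M: left_module K M by (rule M)
interpretation N: left_module K N by (rule N)

interpretation E: left_module K "tensor_free K M N" by (intro left_module_free M.R.ring_axioms)

lemma tensor_relators_closed: "tensor_relators K M N \<subseteq> carrier (tensor_free K M N)"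
  by (auto elim!: tensor_relators.cases simp: free_gen_closed[OF M.R.ring_axioms]
      M.smult_closed N.smult_closed E.smult_closed intro!: E.M.minus_closed E.M.a_closed)

lemma submodule_tensor_rel: "submodule (tensor_rel K M N) K (tensor_free K M N)"
  unfolding tensor_rel_span by (intro submodule_span E.left_module_axioms tensor_relators_closed)

lemma left_module_tensor: "left_module K (tensor K M N)"
  unfolding tensor_def by (intro left_module_quot E.left_module_axioms submodule_tensor_rel)

interpretation T: left_module K "tensor K M N" by (rule left_module_tensor)

lemma linear_map_tensor_coset:
  "linear_map K (tensor_free K M N) (tensor K M N) (\<lambda>e. tensor_rel K M N +>\<^bsub>tensor_free K M N\<^esub> e)"
  unfolding tensor_def by (intro linear_map_coset E.left_module_axioms submodule_tensor_rel)

lemma pure_tensor_closed: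
  "x \<in> carrier M \<Longrightarrow> y \<in> carrier N \<Longrightarrow> pure_tensor K M N x y \<in> carrier (tensor K M N)"
  unfolding pure_tensor_def
  by (intro linear_mapD(1)[OF linear_map_tensor_coset] free_gen_closed M.R.ring_axioms) simp

lemma pure_tensor_linear_left:
  assumes "y \<in> carrier N"
  shows "linear_map K M (tensor K M N) (\<lambda>x. pure_tensor K M N x y)"
proof (rule linear_mapI)
  note gen = free_gen_closed[OF M.R.ring_axioms]
  note L = linear_mapD[OF linear_map_tensor_coset]
  fix x x' assume x: "x \<in> carrier M" "x' \<in> carrier M"
  have "free_gen K (x \<oplus>\<^bsub>M\<^esub> x', y) \<ominus>\<^bsub>tensor_free K M N\<^esub> (free_gen K (x, y) \<oplus>\<^bsub>tensor_free K M N\<^esub> free_gen K (x', y)) \<in> tensor_rel K M N"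
    unfolding tensor_rel_span
    by (rule subsetD[OF span_module_superset tensor_relators.add_left]) fact+
  then have "pure_tensor K M N (x \<oplus>\<^bsub>M\<^esub> x') y =
      tensor_rel K M N +>\<^bsub>tensor_free K M N\<^esub> (free_gen K (x, y) \<oplus>\<^bsub>tensor_free K M N\<^esub> free_gen K (x', y))"
    unfolding pure_tensor_def using x assms
    by (subst coset_eq_iff[OF E.left_module_axioms submodule_tensor_rel]) (auto simp: gen)
  then show "pure_tensor K M N (x \<oplus>\<^bsub>M\<^esub> x') y =
      pure_tensor K M N x y \<oplus>\<^bsub>tensor K M N\<^esub> pure_tensor K M N x' y"
    using x assms by (simp add: L gen pure_tensor_def)
next
  note gen = free_gen_closed[OF M.R.ring_axioms]
  note L = linear_mapD[OF linear_map_tensor_coset]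
  fix c x assume x: "c \<in> carrier K" "x \<in> carrier M"
  have "free_gen K (c \<odot>\<^bsub>M\<^esub> x, y) \<ominus>\<^bsub>tensor_free K M N\<^esub> (c \<odot>\<^bsub>tensor_free K M N\<^esub> free_gen K (x, y)) \<in> tensor_rel K M N"
    unfolding tensor_rel_span
    by (rule subsetD[OF span_module_superset tensor_relators.smult_left]) fact+
  then have "pure_tensor K M N (c \<odot>\<^bsub>M\<^esub> x) y = tensor_rel K M N +>\<^bsub>tensor_free K M N\<^esub> (c \<odot>\<^bsub>tensor_free K M N\<^esub> free_gen K (x, y))"
    unfolding pure_tensor_def using x assms
    by (subst coset_eq_iff[OF E.left_module_axioms submodule_tensor_rel])
      (auto simp: gen M.smult_closed E.smult_closed)
  then show "pure_tensor K M N (c \<odot>\<^bsub>M\<^esub> x) y = c \<odot>\<^bsub>tensor K M N\<^esub> pure_tensor K M N x y"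
    using x assms by (simp add: L gen pure_tensor_def)
qed (intro pure_tensor_closed assms)

lemma pure_tensor_linear_right:
  assumes "x \<in> carrier M"
  shows "linear_map K N (tensor K M N) (pure_tensor K M N x)"
proof (rule linear_mapI)
  note gen = free_gen_closed[OF M.R.ring_axioms]
  note L = linear_mapD[OF linear_map_tensor_coset]
  fix y y' assume y: "y \<in> carrier N" "y' \<in> carrier N"
  have "free_gen K (x, y \<oplus>\<^bsub>N\<^esub> y') \<ominus>\<^bsub>tensor_free K M N\<^esub> (free_gen K (x, y) \<oplus>\<^bsub>tensor_free K M N\<^esub> free_gen K (x, y')) \<in> tensor_rel K M N"
    unfolding tensor_rel_span
    by (rule subsetD[OF span_module_superset tensor_relators.add_right]) fact+
  then have "pure_tensor K M N x (y \<oplus>\<^bsub>N\<^esub> y') =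
      tensor_rel K M N +>\<^bsub>tensor_free K M N\<^esub> (free_gen K (x, y) \<oplus>\<^bsub>tensor_free K M N\<^esub> free_gen K (x, y'))"
    unfolding pure_tensor_def using y assms
    by (subst coset_eq_iff[OF E.left_module_axioms submodule_tensor_rel]) (auto simp: gen)
  then show "pure_tensor K M N x (y \<oplus>\<^bsub>N\<^esub> y') =
      pure_tensor K M N x y \<oplus>\<^bsub>tensor K M N\<^esub> pure_tensor K M N x y'"
    using y assms by (simp add: L gen pure_tensor_def)
next
  note gen = free_gen_closed[OF M.R.ring_axioms]
  note L = linear_mapD[OF linear_map_tensor_coset]
  fix c y assume y: "c \<in> carrier K" "y \<in> carrier N"
  have "free_gen K (x, c \<odot>\<^bsub>N\<^esub> y) \<ominus>\<^bsub>tensor_free K M N\<^esub> (c \<odot>\<^bsub>tensor_free K M N\<^esub> free_gen K (x, y)) \<in> tensor_rel K M N"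
    unfolding tensor_rel_span
    by (rule subsetD[OF span_module_superset tensor_relators.smult_right]) fact+
  then have "pure_tensor K M N x (c \<odot>\<^bsub>N\<^esub> y) = tensor_rel K M N +>\<^bsub>tensor_free K M N\<^esub> (c \<odot>\<^bsub>tensor_free K M N\<^esub> free_gen K (x, y))"
    unfolding pure_tensor_def using y assms
    by (subst coset_eq_iff[OF E.left_module_axioms submodule_tensor_rel])
      (auto simp: gen N.smult_closed E.smult_closed)
  then show "pure_tensor K M N x (c \<odot>\<^bsub>N\<^esub> y) = c \<odot>\<^bsub>tensor K M N\<^esub> pure_tensor K M N x y"
    using y assms by (simp add: L gen pure_tensor_def)
qed (intro pure_tensor_closed assms)

lemma tensor_generated:
  assumes H: "submodule H K (tensor K M N)"
    and pure: "\<And>x y. x \<in> carrier M \<Longrightarrow> y \<in> carrier N \<Longrightarrow> pure_tensor K M N x y \<in> H"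
    and t: "t \<in> carrier (tensor K M N)"
  shows "t \<in> H"
proof -
  obtain e where e: "e \<in> carrier (tensor_free K M N)" "t = tensor_rel K M N +>\<^bsub>tensor_free K M N\<^esub> e"
    using t by (auto simp: tensor_def quot_module_simps(1))
  have "e \<in> {e \<in> carrier (tensor_free K M N). tensor_rel K M N +>\<^bsub>tensor_free K M N\<^esub> e \<in> H}"
    by (rule free_module_generated[OF M.R.ring_axioms _ _ e(1)],
        rule submodule_preimage[OF E.left_module_axioms left_module_tensor linear_map_tensor_coset H])
      (use pure in \<open>auto simp: free_gen_closed[OF M.R.ring_axioms] pure_tensor_def\<close>)
  then show ?thesis using e by simp
qed

text \<open>
  Scalars can be moved into a factor of a pure tensor, so pure tensors generate already as an
  additive group.
\<close>

lemma tensor_induct [consumes 1, case_names pure add]: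
  assumes t: "t \<in> carrier (tensor K M N)"
    and pure: "\<And>x y. x \<in> carrier M \<Longrightarrow> y \<in> carrier N \<Longrightarrow> P (pure_tensor K M N x y)"
    and add: "\<And>s t. s \<in> carrier (tensor K M N) \<Longrightarrow> t \<in> carrier (tensor K M N) \<Longrightarrow>
      P s \<Longrightarrow> P t \<Longrightarrow> P (s \<oplus>\<^bsub>tensor K M N\<^esub> t)"
  shows "P t"
proof -
  let ?T = "tensor K M N"
  let ?H = "{t \<in> carrier ?T. \<forall>c\<in>carrier K. P (c \<odot>\<^bsub>?T\<^esub> t)}"
  have zero: "P \<zero>\<^bsub>?T\<^esub>"
    using pure[OF M.M.zero_closed N.M.zero_closed]
      linear_map_zero[OF M left_module_tensor pure_tensor_linear_left[OF N.M.zero_closed]]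
    by simp
  \<comment> \<open>the tensors all of whose multiples satisfy \<open>P\<close> form a submodule\<close>
  have "submodule ?H K ?T"
  proof (rule T.left_submoduleI)
    fix a x assume ax: "a \<in> carrier K" "x \<in> ?H"
    have "P (c \<odot>\<^bsub>?T\<^esub> (a \<odot>\<^bsub>?T\<^esub> x))" if "c \<in> carrier K" for c
      using ax that T.smult_assoc[of c a x] by (metis (no_types, lifting) M.R.m_closed mem_Collect_eq)
    then show "a \<odot>\<^bsub>?T\<^esub> x \<in> ?H" using ax by (simp add: T.smult_closed)
  qed (auto simp: T.smult_r_null zero T.smult_r_distr T.smult_closed add)
  moreover have "pure_tensor K M N x y \<in> ?H" if xy: "x \<in> carrier M" "y \<in> carrier N" for x y
  proof -
    have "P (c \<odot>\<^bsub>?T\<^esub> pure_tensor K M N x y)" if c: "c \<in> carrier K" for c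
      using pure[OF M.smult_closed[OF c xy(1)] xy(2)]
        linear_mapD(3)[OF pure_tensor_linear_left[OF xy(2)] c xy(1)] by simp
    then show ?thesis using xy by (simp add: pure_tensor_closed)
  qed
  ultimately have "t \<in> ?H" using t by (rule tensor_generated)
  then have "P (\<one>\<^bsub>K\<^esub> \<odot>\<^bsub>?T\<^esub> t)" by simp
  then show ?thesis using t by (simp add: T.smult_one)
qed

text \<open>
  The relators are exactly the conditions that make the extension of \<open>\<beta>\<close> to the free module
  bilinear, so this extension factors through the quotient.
\<close>

lemma tensor_lift:
  assumes V: "left_module K V"
    and left: "\<And>y. y \<in> carrier N \<Longrightarrow> linear_map K M V (\<lambda>x. \<beta> x y)"
    and right: "\<And>x. x \<in> carrier M \<Longrightarrow> linear_map K N V (\<beta> x)"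
  obtains u where "linear_map K (tensor K M N) V u"
    and "\<And>x y. x \<in> carrier M \<Longrightarrow> y \<in> carrier N \<Longrightarrow> u (pure_tensor K M N x y) = \<beta> x y"
proof -
  interpret V: left_module K V by (rule V)
  note l = linear_mapD[OF left] and r = linear_mapD[OF right]
  note gen = free_gen_closed[OF M.R.ring_axioms]
  obtain u0 where u0: "linear_map K (tensor_free K M N) V u0"
    "\<And>s. s \<in> carrier M \<times> carrier N \<Longrightarrow> u0 (free_gen K s) = \<beta> (fst s) (snd s)"
  proof (rule free_module_lift[OF V])
    show "\<beta> (fst s) (snd s) \<in> carrier V" if "s \<in> carrier M \<times> carrier N" for s
      using that l(1) by auto
  qed (rule that)
  note u0m = linear_map_minus[OF E.left_module_axioms V u0(1)]
  have vanish: "v \<ominus>\<^bsub>V\<^esub> v = \<zero>\<^bsub>V\<^esub>" if "v \<in> carrier V" for v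
    using that by (simp add: a_minus_def V.M.r_neg)
  have "u0 s \<in> {\<zero>\<^bsub>V\<^esub>}" if "s \<in> tensor_relators K M N" for s
    using that by cases (auto simp: u0m gen u0(2) linear_mapD[OF u0(1)] l r vanish
        M.smult_closed N.smult_closed E.smult_closed V.smult_closed)
  then have "u0 n = \<zero>\<^bsub>V\<^esub>" if "n \<in> tensor_rel K M N" for n
    using linear_map_span[OF E.left_module_axioms V u0(1) submodule_zero[OF V]
        tensor_relators_closed, of n] that by (simp add: tensor_rel_span)
  from quot_module_lift[OF E.left_module_axioms V u0(1) submodule_tensor_rel this]
  obtain u where u: "linear_map K (tensor K M N) V u"
    "\<And>x. x \<in> carrier (tensor_free K M N) \<Longrightarrow> u (tensor_rel K M N +>\<^bsub>tensor_free K M N\<^esub> x) = u0 x"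
    unfolding tensor_def by blast
  have "u (pure_tensor K M N x y) = \<beta> x y" if "x \<in> carrier M" "y \<in> carrier N" for x y
    using that by (simp add: pure_tensor_def u(2) gen u0(2))
  with u(1) show ?thesis by (rule that)
qed

end

context
  fixes K :: "'k ring" and M :: "('k, 'm) module" and N :: "('k, 'n) module"
    and M' :: "('k, 'm') module" and N' :: "('k, 'n') module" and f g
  assumes M: "left_module K M" and N: "left_module K N"
    and M': "left_module K M'" and N': "left_module K N'"
    and f: "linear_map K M M' f" and g: "linear_map K N N' g"
begin

interpretation M: left_module K M by (rule M)
interpretation N: left_module K N by (rule N)

interpretation E1: left_module K "tensor_free K M N" by (intro left_module_free M.R.ring_axioms)
interpretation E2: left_module K "tensor_free K M' N'" by (intro left_module_free M.R.ring_axioms)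

lemma free_map_prod:
  shows "linear_map K (tensor_free K M N) (tensor_free K M' N') (free_map K (map_prod f g))"
    and "x \<in> carrier M \<Longrightarrow> y \<in> carrier N \<Longrightarrow>
      free_map K (map_prod f g) (free_gen K (x, y)) = free_gen K (f x, g y)"
proof -
  have fg: "map_prod f g s \<in> carrier M' \<times> carrier N'" if "s \<in> carrier M \<times> carrier N" for s
    using that linear_mapD(1)[OF f] linear_mapD(1)[OF g] by auto
  show "linear_map K (tensor_free K M N) (tensor_free K M' N') (free_map K (map_prod f g))"
    by (rule linear_map_free_map(1)[OF M.R.ring_axioms fg])
  show "x \<in> carrier M \<Longrightarrow> y \<in> carrier N \<Longrightarrow>
      free_map K (map_prod f g) (free_gen K (x, y)) = free_gen K (f x, g y)"
    using linear_map_free_map(2)[OF M.R.ring_axioms fg, where s = "(x, y)"] by simp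
qed

text \<open>
  The map induced by \<open>f\<close> and \<open>g\<close> on free modules takes each relator to a relator of the same kind;
  hence the map of tensor products is well defined.
\<close>

lemma free_map_tensor_rel:
  assumes "n \<in> tensor_rel K M N"
  shows "free_map K (map_prod f g) n \<in> tensor_rel K M' N'"
proof -
  let ?h = "free_map K (map_prod f g)"
  note gen = free_gen_closed[OF M.R.ring_axioms]
  note hm = linear_map_minus[OF E1.left_module_axioms E2.left_module_axioms free_map_prod(1)]
  have "?h s \<in> tensor_relators K M' N'" if s: "s \<in> tensor_relators K M N" for s
  proof -
    note [simp] = hm gen free_map_prod(2) linear_mapD[OF free_map_prod(1)]
      M.smult_closed N.smult_closed E1.smult_closed linear_mapD[OF f] linear_mapD[OF g]
    have fc: "f x \<in> carrier M'" if "x \<in> carrier M" for x by (rule linear_mapD(1)[OF f that])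
    have gc: "g y \<in> carrier N'" if "y \<in> carrier N" for y by (rule linear_mapD(1)[OF g that])
    from s show ?thesis
    proof cases
      case (add_left x x' y)
      then show ?thesis
        using tensor_relators.add_left[OF fc fc gc, of x x' y] by simp
    next
      case (add_right x y y')
      then show ?thesis
        using tensor_relators.add_right[OF fc gc gc, of x y y'] by simp
    next
      case (smult_left c x y)
      then show ?thesis
        using tensor_relators.smult_left[OF _ fc gc, of c K x y] by simp
    next
      case (smult_right c x y)
      then show ?thesis
        using tensor_relators.smult_right[OF _ fc gc, of c K x y] by simp
    qed
  qed
  then have "?h s \<in> tensor_rel K M' N'" if "s \<in> tensor_relators K M N" for s
    using that span_module_superset unfolding tensor_rel_span by fast
  then show ?thesis
    using linear_map_span[OF E1.left_module_axioms E2.left_module_axioms free_map_prod(1)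
        submodule_tensor_rel[OF M' N'] tensor_relators_closed[OF M N]] assms
    by (simp add: tensor_rel_span)
qed

lemma linear_map_tensor_map:
  "linear_map K (tensor K M N) (tensor K M' N') (tensor_map K M N M' N' f g)"
proof -
  have "linear_map K (tensor K M N) (tensor K M' N')
      (quot_map (tensor_free K M' N') (tensor_rel K M' N') (free_map K (map_prod f g)))"
    unfolding tensor_def
    by (intro linear_map_quot_map E1.left_module_axioms E2.left_module_axioms free_map_prod(1)
        submodule_tensor_rel M N M' N' free_map_tensor_rel)
  then show ?thesis
    by (subst linear_map_cong[OF left_module_tensor[OF M N]]) (auto simp: tensor_map_def)
qed

lemma tensor_map_pure:
  assumes "x \<in> carrier M" "y \<in> carrier N"
  shows "tensor_map K M N M' N' f g (pure_tensor K M N x y) = pure_tensor K M' N' (f x) (g y)"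
  using quot_map_coset[OF E1.left_module_axioms E2.left_module_axioms free_map_prod(1)
      submodule_tensor_rel[OF M N] submodule_tensor_rel[OF M' N'] free_map_tensor_rel,
      of "free_gen K (x, y)"]
    pure_tensor_closed[OF M N assms] assms
  by (simp add: tensor_map_def pure_tensor_def free_gen_closed[OF M.R.ring_axioms] free_map_prod(2))

end

section \<open>Modules over an algebra and their tensor products\<close>

lemma scalars_simps [simp]:
  "carrier (scalars A M) = carrier M"
  "\<zero>\<^bsub>scalars A M\<^esub> = \<zero>\<^bsub>M\<^esub>"
  "x \<oplus>\<^bsub>scalars A M\<^esub> y = x \<oplus>\<^bsub>M\<^esub> y"
  "c \<odot>\<^bsub>scalars A M\<^esub> x = (c \<odot>\<^bsub>A\<^esub> \<one>\<^bsub>A\<^esub>) \<odot>\<^bsub>M\<^esub> x"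
  by (simp_all add: scalars_def)

lemma tensor_left_simps:
  "carrier (tensor_left K A M U) = carrier (tensor K (scalars A M) U)"
  "\<zero>\<^bsub>tensor_left K A M U\<^esub> = \<zero>\<^bsub>tensor K (scalars A M) U\<^esub>"
  "s \<oplus>\<^bsub>tensor_left K A M U\<^esub> t = s \<oplus>\<^bsub>tensor K (scalars A M) U\<^esub> t"
  "a \<odot>\<^bsub>tensor_left K A M U\<^esub> t =
    tensor_map K (scalars A M) U (scalars A M) U (\<lambda>x. a \<odot>\<^bsub>M\<^esub> x) (\<lambda>u. u) t"
  by (simp_all add: tensor_left_def Let_def)

context
  fixes K :: "'k ring" and A :: "('k, 'a) module"
  assumes algebra: "assoc_algebra K A"
begin

interpretation A: assoc_algebra K A by (rule algebra)

lemma scalar_closed: "c \<in> carrier K \<Longrightarrow> c \<odot>\<^bsub>A\<^esub> \<one>\<^bsub>A\<^esub> \<in> carrier A"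
  by (simp add: A.smult_closed)

lemma scalar_central:
  assumes "c \<in> carrier K" "a \<in> carrier A"
  shows "(c \<odot>\<^bsub>A\<^esub> \<one>\<^bsub>A\<^esub>) \<otimes>\<^bsub>A\<^esub> a = a \<otimes>\<^bsub>A\<^esub> (c \<odot>\<^bsub>A\<^esub> \<one>\<^bsub>A\<^esub>)"
  using assms by (simp add: A.smult_mult_left A.smult_mult_right)

text \<open>
  The image of \<open>K\<close> in \<open>A\<close> is central; this is why \<open>Hom\<^sub>A(M, N)\<close> is a vector space although it is not
  an \<open>A\<close>-module in general.
\<close>

lemma scalar_commute:
  assumes "left_module A M" "c \<in> carrier K" "a \<in> carrier A" "x \<in> carrier M"
  shows "(c \<odot>\<^bsub>A\<^esub> \<one>\<^bsub>A\<^esub>) \<odot>\<^bsub>M\<^esub> (a \<odot>\<^bsub>M\<^esub> x) = a \<odot>\<^bsub>M\<^esub> ((c \<odot>\<^bsub>A\<^esub> \<one>\<^bsub>A\<^esub>) \<odot>\<^bsub>M\<^esub> x)"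
proof -
  interpret M: left_module A M by fact
  show ?thesis
    using assms scalar_closed scalar_central
    by (simp add: M.smult_assoc[symmetric])
qed

lemma left_module_scalars:
  assumes "left_module A M"
  shows "left_module K (scalars A M)"
proof -
  interpret M: left_module A M by fact
  have "\<exists>y\<in>carrier M. y \<oplus>\<^bsub>M\<^esub> x = \<zero>\<^bsub>M\<^esub>" if "x \<in> carrier M" for x
    using that M.M.l_neg M.M.a_inv_closed by blast
  moreover have "((c \<otimes>\<^bsub>K\<^esub> d) \<odot>\<^bsub>A\<^esub> \<one>\<^bsub>A\<^esub>) = (c \<odot>\<^bsub>A\<^esub> \<one>\<^bsub>A\<^esub>) \<otimes>\<^bsub>A\<^esub> (d \<odot>\<^bsub>A\<^esub> \<one>\<^bsub>A\<^esub>)"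
    if "c \<in> carrier K" "d \<in> carrier K" for c d
    using that by (simp add: A.smult_assoc1 A.smult_mult_left)
  ultimately show ?thesis
    by (intro left_module.intro left_module_axioms.intro abelian_groupI A.R.ring_axioms)
      (auto simp: M.M.a_ac M.smult_closed M.smult_l_distr M.smult_r_distr M.smult_assoc M.smult_one
        A.smult_l_distr scalar_closed)
qed

lemma linear_map_scalars:
  assumes "linear_map A M N f"
  shows "linear_map K (scalars A M) (scalars A N) f"
  using linear_mapD[OF assms] by (intro linear_mapI) (auto simp: scalar_closed)

lemma linear_map_action:
  assumes "left_module A M" "a \<in> carrier A"
  shows "linear_map K (scalars A M) (scalars A M) (\<lambda>x. a \<odot>\<^bsub>M\<^esub> x)"
proof -
  interpret M: left_module A M by fact
  show ?thesis
    using assms by (intro linear_mapI)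
      (simp_all add: M.smult_closed M.smult_r_distr scalar_commute)
qed

context
  fixes M :: "('a, 'm) module" and U :: "('k, 'n) module"
  assumes M: "left_module A M" and U: "left_module K U"
begin

interpretation M: left_module A M by (rule M)
interpretation U: left_module K U by (rule U)
interpretation T: left_module K "tensor K (scalars A M) U"
  by (intro left_module_tensor left_module_scalars M U)

lemma tensor_left_action_linear:
  assumes "a \<in> carrier A"
  shows "linear_map K (tensor K (scalars A M) U) (tensor K (scalars A M) U)
    (\<lambda>t. a \<odot>\<^bsub>tensor_left K A M U\<^esub> t)"
  using linear_map_tensor_map[OF left_module_scalars[OF M] U left_module_scalars[OF M] U
      linear_map_action[OF M assms] linear_map_ident]
  by (simp add: tensor_left_simps)

lemma tensor_left_smult_pure:
  assumes "a \<in> carrier A" "x \<in> carrier M" "u \<in> carrier U"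
  shows "a \<odot>\<^bsub>tensor_left K A M U\<^esub> pure_tensor K (scalars A M) U x u =
    pure_tensor K (scalars A M) U (a \<odot>\<^bsub>M\<^esub> x) u"
  using tensor_map_pure[OF left_module_scalars[OF M] U left_module_scalars[OF M] U
      linear_map_action[OF M assms(1)] linear_map_ident] assms(2,3)
  by (simp add: tensor_left_simps)

lemma tensor_left_induct [consumes 1, case_names pure add]:
  assumes "t \<in> carrier (tensor_left K A M U)"
    and "\<And>x u. x \<in> carrier M \<Longrightarrow> u \<in> carrier U \<Longrightarrow> P (pure_tensor K (scalars A M) U x u)"
    and "\<And>s t. s \<in> carrier (tensor_left K A M U) \<Longrightarrow> t \<in> carrier (tensor_left K A M U) \<Longrightarrow>
      P s \<Longrightarrow> P t \<Longrightarrow> P (s \<oplus>\<^bsub>tensor_left K A M U\<^esub> t)"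
  shows "P t"
  using tensor_induct[OF left_module_scalars[OF M] U, of t P] assms
  by (simp add: tensor_left_simps)

lemma tensor_left_pure_closed:
  "x \<in> carrier M \<Longrightarrow> u \<in> carrier U \<Longrightarrow>
    pure_tensor K (scalars A M) U x u \<in> carrier (tensor_left K A M U)"
  using pure_tensor_closed[OF left_module_scalars[OF M] U] by (simp add: tensor_left_simps)

text \<open>
  Both sides of each module axiom are additive in the tensor, and on pure tensors the axiom is that
  of \<open>M\<close>.
\<close>

lemma left_module_tensor_left: "left_module A (tensor_left K A M U)"
proof -
  let ?L = "tensor_left K A M U" and ?p = "pure_tensor K (scalars A M) U"
  note L = linear_mapD[OF tensor_left_action_linear, folded tensor_left_simps]
  note pl = linear_mapD[OF pure_tensor_linear_left[OF left_module_scalars[OF M] U],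
      simplified, folded tensor_left_simps]
  note sp = tensor_left_smult_pure
  have ex: "\<exists>s\<in>carrier ?L. s \<oplus>\<^bsub>?L\<^esub> t = \<zero>\<^bsub>?L\<^esub>" if "t \<in> carrier ?L" for t
    using that T.M.l_neg T.M.a_inv_closed unfolding tensor_left_simps by blast
  have ab: "abelian_group ?L"
    by (rule abelian_groupI) (use ex in \<open>auto simp: tensor_left_simps(1-3) T.M.a_ac\<close>)
  interpret L: abelian_group ?L by (rule ab)
  have l: "(a \<oplus>\<^bsub>A\<^esub> b) \<odot>\<^bsub>?L\<^esub> t = a \<odot>\<^bsub>?L\<^esub> t \<oplus>\<^bsub>?L\<^esub> b \<odot>\<^bsub>?L\<^esub> t"
    if ab: "a \<in> carrier A" "b \<in> carrier A" and t: "t \<in> carrier ?L" for a b t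
    using t
  proof (induction t rule: tensor_left_induct)
    case (pure x u)
    then show ?case
      using ab by (simp add: sp M.smult_l_distr M.smult_closed pl)
  next
    case (add s t)
    then show ?case using ab by (simp add: L L.a_ac)
  qed
  have assoc: "(a \<otimes>\<^bsub>A\<^esub> b) \<odot>\<^bsub>?L\<^esub> t = a \<odot>\<^bsub>?L\<^esub> (b \<odot>\<^bsub>?L\<^esub> t)"
    if ab: "a \<in> carrier A" "b \<in> carrier A" and t: "t \<in> carrier ?L" for a b t
    using t
  proof (induction t rule: tensor_left_induct)
    case (pure x u)
    then show ?case using ab by (simp add: sp M.smult_assoc M.smult_closed)
  next
    case (add s t)
    then show ?case using ab by (simp add: L)
  qed
  have one: "\<one>\<^bsub>A\<^esub> \<odot>\<^bsub>?L\<^esub> t = t" if t: "t \<in> carrier ?L" for t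
    using t
  proof (induction t rule: tensor_left_induct)
    case (pure x u)
    then show ?case by (simp add: sp M.smult_one)
  next
    case (add s t)
    then show ?case by (simp add: L)
  qed
  show ?thesis
    by (intro left_module.intro left_module_axioms.intro left_module.axioms(1)[OF M] ab l assoc one) (auto simp: L)
qed

text \<open>
  On a pure tensor both sides multiply the left factor by \<open>c\<close>. The right-hand side is the scalar
  action of the tensor product over \<open>K\<close>, so scalars may also be moved into the right factor.
\<close>

lemma tensor_left_scalars:
  assumes c: "c \<in> carrier K" and t: "t \<in> carrier (tensor_left K A M U)"
  shows "c \<odot>\<^bsub>scalars A (tensor_left K A M U)\<^esub> t = c \<odot>\<^bsub>tensor K (scalars A M) U\<^esub> t"
  using t
proof (induction t rule: tensor_left_induct)
  case (pure x u)
  then show ?case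
    using c linear_mapD(3)[OF pure_tensor_linear_left[OF left_module_scalars[OF M] U], of u c x]
    by (simp add: tensor_left_smult_pure scalar_closed)
next
  case (add s t)
  then show ?case
    using c linear_mapD(2)[OF tensor_left_action_linear[OF scalar_closed[OF c]]]
    by (simp add: tensor_left_simps(1-3) T.smult_r_distr)
qed

lemma pure_tensor_left_linear_left:
  assumes "u \<in> carrier U"
  shows "linear_map A M (tensor_left K A M U) (\<lambda>x. pure_tensor K (scalars A M) U x u)"
  using linear_mapD[OF pure_tensor_linear_left[OF left_module_scalars[OF M] U assms]] assms
  by (intro linear_mapI) (auto simp: tensor_left_simps(1-3) tensor_left_smult_pure)

lemma pure_tensor_left_linear_right:
  assumes "x \<in> carrier M"
  shows "linear_map K U (scalars A (tensor_left K A M U)) (pure_tensor K (scalars A M) U x)"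
proof (rule linear_mapI)
  note p = linear_mapD[OF pure_tensor_linear_right[OF left_module_scalars[OF M] U, simplified, OF assms]]
  show "pure_tensor K (scalars A M) U x (c \<odot>\<^bsub>U\<^esub> u) =
      c \<odot>\<^bsub>scalars A (tensor_left K A M U)\<^esub> pure_tensor K (scalars A M) U x u"
    if "c \<in> carrier K" "u \<in> carrier U" for c u
    using that assms tensor_left_scalars[OF that(1) tensor_left_pure_closed[OF assms that(2)]] p(3) by simp
  show "pure_tensor K (scalars A M) U x (u \<oplus>\<^bsub>U\<^esub> v) =
      pure_tensor K (scalars A M) U x u \<oplus>\<^bsub>scalars A (tensor_left K A M U)\<^esub> pure_tensor K (scalars A M) U x v"
    if "u \<in> carrier U" "v \<in> carrier U" for u v
    using that p(2) by (simp add: tensor_left_simps)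
qed (simp add: tensor_left_pure_closed assms)

lemma tensor_left_lift:
  assumes V: "left_module A V"
    and left: "\<And>u. u \<in> carrier U \<Longrightarrow> linear_map A M V (\<lambda>x. \<beta> x u)"
    and right: "\<And>x. x \<in> carrier M \<Longrightarrow> linear_map K U (scalars A V) (\<beta> x)"
  obtains h where "linear_map A (tensor_left K A M U) V h"
    and "\<And>x u. x \<in> carrier M \<Longrightarrow> u \<in> carrier U \<Longrightarrow> h (pure_tensor K (scalars A M) U x u) = \<beta> x u"
proof -
  interpret V: left_module A V by (rule V)
  interpret L: left_module A "tensor_left K A M U" by (rule left_module_tensor_left)
  obtain h where h: "linear_map K (tensor K (scalars A M) U) (scalars A V) h"
    "\<And>x u. x \<in> carrier (scalars A M) \<Longrightarrow> u \<in> carrier U \<Longrightarrow> h (pure_tensor K (scalars A M) U x u) = \<beta> x u"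
    by (rule tensor_lift[OF left_module_scalars[OF M] U left_module_scalars[OF V], of \<beta>])
      (use left right in \<open>auto intro: linear_map_scalars\<close>)
  note hD = linear_mapD[OF h(1), simplified, folded tensor_left_simps]
  have "h (a \<odot>\<^bsub>tensor_left K A M U\<^esub> t) = a \<odot>\<^bsub>V\<^esub> h t"
    if a: "a \<in> carrier A" and t: "t \<in> carrier (tensor_left K A M U)" for a t
    using t
  proof (induction t rule: tensor_left_induct)
    case (pure x u)
    then show ?case
      using a h(2) linear_mapD(3)[OF left] by (simp add: tensor_left_smult_pure M.smult_closed)
  next
    case (add s t)
    then show ?case
      using a by (simp add: L.smult_r_distr L.smult_closed hD V.smult_r_distr)
  qed
  then have "linear_map A (tensor_left K A M U) V h"
    by (intro linear_mapI) (auto simp: hD)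
  then show ?thesis by (rule that) (simp add: h(2))
qed

lemma tensor_left_linear_ext:
  assumes "linear_map A (tensor_left K A M U) V g" "linear_map A (tensor_left K A M U) V h"
    and "\<And>x u. x \<in> carrier M \<Longrightarrow> u \<in> carrier U \<Longrightarrow>
      g (pure_tensor K (scalars A M) U x u) = h (pure_tensor K (scalars A M) U x u)"
    and "t \<in> carrier (tensor_left K A M U)"
  shows "g t = h t"
  using assms(4)
proof (induction t rule: tensor_left_induct)
  case (add s t)
  then show ?case by (simp add: linear_mapD[OF assms(1)] linear_mapD[OF assms(2)])
qed (rule assms(3))

end

lemma tensor_left_map:
  assumes M: "left_module A M" and U: "left_module K U"
    and M': "left_module A M'" and U': "left_module K U'"
    and f: "linear_map A M M' f" and g: "linear_map K U U' g"
  shows "linear_map A (tensor_left K A M U) (tensor_left K A M' U')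
      (tensor_map K (scalars A M) U (scalars A M') U' f g)"
    and "x \<in> carrier M \<Longrightarrow> u \<in> carrier U \<Longrightarrow>
      tensor_map K (scalars A M) U (scalars A M') U' f g (pure_tensor K (scalars A M) U x u) =
      pure_tensor K (scalars A M') U' (f x) (g u)"
proof -
  let ?h = "tensor_map K (scalars A M) U (scalars A M') U' f g"
  interpret M: left_module A M by (rule M)
  interpret M': left_module A M' by (rule M')
  interpret L: left_module A "tensor_left K A M U" by (rule left_module_tensor_left[OF M U])
  interpret L': left_module A "tensor_left K A M' U'" by (rule left_module_tensor_left[OF M' U'])
  note h = linear_mapD[OF linear_map_tensor_map[OF left_module_scalars[OF M] U
        left_module_scalars[OF M'] U' linear_map_scalars[OF f] g], folded tensor_left_simps]
  have p: "?h (pure_tensor K (scalars A M) U x u) = pure_tensor K (scalars A M') U' (f x) (g u)"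
    if "x \<in> carrier M" "u \<in> carrier U" for x u
    using tensor_map_pure[OF left_module_scalars[OF M] U left_module_scalars[OF M'] U'
        linear_map_scalars[OF f] g] that by simp
  then show "x \<in> carrier M \<Longrightarrow> u \<in> carrier U \<Longrightarrow>
      ?h (pure_tensor K (scalars A M) U x u) = pure_tensor K (scalars A M') U' (f x) (g u)" .
  have "?h (a \<odot>\<^bsub>tensor_left K A M U\<^esub> t) = a \<odot>\<^bsub>tensor_left K A M' U'\<^esub> ?h t"
    if a: "a \<in> carrier A" and t: "t \<in> carrier (tensor_left K A M U)" for a t
    using t
  proof (induction t rule: tensor_left_induct[OF M U, consumes 1, case_names pure add])
    case (pure x u)
    then show ?case
      using a by (simp add: tensor_left_smult_pure[OF M U] tensor_left_smult_pure[OF M' U'] p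
          M.smult_closed linear_mapD[OF f] linear_mapD[OF g])
  next
    case (add s t)
    then show ?case using a by (simp add: L.smult_r_distr L.smult_closed h L'.smult_r_distr)
  qed
  then show "linear_map A (tensor_left K A M U) (tensor_left K A M' U') ?h"
    by (intro linear_mapI) (auto simp: h)
qed

end

section \<open>Spaces of linear maps\<close>

lemma linear_maps_iff: "h \<in> linear_maps R M N \<longleftrightarrow> h \<in> extensional (carrier M) \<and> linear_map R M N h"
  by (auto simp: linear_maps_def)

lemma linear_mapsD:
  assumes "h \<in> linear_maps R M N"
  shows "h \<in> extensional (carrier M)" "linear_map R M N h"
    and "x \<in> carrier M \<Longrightarrow> h x \<in> carrier N"
    and "x \<in> carrier M \<Longrightarrow> y \<in> carrier M \<Longrightarrow> h (x \<oplus>\<^bsub>M\<^esub> y) = h x \<oplus>\<^bsub>N\<^esub> h y"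
    and "a \<in> carrier R \<Longrightarrow> x \<in> carrier M \<Longrightarrow> h (a \<odot>\<^bsub>M\<^esub> x) = a \<odot>\<^bsub>N\<^esub> h x"
  using assms by (auto simp: linear_maps_iff linear_map_def)

lemma linear_maps_eqI:
  assumes "f \<in> linear_maps R M N" "g \<in> linear_maps R M N"
    and "\<And>x. x \<in> carrier M \<Longrightarrow> f x = g x"
  shows "f = g"
  using assms by (intro extensionalityI[of f "carrier M" g]) (auto simp: linear_maps_iff)

lemma restrict_linear_maps:
  assumes "left_module R M" "linear_map R M N h"
  shows "(\<lambda>x\<in>carrier M. h x) \<in> linear_maps R M N"
proof -
  have "linear_map R M N (\<lambda>x\<in>carrier M. h x) \<longleftrightarrow> linear_map R M N h"
    by (rule linear_map_cong[OF assms(1)]) simp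
  then show ?thesis using assms(2) by (simp add: linear_maps_iff)
qed

lemma compose_linear_maps:
  assumes "left_module R L" "f \<in> linear_maps R L M" "g \<in> linear_maps R M N"
  shows "compose (carrier L) g f \<in> linear_maps R L N"
  unfolding compose_def
  by (rule restrict_linear_maps[OF assms(1) linear_map_comp[OF linear_mapsD(2)[OF assms(2)]
        linear_mapsD(2)[OF assms(3)]]])

lemma ident_linear_maps: "left_module R M \<Longrightarrow> (\<lambda>x\<in>carrier M. x) \<in> linear_maps R M M"
  by (intro restrict_linear_maps linear_map_ident)

lemma pointwise_module_simps [simp]:
  "carrier (pointwise_module S N H) = H"
  "\<zero>\<^bsub>pointwise_module S N H\<^esub> = (\<lambda>x\<in>S. \<zero>\<^bsub>N\<^esub>)"
  "f \<oplus>\<^bsub>pointwise_module S N H\<^esub> g = (\<lambda>x\<in>S. f x \<oplus>\<^bsub>N\<^esub> g x)"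
  "c \<odot>\<^bsub>pointwise_module S N H\<^esub> f = (\<lambda>x\<in>S. c \<odot>\<^bsub>N\<^esub> f x)"
  by (simp_all add: pointwise_module_def)

text \<open>
  \<open>N'\<close> is \<open>N\<close> with another ring of scalars, whose action commutes with that of \<open>R\<close>. This covers
  \<open>Hom\<^sub>k\<close>, where \<open>N' = N\<close>, and \<open>Hom\<^sub>A\<close>, where \<open>N'\<close> is the underlying vector space of \<open>N\<close>.
\<close>

lemma left_module_linear_maps:
  fixes M :: "('a, 'b) module" and N :: "('a, 'c) module" and N' :: "('k, 'c) module"
  assumes M: "left_module R M" and N: "left_module R N" and N': "left_module K N'"
    and same: "carrier N' = carrier N" "\<zero>\<^bsub>N'\<^esub> = \<zero>\<^bsub>N\<^esub>"
      "\<And>x y. x \<oplus>\<^bsub>N'\<^esub> y = x \<oplus>\<^bsub>N\<^esub> y"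
    and comm: "\<And>c a x. c \<in> carrier K \<Longrightarrow> a \<in> carrier R \<Longrightarrow> x \<in> carrier N \<Longrightarrow>
      c \<odot>\<^bsub>N'\<^esub> (a \<odot>\<^bsub>N\<^esub> x) = a \<odot>\<^bsub>N\<^esub> (c \<odot>\<^bsub>N'\<^esub> x)"
  shows "left_module K (pointwise_module (carrier M) N' (linear_maps R M N))"
proof (rule left_module_family[where I = "carrier M" and M = "\<lambda>_. N'"])
  interpret M: left_module R M by (rule M)
  interpret N: left_module R N by (rule N)
  interpret N': left_module K N' by (rule N')
  note cl = N'.smult_closed[unfolded same] N'.smult_r_distr[unfolded same]
  let ?P = "pointwise_module (carrier M) N' (linear_maps R M N)"
  show "ring K" by (rule N'.R.ring_axioms)
  show "carrier ?P \<subseteq> carrier M \<rightarrow>\<^sub>E carrier N'"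
    by (auto simp: PiE_def linear_mapsD(1) linear_mapsD(3) same)
  show "\<zero>\<^bsub>?P\<^esub> \<in> carrier ?P"
    using restrict_linear_maps[OF M linear_map_into_zero[OF N]] by (simp add: same)
  show "f \<oplus>\<^bsub>?P\<^esub> g \<in> carrier ?P" if "f \<in> carrier ?P" "g \<in> carrier ?P" for f g
    using that unfolding pointwise_module_simps same
    by (intro restrict_linear_maps M linear_mapI)
      (auto simp: linear_mapsD(3,4,5) N.M.a_ac N.smult_r_distr)
  show "c \<odot>\<^bsub>?P\<^esub> f \<in> carrier ?P" if "c \<in> carrier K" "f \<in> carrier ?P" for c f
    using that unfolding pointwise_module_simps same
    by (intro restrict_linear_maps M linear_mapI) (auto simp: linear_mapsD(3,4,5) cl comm)
qed (simp_all add: N')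

lemma compose_eq_iff: "compose S g f = compose S g' f' \<longleftrightarrow> (\<forall>x\<in>S. g (f x) = g' (f' x))"
  by (auto simp: compose_def fun_eq_iff restrict_def)

text \<open>
  The common part of the two categories of modules: the hom spaces get their scalars from a
  functor \<open>S\<close> that changes neither elements nor sums.
\<close>

lemma linear_category_linear_maps:
  fixes K :: "'k ring" and R :: "('a, 'x) ring_scheme"
    and S :: "('a, 'v) module \<Rightarrow> ('k, 'v) module"
  assumes K: "cring K" and R: "\<And>V. V \<in> obs \<Longrightarrow> left_module R V"
    and S: "\<And>V. V \<in> obs \<Longrightarrow> left_module K (S V)"
    and same: "\<And>V. carrier (S V) = carrier V" "\<And>V. \<zero>\<^bsub>S V\<^esub> = \<zero>\<^bsub>V\<^esub>"
      "\<And>V x y. x \<oplus>\<^bsub>S V\<^esub> y = x \<oplus>\<^bsub>V\<^esub> y"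
    and comm: "\<And>V c a x. V \<in> obs \<Longrightarrow> c \<in> carrier K \<Longrightarrow> a \<in> carrier R \<Longrightarrow> x \<in> carrier V \<Longrightarrow>
      c \<odot>\<^bsub>S V\<^esub> (a \<odot>\<^bsub>V\<^esub> x) = a \<odot>\<^bsub>V\<^esub> (c \<odot>\<^bsub>S V\<^esub> x)"
    and lin: "\<And>V W g. linear_map R V W g \<Longrightarrow> linear_map K (S V) (S W) g"
  shows "linear_category K
    \<lparr>Ob = obs, Hom = (\<lambda>V W. pointwise_module (carrier V) (S W) (linear_maps R V W)),
     Ident = (\<lambda>V. \<lambda>x\<in>carrier V. x), Cmp = (\<lambda>U V W g f. compose (carrier U) g f)\<rparr>"
proof (rule linear_category.intro, simp_all)
  fix X Y assume "X \<in> obs" "Y \<in> obs"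
  then show "module K (pointwise_module (carrier X) (S Y) (linear_maps R X Y))"
    by (intro left_module_imp_module K left_module_linear_maps R S same comm)
next
  fix X assume "X \<in> obs"
  then show "(\<lambda>x\<in>carrier X. x) \<in> linear_maps R X X" by (intro ident_linear_maps R)
next
  fix X Y Z f assume "X \<in> obs" "Y \<in> obs" "Z \<in> obs" and f: "f \<in> linear_maps R X Y"
  then show "linear_map K (pointwise_module (carrier Y) (S Z) (linear_maps R Y Z))
      (pointwise_module (carrier X) (S Z) (linear_maps R X Z)) (\<lambda>g. compose (carrier X) g f)"
    by (intro linear_mapI, simp add: compose_linear_maps R)
      (simp_all add: compose_def linear_mapsD(3)[OF f] same cong: restrict_cong)
next
  fix X Y Z g assume X: "X \<in> obs" and "Y \<in> obs" "Z \<in> obs" and g: "g \<in> linear_maps R Y Z"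
  note gl = linear_mapD[OF lin[OF linear_mapsD(2)[OF g]], unfolded same]
  show "linear_map K (pointwise_module (carrier X) (S Y) (linear_maps R X Y))
      (pointwise_module (carrier X) (S Z) (linear_maps R X Z)) (compose (carrier X) g)"
    using X g by (intro linear_mapI, simp add: compose_linear_maps R)
      (simp_all add: compose_def linear_mapsD(3) gl same cong: restrict_cong)
next
  fix X Y f assume "X \<in> obs" "Y \<in> obs" and f: "f \<in> linear_maps R X Y"
  show "compose (carrier X) (\<lambda>x\<in>carrier Y. x) f = f"
    using linear_mapsD(1,3)[OF f] by (intro Id_compose) auto
  show "compose (carrier X) f (\<lambda>x\<in>carrier X. x) = f"
    using linear_mapsD(1,3)[OF f] by (intro compose_Id) auto
next
  fix W X Y Z f g h
  assume "f \<in> linear_maps R W X" "g \<in> linear_maps R X Y" "h \<in> linear_maps R Y Z"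
  then show "compose (carrier W) h (compose (carrier W) g f) =
      compose (carrier W) (compose (carrier X) h g) f"
    by (auto simp: compose_def fun_eq_iff restrict_def linear_mapsD(3))
qed

lemma Hom_Vec_simps [simp]:
  "carrier (Hom_Vec K U W) = linear_maps K U W"
  "\<zero>\<^bsub>Hom_Vec K U W\<^esub> = (\<lambda>x\<in>carrier U. \<zero>\<^bsub>W\<^esub>)"
  "f \<oplus>\<^bsub>Hom_Vec K U W\<^esub> g = (\<lambda>x\<in>carrier U. f x \<oplus>\<^bsub>W\<^esub> g x)"
  "c \<odot>\<^bsub>Hom_Vec K U W\<^esub> f = (\<lambda>x\<in>carrier U. c \<odot>\<^bsub>W\<^esub> f x)"
  by (simp_all add: Hom_Vec_def)

lemma Hom_Mod_simps [simp]:
  "carrier (Hom_Mod A M N) = linear_maps A M N"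
  "\<zero>\<^bsub>Hom_Mod A M N\<^esub> = (\<lambda>x\<in>carrier M. \<zero>\<^bsub>N\<^esub>)"
  "f \<oplus>\<^bsub>Hom_Mod A M N\<^esub> g = (\<lambda>x\<in>carrier M. f x \<oplus>\<^bsub>N\<^esub> g x)"
  "c \<odot>\<^bsub>Hom_Mod A M N\<^esub> f = (\<lambda>x\<in>carrier M. (c \<odot>\<^bsub>A\<^esub> \<one>\<^bsub>A\<^esub>) \<odot>\<^bsub>N\<^esub> f x)"
  by (simp_all add: Hom_Mod_def)

lemma VecCat_simps [simp]:
  "Ob (VecCat K) = {V. module K V}" "Hom (VecCat K) = Hom_Vec K"
  "Ident (VecCat K) V = (\<lambda>x\<in>carrier V. x)" "Cmp (VecCat K) U V W g f = compose (carrier U) g f"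
  by (simp_all add: VecCat_def)

lemma ModCat_simps [simp]:
  "Ob (ModCat A) = {V. left_module A V}" "Hom (ModCat A) = Hom_Mod A"
  "Ident (ModCat A) V = (\<lambda>x\<in>carrier V. x)" "Cmp (ModCat A) U V W g f = compose (carrier U) g f"
  by (simp_all add: ModCat_def)

lemma smult_commute:
  assumes "cring K" "left_module K V" "c \<in> carrier K" "a \<in> carrier K" "x \<in> carrier V"
  shows "c \<odot>\<^bsub>V\<^esub> (a \<odot>\<^bsub>V\<^esub> x) = a \<odot>\<^bsub>V\<^esub> (c \<odot>\<^bsub>V\<^esub> x)"
proof -
  interpret K: cring K by fact
  interpret V: left_module K V by fact
  show ?thesis using assms(3-5) by (simp add: V.smult_assoc[symmetric] K.m_comm)
qed

lemma left_module_Hom_Vec: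
  "cring K \<Longrightarrow> left_module K U \<Longrightarrow> left_module K W \<Longrightarrow> left_module K (Hom_Vec K U W)"
  unfolding Hom_Vec_def by (intro left_module_linear_maps smult_commute) auto

lemma left_module_Hom_Mod:
  fixes K :: "'k ring"
  assumes "assoc_algebra K A" "left_module A M" "left_module A N"
  shows "left_module K (Hom_Mod A M N)"
  unfolding Hom_Mod_def using assms
  by (intro left_module_linear_maps) (auto intro: left_module_scalars scalar_commute)

lemma linear_category_VecCat:
  assumes "cring K"
  shows "linear_category K (VecCat K)"
proof -
  have eq: "VecCat K = \<lparr>Ob = {V. module K V},
      Hom = (\<lambda>V W. pointwise_module (carrier V) W (linear_maps K V W)),
      Ident = (\<lambda>V. \<lambda>x\<in>carrier V. x), Cmp = (\<lambda>U V W g f. compose (carrier U) g f)\<rparr>"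
    by (auto simp: VecCat_def Hom_Vec_def fun_eq_iff)
  show ?thesis
    unfolding eq using assms by (intro linear_category_linear_maps[where S = "\<lambda>V. V"])
      (auto intro: module_imp_left_module smult_commute)
qed

lemma linear_category_ModCat:
  fixes K :: "'k ring"
  assumes "cring K" "assoc_algebra K A"
  shows "linear_category K (ModCat A)"
proof -
  have eq: "ModCat A = \<lparr>Ob = {V. left_module A V},
      Hom = (\<lambda>V W. pointwise_module (carrier V) (scalars A W) (linear_maps A V W)),
      Ident = (\<lambda>V. \<lambda>x\<in>carrier V. x), Cmp = (\<lambda>U V W g f. compose (carrier U) g f)\<rparr>"
    by (auto simp: ModCat_def Hom_Mod_def fun_eq_iff)
  show ?thesis
    unfolding eq using assms by (intro linear_category_linear_maps[where S = "scalars A"])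
      (auto intro: scalar_commute left_module_scalars linear_map_scalars)
qed


section \<open>Presheaves\<close>

lemma op_cat_simps [simp]:
  "Ob (op_cat C) = Ob C" "Hom (op_cat C) X Y = Hom C Y X" "Ident (op_cat C) = Ident C"
  "Cmp (op_cat C) X Y Z g f = Cmp C Z Y X f g"
  by (simp_all add: op_cat_def)

lemma linear_category_op_cat:
  assumes "linear_category K C"
  shows "linear_category K (op_cat C)"
proof -
  interpret linear_category K C by fact
  show ?thesis
    by (rule linear_category.intro)
      (simp_all add: hom_space ident_in comp_linear_left comp_linear_right comp_ident_left
        comp_ident_right comp_assoc)
qed

lemma PShCat_simps [simp]:
  "F \<in> Ob (PShCat K B) \<longleftrightarrow> linear_functor K (op_cat B) (VecCat K) F"
  "Hom (PShCat K B) = Hom_PSh K B"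
  "Ident (PShCat K B) F = (\<lambda>b\<in>Ob B. \<lambda>x\<in>carrier (fobj F b). x)"
  "Cmp (PShCat K B) F G H \<eta> \<theta> = nat_comp B F \<eta> \<theta>"
  by (simp_all add: PShCat_def)

lemma presheafD:
  assumes "linear_functor K (op_cat B) (VecCat K) F" and "b \<in> Ob B" "b' \<in> Ob B"
  shows "left_module K (fobj F b)"
    and "f \<in> carrier (Hom B b b') \<Longrightarrow> farr F b' b f \<in> linear_maps K (fobj F b') (fobj F b)"
    and "f \<in> carrier (Hom B b b') \<Longrightarrow> g \<in> carrier (Hom B b b') \<Longrightarrow> v \<in> carrier (fobj F b') \<Longrightarrow>
      farr F b' b (f \<oplus>\<^bsub>Hom B b b'\<^esub> g) v = farr F b' b f v \<oplus>\<^bsub>fobj F b\<^esub> farr F b' b g v"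
    and "c \<in> carrier K \<Longrightarrow> f \<in> carrier (Hom B b b') \<Longrightarrow> v \<in> carrier (fobj F b') \<Longrightarrow>
      farr F b' b (c \<odot>\<^bsub>Hom B b b'\<^esub> f) v = c \<odot>\<^bsub>fobj F b\<^esub> farr F b' b f v"
proof -
  interpret linear_functor K "op_cat B" "VecCat K" F by fact
  show "left_module K (fobj F b)"
    using fobj_in[of b] assms(2) by (simp add: module_imp_left_module)
  have l: "linear_map K (Hom B b b') (Hom_Vec K (fobj F b') (fobj F b)) (farr F b' b)"
    using farr_linear[of b' b] assms(2,3) by simp
  show "f \<in> carrier (Hom B b b') \<Longrightarrow> farr F b' b f \<in> linear_maps K (fobj F b') (fobj F b)"
    "f \<in> carrier (Hom B b b') \<Longrightarrow> g \<in> carrier (Hom B b b') \<Longrightarrow> v \<in> carrier (fobj F b') \<Longrightarrow>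
      farr F b' b (f \<oplus>\<^bsub>Hom B b b'\<^esub> g) v = farr F b' b f v \<oplus>\<^bsub>fobj F b\<^esub> farr F b' b g v"
    "c \<in> carrier K \<Longrightarrow> f \<in> carrier (Hom B b b') \<Longrightarrow> v \<in> carrier (fobj F b') \<Longrightarrow>
      farr F b' b (c \<odot>\<^bsub>Hom B b b'\<^esub> f) v = c \<odot>\<^bsub>fobj F b\<^esub> farr F b' b f v"
    using linear_mapD[OF l] by simp_all
qed

lemma Hom_PSh_simps:
  "\<zero>\<^bsub>Hom_PSh K B F G\<^esub> = (\<lambda>b\<in>Ob B. \<lambda>v\<in>carrier (fobj F b). \<zero>\<^bsub>fobj G b\<^esub>)"
  "\<theta> \<oplus>\<^bsub>Hom_PSh K B F G\<^esub> \<eta> = (\<lambda>b\<in>Ob B. \<lambda>v\<in>carrier (fobj F b). \<theta> b v \<oplus>\<^bsub>fobj G b\<^esub> \<eta> b v)"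
  "c \<odot>\<^bsub>Hom_PSh K B F G\<^esub> \<theta> = (\<lambda>b\<in>Ob B. \<lambda>v\<in>carrier (fobj F b). c \<odot>\<^bsub>fobj G b\<^esub> \<theta> b v)"
  by (simp_all add: Hom_PSh_def Let_def)

lemma carrier_Hom_PSh:
  "\<theta> \<in> carrier (Hom_PSh K B F G) \<longleftrightarrow>
    \<theta> \<in> extensional (Ob B) \<and> (\<forall>b\<in>Ob B. \<theta> b \<in> linear_maps K (fobj F b) (fobj G b)) \<and>
    (\<forall>b\<in>Ob B. \<forall>b'\<in>Ob B. \<forall>f\<in>carrier (Hom B b b'). \<forall>v\<in>carrier (fobj F b').
      \<theta> b (farr F b' b f v) = farr G b' b f (\<theta> b' v))"
  by (auto simp: Hom_PSh_def Let_def compose_eq_iff PiE_iff)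

lemma Hom_PShD:
  assumes "\<theta> \<in> carrier (Hom_PSh K B F G)" "b \<in> Ob B"
  shows "\<theta> b \<in> linear_maps K (fobj F b) (fobj G b)"
    and "v \<in> carrier (fobj F b) \<Longrightarrow> \<theta> b v \<in> carrier (fobj G b)"
    and "v \<in> carrier (fobj F b) \<Longrightarrow> w \<in> carrier (fobj F b) \<Longrightarrow>
      \<theta> b (v \<oplus>\<^bsub>fobj F b\<^esub> w) = \<theta> b v \<oplus>\<^bsub>fobj G b\<^esub> \<theta> b w"
    and "c \<in> carrier K \<Longrightarrow> v \<in> carrier (fobj F b) \<Longrightarrow>
      \<theta> b (c \<odot>\<^bsub>fobj F b\<^esub> v) = c \<odot>\<^bsub>fobj G b\<^esub> \<theta> b v"
    and "b' \<in> Ob B \<Longrightarrow> f \<in> carrier (Hom B b b') \<Longrightarrow> v \<in> carrier (fobj F b') \<Longrightarrow>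
      \<theta> b (farr F b' b f v) = farr G b' b f (\<theta> b' v)"
proof -
  show l: "\<theta> b \<in> linear_maps K (fobj F b) (fobj G b)"
    using assms by (simp add: carrier_Hom_PSh)
  show "v \<in> carrier (fobj F b) \<Longrightarrow> \<theta> b v \<in> carrier (fobj G b)"
    "v \<in> carrier (fobj F b) \<Longrightarrow> w \<in> carrier (fobj F b) \<Longrightarrow>
      \<theta> b (v \<oplus>\<^bsub>fobj F b\<^esub> w) = \<theta> b v \<oplus>\<^bsub>fobj G b\<^esub> \<theta> b w"
    "c \<in> carrier K \<Longrightarrow> v \<in> carrier (fobj F b) \<Longrightarrow>
      \<theta> b (c \<odot>\<^bsub>fobj F b\<^esub> v) = c \<odot>\<^bsub>fobj G b\<^esub> \<theta> b v"
    using linear_mapsD[OF l] by simp_all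
  show "b' \<in> Ob B \<Longrightarrow> f \<in> carrier (Hom B b b') \<Longrightarrow> v \<in> carrier (fobj F b') \<Longrightarrow>
      \<theta> b (farr F b' b f v) = farr G b' b f (\<theta> b' v)"
    using assms by (simp add: carrier_Hom_PSh)
qed

lemma Hom_PSh_eqI:
  assumes "\<theta> \<in> carrier (Hom_PSh K B F G)" "\<eta> \<in> carrier (Hom_PSh K B F G)"
    and "\<And>b v. b \<in> Ob B \<Longrightarrow> v \<in> carrier (fobj F b) \<Longrightarrow> \<theta> b v = \<eta> b v"
  shows "\<theta> = \<eta>"
proof (rule extensionalityI[of _ "Ob B"])
  show "\<theta> b = \<eta> b" if "b \<in> Ob B" for b
    by (rule linear_maps_eqI[OF Hom_PShD(1)[OF assms(1) that] Hom_PShD(1)[OF assms(2) that]])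
      (rule assms(3)[OF that])
qed (use assms in \<open>simp_all add: carrier_Hom_PSh\<close>)

lemma Hom_PShI:
  assumes "\<And>b. b \<in> Ob B \<Longrightarrow> left_module K (fobj F b)"
    and "\<And>b. b \<in> Ob B \<Longrightarrow> linear_map K (fobj F b) (fobj G b) (\<theta> b)"
    and "\<And>b b' f v. b \<in> Ob B \<Longrightarrow> b' \<in> Ob B \<Longrightarrow> f \<in> carrier (Hom B b b') \<Longrightarrow>
      v \<in> carrier (fobj F b') \<Longrightarrow> farr F b' b f v \<in> carrier (fobj F b) \<and>
      \<theta> b (farr F b' b f v) = farr G b' b f (\<theta> b' v)"
  shows "(\<lambda>b\<in>Ob B. \<lambda>v\<in>carrier (fobj F b). \<theta> b v) \<in> carrier (Hom_PSh K B F G)"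
  unfolding carrier_Hom_PSh using assms by (auto intro!: restrict_linear_maps)

text \<open>Sums and multiples of natural transformations are natural because the maps of \<open>G\<close> are linear.\<close>

lemma left_module_Hom_PSh:
  fixes F :: "('o, 'm, 'k, 'u) presheaf" and G :: "('o, 'm, 'k, 'v) presheaf"
  assumes K: "cring K" and F: "linear_functor K (op_cat B) (VecCat K) F"
    and G: "linear_functor K (op_cat B) (VecCat K) G"
  shows "left_module K (Hom_PSh K B F G)"
proof (rule left_module_family[where I = "Ob B" and M = "\<lambda>b. Hom_Vec K (fobj F b) (fobj G b)"])
  let ?P = "Hom_PSh K B F G"
  note Fm = presheafD(1)[OF F] and Gm = presheafD(1)[OF G]
  note Fa = linear_mapsD[OF presheafD(2)[OF F]] and Ga = linear_mapsD[OF presheafD(2)[OF G]]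
  show "ring K" using K by (rule cring.axioms)
  show vec: "left_module K (Hom_Vec K (fobj F b) (fobj G b))" if "b \<in> Ob B" for b
    using that by (intro left_module_Hom_Vec K Fm Gm)
  show "carrier ?P \<subseteq> (\<Pi>\<^sub>E b\<in>Ob B. carrier (Hom_Vec K (fobj F b) (fobj G b)))"
    by (auto simp: carrier_Hom_PSh PiE_iff intro: extensional_arb)
  have lin: "(\<lambda>v\<in>carrier (fobj F b). \<zero>\<^bsub>fobj G b\<^esub>) \<in> linear_maps K (fobj F b) (fobj G b)"
    "\<theta> \<in> linear_maps K (fobj F b) (fobj G b) \<Longrightarrow> \<eta> \<in> linear_maps K (fobj F b) (fobj G b) \<Longrightarrow>
      (\<lambda>v\<in>carrier (fobj F b). \<theta> v \<oplus>\<^bsub>fobj G b\<^esub> \<eta> v) \<in> linear_maps K (fobj F b) (fobj G b)"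
    "c \<in> carrier K \<Longrightarrow> \<theta> \<in> linear_maps K (fobj F b) (fobj G b) \<Longrightarrow>
      (\<lambda>v\<in>carrier (fobj F b). c \<odot>\<^bsub>fobj G b\<^esub> \<theta> v) \<in> linear_maps K (fobj F b) (fobj G b)"
    if "b \<in> Ob B" for b \<theta> \<eta> c
    using abelian_monoid.zero_closed[OF abelian_group.axioms(1)[OF left_module.axioms(2)[OF vec[OF that]]]]
      abelian_monoid.a_closed[OF abelian_group.axioms(1)[OF left_module.axioms(2)[OF vec[OF that]]]]
      left_module.smult_closed[OF vec[OF that]]
    by simp_all
  have Gzero: "farr G b' b f \<zero>\<^bsub>fobj G b'\<^esub> = \<zero>\<^bsub>fobj G b\<^esub>"
    if "b \<in> Ob B" "b' \<in> Ob B" "f \<in> carrier (Hom B b b')" for b b' f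
    using that by (intro linear_map_zero[of K] Gm Ga(2)) auto
  show "\<zero>\<^bsub>?P\<^esub> \<in> carrier ?P"
    unfolding carrier_Hom_PSh by (auto simp: Hom_PSh_simps lin Fa Gzero)
  fix \<theta> \<eta> assume t: "\<theta> \<in> carrier ?P" "\<eta> \<in> carrier ?P"
  show "\<theta> \<oplus>\<^bsub>?P\<^esub> \<eta> \<in> carrier ?P"
    unfolding carrier_Hom_PSh using Hom_PShD[OF t(1)] Hom_PShD[OF t(2)]
    by (auto simp: Hom_PSh_simps lin Fa Ga)
next
  let ?P = "Hom_PSh K B F G"
  note Fm = presheafD(1)[OF F] and Gm = presheafD(1)[OF G]
  note Fa = linear_mapsD[OF presheafD(2)[OF F]] and Ga = linear_mapsD[OF presheafD(2)[OF G]]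
  have vec: "left_module K (Hom_Vec K (fobj F b) (fobj G b))" if "b \<in> Ob B" for b
    using that by (intro left_module_Hom_Vec K Fm Gm)
  fix c \<theta> assume t: "c \<in> carrier K" "\<theta> \<in> carrier ?P"
  have "(\<lambda>v\<in>carrier (fobj F b). c \<odot>\<^bsub>fobj G b\<^esub> \<theta> b v) \<in> linear_maps K (fobj F b) (fobj G b)"
    if "b \<in> Ob B" for b
    using left_module.smult_closed[OF vec[OF that] t(1)] Hom_PShD(1)[OF t(2) that] by simp
  then show "c \<odot>\<^bsub>?P\<^esub> \<theta> \<in> carrier ?P"
    unfolding carrier_Hom_PSh using Hom_PShD[OF t(2)] t(1)
    by (auto simp: Hom_PSh_simps Fa Ga)
qed (simp_all add: Hom_PSh_simps)

lemma nat_comp_apply [simp]: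
  "b \<in> Ob B \<Longrightarrow> v \<in> carrier (fobj F b) \<Longrightarrow> nat_comp B F \<eta> \<theta> b v = \<eta> b (\<theta> b v)"
  by (simp add: nat_comp_def compose_def)

lemma nat_comp_closed:
  assumes F: "linear_functor K (op_cat B) (VecCat K) F"
    and t: "\<theta> \<in> carrier (Hom_PSh K B F G)" and e: "\<eta> \<in> carrier (Hom_PSh K B G H)"
  shows "nat_comp B F \<eta> \<theta> \<in> carrier (Hom_PSh K B F H)"
proof -
  note Fa = linear_mapsD[OF presheafD(2)[OF F]]
  have "compose (carrier (fobj F b)) (\<eta> b) (\<theta> b) \<in> linear_maps K (fobj F b) (fobj H b)" if "b \<in> Ob B" for b
    by (rule compose_linear_maps[OF presheafD(1)[OF F that that] Hom_PShD(1)[OF t that] Hom_PShD(1)[OF e that]])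
  then show ?thesis
    unfolding carrier_Hom_PSh using Hom_PShD[OF t] Hom_PShD[OF e]
    by (auto simp: nat_comp_def compose_def Fa)
qed

lemma ident_Hom_PSh:
  assumes F: "linear_functor K (op_cat B) (VecCat K) F"
  shows "(\<lambda>b\<in>Ob B. \<lambda>v\<in>carrier (fobj F b). v) \<in> carrier (Hom_PSh K B F F)"
  using linear_mapsD[OF presheafD(2)[OF F]]
  by (intro Hom_PShI presheafD(1)[OF F] linear_map_ident) auto

lemma linear_category_PShCat:
  fixes K :: "'k ring" and B :: "('o, 'm, 'k) lincat"
  assumes K: "cring K"
  shows "linear_category K (PShCat K B :: (('o, 'm, 'k, 'v) presheaf, _, _) lincat)"
proof (rule linear_category.intro, simp_all)
  note add = abelian_monoid.a_closed[OF abelian_group.axioms(1)[OF left_module.axioms(2)[OF left_module_Hom_PSh[OF K]]]]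
  note smult = left_module.smult_closed[OF left_module_Hom_PSh[OF K]]
  {
    fix F G :: "('o, 'm, 'k, 'v) presheaf"
    assume "linear_functor K (op_cat B) (VecCat K) F" "linear_functor K (op_cat B) (VecCat K) G"
    then show "module K (Hom_PSh K B F G)"
      by (intro left_module_imp_module K left_module_Hom_PSh)
  next
    fix F :: "('o, 'm, 'k, 'v) presheaf"
    assume "linear_functor K (op_cat B) (VecCat K) F"
    then show "(\<lambda>b\<in>Ob B. \<lambda>x\<in>carrier (fobj F b). x) \<in> carrier (Hom_PSh K B F F)"
      by (rule ident_Hom_PSh)
  next
    fix F G H :: "('o, 'm, 'k, 'v) presheaf" and \<theta>
    assume F: "linear_functor K (op_cat B) (VecCat K) F" and G: "linear_functor K (op_cat B) (VecCat K) G"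
      and H: "linear_functor K (op_cat B) (VecCat K) H" and t: "\<theta> \<in> carrier (Hom_PSh K B F G)"
    show "linear_map K (Hom_PSh K B G H) (Hom_PSh K B F H) (\<lambda>\<eta>. nat_comp B F \<eta> \<theta>)"
    proof (rule linear_mapI)
      show "nat_comp B F (\<eta> \<oplus>\<^bsub>Hom_PSh K B G H\<^esub> \<zeta>) \<theta> =
          nat_comp B F \<eta> \<theta> \<oplus>\<^bsub>Hom_PSh K B F H\<^esub> nat_comp B F \<zeta> \<theta>"
        if "\<eta> \<in> carrier (Hom_PSh K B G H)" "\<zeta> \<in> carrier (Hom_PSh K B G H)" for \<eta> \<zeta>
        by (rule Hom_PSh_eqI[OF nat_comp_closed[OF F t add[OF G H that]]
              add[OF F H nat_comp_closed[OF F t that(1)] nat_comp_closed[OF F t that(2)]]])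
          (simp add: Hom_PSh_simps Hom_PShD(2)[OF t])
      show "nat_comp B F (c \<odot>\<^bsub>Hom_PSh K B G H\<^esub> \<eta>) \<theta> =
          c \<odot>\<^bsub>Hom_PSh K B F H\<^esub> nat_comp B F \<eta> \<theta>"
        if "c \<in> carrier K" "\<eta> \<in> carrier (Hom_PSh K B G H)" for c \<eta>
        by (rule Hom_PSh_eqI[OF nat_comp_closed[OF F t smult[OF G H that]]
              smult[OF F H that(1) nat_comp_closed[OF F t that(2)]]])
          (simp add: Hom_PSh_simps Hom_PShD(2)[OF t])
    qed (rule nat_comp_closed[OF F t])
  next
    fix F G H :: "('o, 'm, 'k, 'v) presheaf" and \<eta>
    assume F: "linear_functor K (op_cat B) (VecCat K) F" and G: "linear_functor K (op_cat B) (VecCat K) G"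
      and H: "linear_functor K (op_cat B) (VecCat K) H" and e: "\<eta> \<in> carrier (Hom_PSh K B G H)"
    show "linear_map K (Hom_PSh K B F G) (Hom_PSh K B F H) (nat_comp B F \<eta>)"
    proof (rule linear_mapI)
      show "nat_comp B F \<eta> (\<theta> \<oplus>\<^bsub>Hom_PSh K B F G\<^esub> \<zeta>) =
          nat_comp B F \<eta> \<theta> \<oplus>\<^bsub>Hom_PSh K B F H\<^esub> nat_comp B F \<eta> \<zeta>"
        if "\<theta> \<in> carrier (Hom_PSh K B F G)" "\<zeta> \<in> carrier (Hom_PSh K B F G)" for \<theta> \<zeta>
        by (rule Hom_PSh_eqI[OF nat_comp_closed[OF F add[OF F G that] e]
              add[OF F H nat_comp_closed[OF F that(1) e] nat_comp_closed[OF F that(2) e]]])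
          (simp add: Hom_PSh_simps Hom_PShD(2)[OF that(1)] Hom_PShD(2)[OF that(2)] Hom_PShD(3)[OF e])
      show "nat_comp B F \<eta> (c \<odot>\<^bsub>Hom_PSh K B F G\<^esub> \<theta>) =
          c \<odot>\<^bsub>Hom_PSh K B F H\<^esub> nat_comp B F \<eta> \<theta>"
        if "c \<in> carrier K" "\<theta> \<in> carrier (Hom_PSh K B F G)" for c \<theta>
        using that(1)
        by (intro Hom_PSh_eqI[OF nat_comp_closed[OF F smult[OF F G that] e]
              smult[OF F H that(1) nat_comp_closed[OF F that(2) e]]])
          (simp add: Hom_PSh_simps Hom_PShD(2)[OF that(2)] Hom_PShD(4)[OF e])
    qed (rule nat_comp_closed[OF F _ e])
  next
    fix F G :: "('o, 'm, 'k, 'v) presheaf" and \<theta>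
    assume F: "linear_functor K (op_cat B) (VecCat K) F" and G: "linear_functor K (op_cat B) (VecCat K) G"
      and t: "\<theta> \<in> carrier (Hom_PSh K B F G)"
    show "nat_comp B F (\<lambda>b\<in>Ob B. \<lambda>x\<in>carrier (fobj G b). x) \<theta> = \<theta>"
      using Hom_PShD(2)[OF t]
      by (intro Hom_PSh_eqI[OF nat_comp_closed[OF F t ident_Hom_PSh[OF G]] t]) simp
    show "nat_comp B F \<theta> (\<lambda>b\<in>Ob B. \<lambda>x\<in>carrier (fobj F b). x) = \<theta>"
      by (intro Hom_PSh_eqI[OF nat_comp_closed[OF F ident_Hom_PSh[OF F] t] t]) simp
  next
    fix F G H J :: "('o, 'm, 'k, 'v) presheaf" and \<theta> \<eta> \<zeta>
    assume F: "linear_functor K (op_cat B) (VecCat K) F" and G: "linear_functor K (op_cat B) (VecCat K) G"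
      and t: "\<theta> \<in> carrier (Hom_PSh K B F G)" and e: "\<eta> \<in> carrier (Hom_PSh K B G H)"
      and z: "\<zeta> \<in> carrier (Hom_PSh K B H J)"
    show "nat_comp B F \<zeta> (nat_comp B F \<eta> \<theta>) = nat_comp B F (nat_comp B G \<zeta> \<eta>) \<theta>"
      using Hom_PShD(2)[OF t]
      by (intro Hom_PSh_eqI[OF nat_comp_closed[OF F nat_comp_closed[OF F t e] z]
            nat_comp_closed[OF F t nat_comp_closed[OF G e z]]]) simp
  }
qed

section \<open>The coend of a presheaf\<close>

locale module_functor =
  fixes K :: "'k ring" and A :: "('k, 'a) module" and B :: "('o, 'm, 'k) lincat"
    and i :: "('o, 'm, 'a, 'i) modfun"
  assumes K: "cring K" and algebra: "assoc_algebra K A"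
    and functor_i: "linear_functor K B (ModCat A) i"
begin

interpretation I: linear_functor K B "ModCat A" i by (rule functor_i)

abbreviation psh :: "('o, 'm, 'k, 'f) presheaf \<Rightarrow> bool"
  where "psh F \<equiv> linear_functor K (op_cat B) (VecCat K) F"

lemma ring_A: "ring A"
  using algebra by (simp add: assoc_algebra_def)

lemma i_module: "b \<in> Ob B \<Longrightarrow> left_module A (fobj i b)"
  using I.fobj_in[of b] by simp

lemma i_arr: "b \<in> Ob B \<Longrightarrow> b' \<in> Ob B \<Longrightarrow> f \<in> carrier (Hom B b b') \<Longrightarrow>
    farr i b b' f \<in> linear_maps A (fobj i b) (fobj i b')"
  using linear_mapD(1)[OF I.farr_linear] by simp

lemmas i_arrD = linear_mapsD[OF i_arr]

lemma i_arr_add: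
  "b \<in> Ob B \<Longrightarrow> b' \<in> Ob B \<Longrightarrow> f \<in> carrier (Hom B b b') \<Longrightarrow> g \<in> carrier (Hom B b b') \<Longrightarrow>
    x \<in> carrier (fobj i b) \<Longrightarrow>
    farr i b b' (f \<oplus>\<^bsub>Hom B b b'\<^esub> g) x = farr i b b' f x \<oplus>\<^bsub>fobj i b'\<^esub> farr i b b' g x"
  using linear_mapD(2)[OF I.farr_linear] by simp

lemma i_arr_smult:
  "b \<in> Ob B \<Longrightarrow> b' \<in> Ob B \<Longrightarrow> c \<in> carrier K \<Longrightarrow> f \<in> carrier (Hom B b b') \<Longrightarrow>
    x \<in> carrier (fobj i b) \<Longrightarrow>
    farr i b b' (c \<odot>\<^bsub>Hom B b b'\<^esub> f) x = (c \<odot>\<^bsub>A\<^esub> \<one>\<^bsub>A\<^esub>) \<odot>\<^bsub>fobj i b'\<^esub> farr i b b' f x"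
  using linear_mapD(3)[OF I.farr_linear] by simp

lemma i_arr_ident: "b \<in> Ob B \<Longrightarrow> x \<in> carrier (fobj i b) \<Longrightarrow> farr i b b (Ident B b) x = x"
  using I.farr_ident[of b] by simp

lemma i_arr_comp:
  "a \<in> Ob B \<Longrightarrow> b \<in> Ob B \<Longrightarrow> c \<in> Ob B \<Longrightarrow> f \<in> carrier (Hom B a b) \<Longrightarrow> g \<in> carrier (Hom B b c) \<Longrightarrow>
    x \<in> carrier (fobj i a) \<Longrightarrow> farr i a c (Cmp B a b c g f) x = farr i b c g (farr i a b f x)"
  using I.farr_comp[of a b c f g] by (simp add: compose_def)

abbreviation pure where "pure F b b' x v \<equiv> pure_tensor K (scalars A (fobj i b)) (fobj F b') x v"

text \<open>
  The class of \<open>x \<otimes> v\<close> in the coend. Equations between linear maps out of \<open>|F|\<close> are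
  tested on these classes.
\<close>

definition coend_gen :: "('o, 'm, 'k, 'f) presheaf \<Rightarrow> 'o \<Rightarrow> 'i \<Rightarrow> 'f \<Rightarrow> ('o \<Rightarrow> ('k, 'i, 'f) tensor) set"
  where "coend_gen F b x v = coend_inj K A B i F b (pure F b b x v)"

context
  fixes F :: "('o, 'm, 'k, 'f) presheaf"
  assumes F: "psh F"
begin

lemmas F_module = presheafD(1)[OF F]
lemmas F_arr = presheafD(2)[OF F]
lemmas F_arrD = linear_mapsD[OF F_arr]

lemma left_module_integrand:
  "b \<in> Ob B \<Longrightarrow> b' \<in> Ob B \<Longrightarrow> left_module A (integrand K A i F b b')"
  unfolding integrand_def by (intro left_module_tensor_left[OF algebra] i_module F_module)

lemma pure_closed:
  "b \<in> Ob B \<Longrightarrow> b' \<in> Ob B \<Longrightarrow> x \<in> carrier (fobj i b) \<Longrightarrow> v \<in> carrier (fobj F b') \<Longrightarrow>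
    pure F b b' x v \<in> carrier (integrand K A i F b b')"
  unfolding integrand_def by (intro tensor_left_pure_closed[OF algebra] i_module F_module)

lemma integrand_left:
  assumes "b \<in> Ob B" "b' \<in> Ob B" "f \<in> carrier (Hom B b b')"
  shows "linear_map A (integrand K A i F b b') (integrand K A i F b' b') (integrand_left K A i F b b' f)"
    and "x \<in> carrier (fobj i b) \<Longrightarrow> v \<in> carrier (fobj F b') \<Longrightarrow>
      integrand_left K A i F b b' f (pure F b b' x v) = pure F b' b' (farr i b b' f x) v"
  unfolding integrand_def integrand_left_def
  using tensor_left_map[OF algebra i_module F_module i_module F_module i_arrD(2) linear_map_ident, OF
      assms(1) assms(2) assms(2) assms(2) assms(2) assms(2) assms] by simp_all

lemma integrand_right:
  assumes "b \<in> Ob B" "b' \<in> Ob B" "f \<in> carrier (Hom B b b')"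
  shows "linear_map A (integrand K A i F b b') (integrand K A i F b b) (integrand_right K A i F b b' f)"
    and "x \<in> carrier (fobj i b) \<Longrightarrow> v \<in> carrier (fobj F b') \<Longrightarrow>
      integrand_right K A i F b b' f (pure F b b' x v) = pure F b b x (farr F b' b f v)"
  unfolding integrand_def integrand_right_def
  using tensor_left_map[OF algebra i_module F_module i_module F_module linear_map_ident F_arrD(2), OF
      assms(1) assms(2) assms(2) assms(1) assms(1) assms(1) assms] by simp_all

lemma left_module_integrand_sum: "left_module A (integrand_sum K A B i F)"
  unfolding integrand_sum_def by (intro left_module_direct_sum left_module_integrand ring_A)

lemma linear_map_integrand_inj:
  "b \<in> Ob B \<Longrightarrow> linear_map A (integrand K A i F b b) (integrand_sum K A B i F)
    (sum_inj (Ob B) (\<lambda>b. integrand K A i F b b) b)"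
  unfolding integrand_sum_def by (intro linear_map_sum_inj left_module_integrand ring_A)

lemma sum_pure_closed:
  "b \<in> Ob B \<Longrightarrow> x \<in> carrier (fobj i b) \<Longrightarrow> v \<in> carrier (fobj F b) \<Longrightarrow>
    sum_pure K A B i F b x v \<in> carrier (integrand_sum K A B i F)"
  unfolding sum_pure_def by (intro linear_mapD(1)[OF linear_map_integrand_inj] pure_closed)

definition coend_relators :: "('o \<Rightarrow> ('k, 'i, 'f) tensor) set"
  where "coend_relators =
    {sum_pure K A B i F b' (farr i b b' f x) v \<ominus>\<^bsub>integrand_sum K A B i F\<^esub>
       sum_pure K A B i F b x (farr F b' b f v)
      | b b' f x v. b \<in> Ob B \<and> b' \<in> Ob B \<and> f \<in> carrier (Hom B b b') \<and>
          x \<in> carrier (fobj i b) \<and> v \<in> carrier (fobj F b')}"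

lemma coend_rel_span: "coend_rel K A B i F = span_module (integrand_sum K A B i F) A coend_relators"
  by (simp add: coend_rel_def coend_relators_def)

lemma coend_relators_closed: "coend_relators \<subseteq> carrier (integrand_sum K A B i F)"
proof -
  interpret S: left_module A "integrand_sum K A B i F" by (rule left_module_integrand_sum)
  show ?thesis
    unfolding coend_relators_def
    by (auto intro!: S.M.minus_closed sum_pure_closed simp: i_arrD(3) F_arrD(3))
qed

lemma submodule_coend_rel: "submodule (coend_rel K A B i F) A (integrand_sum K A B i F)"
  unfolding coend_rel_span by (intro submodule_span left_module_integrand_sum coend_relators_closed)

lemma left_module_coend: "left_module A (coend K A B i F)"
  unfolding coend_def by (intro left_module_quot left_module_integrand_sum submodule_coend_rel)

lemma linear_map_coend_coset:
  "linear_map A (integrand_sum K A B i F) (coend K A B i F)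
    (\<lambda>x. coend_rel K A B i F +>\<^bsub>integrand_sum K A B i F\<^esub> x)"
  unfolding coend_def by (intro linear_map_coset left_module_integrand_sum submodule_coend_rel)

lemma coend_inj_linear:
  assumes "b \<in> Ob B"
  shows "coend_inj K A B i F b \<in> linear_maps A (integrand K A i F b b) (coend K A B i F)"
  using assms unfolding coend_inj_def
  by (simp add: restrict_linear_maps[OF left_module_integrand[OF assms assms]
        linear_map_comp[OF linear_map_integrand_inj[OF assms] linear_map_coend_coset]])

lemma coend_gen_coset:
  "b \<in> Ob B \<Longrightarrow> x \<in> carrier (fobj i b) \<Longrightarrow> v \<in> carrier (fobj F b) \<Longrightarrow>
    coend_gen F b x v = coend_rel K A B i F +>\<^bsub>integrand_sum K A B i F\<^esub> sum_pure K A B i F b x v"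
  by (simp add: coend_gen_def coend_inj_def sum_pure_def pure_closed)

lemma coend_gen_closed:
  "b \<in> Ob B \<Longrightarrow> x \<in> carrier (fobj i b) \<Longrightarrow> v \<in> carrier (fobj F b) \<Longrightarrow>
    coend_gen F b x v \<in> carrier (coend K A B i F)"
  unfolding coend_gen_def by (intro linear_mapsD(3)[OF coend_inj_linear] pure_closed)

lemma coend_gen_linear_left:
  assumes "b \<in> Ob B" "v \<in> carrier (fobj F b)"
  shows "linear_map A (fobj i b) (coend K A B i F) (\<lambda>x. coend_gen F b x v)"
  unfolding coend_gen_def
  using linear_map_comp[OF pure_tensor_left_linear_left[OF algebra i_module F_module]
      linear_mapsD(2)[OF coend_inj_linear, unfolded integrand_def]] assms
  by blast

lemma coend_gen_linear_right:
  assumes "b \<in> Ob B" "x \<in> carrier (fobj i b)"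
  shows "linear_map K (fobj F b) (scalars A (coend K A B i F)) (coend_gen F b x)"
  unfolding coend_gen_def
  using linear_map_comp[OF pure_tensor_left_linear_right[OF algebra i_module F_module]
      linear_map_scalars[OF algebra linear_mapsD(2)[OF coend_inj_linear, unfolded integrand_def]]] assms
  by blast

lemma coend_gen_dinatural:
  assumes "b \<in> Ob B" "b' \<in> Ob B" "f \<in> carrier (Hom B b b')"
    and "x \<in> carrier (fobj i b)" "v \<in> carrier (fobj F b')"
  shows "coend_gen F b' (farr i b b' f x) v = coend_gen F b x (farr F b' b f v)"
proof -
  let ?S = "integrand_sum K A B i F"
  have "sum_pure K A B i F b' (farr i b b' f x) v \<ominus>\<^bsub>?S\<^esub> sum_pure K A B i F b x (farr F b' b f v)
      \<in> coend_rel K A B i F"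
    unfolding coend_rel_span using assms
    by (intro subsetD[OF span_module_superset]) (unfold coend_relators_def, blast)
  then show ?thesis
    using assms
    by (simp add: coend_gen_coset i_arrD(3) F_arrD(3) sum_pure_closed
        coset_eq_iff[OF left_module_integrand_sum submodule_coend_rel])
qed

text \<open>
  Every element of \<open>|F|\<close> is the class of a finite sum of elements of the summands, each of which is a
  sum of pure tensors. So two linear maps that agree on the classes of pure tensors agree first on
  each summand and then everywhere.
\<close>

lemma coend_linear_ext:
  assumes V: "left_module A V"
    and g: "linear_map A (coend K A B i F) V g" and h: "linear_map A (coend K A B i F) V h"
    and gen: "\<And>b x v. b \<in> Ob B \<Longrightarrow> x \<in> carrier (fobj i b) \<Longrightarrow> v \<in> carrier (fobj F b) \<Longrightarrow>
      g (coend_gen F b x v) = h (coend_gen F b x v)"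
    and z: "z \<in> carrier (coend K A B i F)"
  shows "g z = h z"
proof -
  let ?S = "integrand_sum K A B i F" and ?q = "\<lambda>s. coend_rel K A B i F +>\<^bsub>integrand_sum K A B i F\<^esub> s"
  let ?inj = "sum_inj (Ob B) (\<lambda>b. integrand K A i F b b)"
  note gq = linear_map_comp[OF linear_map_coend_coset g] and hq = linear_map_comp[OF linear_map_coend_coset h]
  have inj: "g (?q (?inj b t)) = h (?q (?inj b t))"
    if b: "b \<in> Ob B" and t: "t \<in> carrier (integrand K A i F b b)" for b t
  proof (rule tensor_left_linear_ext[OF algebra i_module[OF b] F_module[OF b b]])
    show "linear_map A (tensor_left K A (fobj i b) (fobj F b)) V (\<lambda>t. g (?q (?inj b t)))"
      using linear_map_comp[OF linear_map_integrand_inj[OF b] gq] by (simp add: integrand_def)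
    show "linear_map A (tensor_left K A (fobj i b) (fobj F b)) V (\<lambda>t. h (?q (?inj b t)))"
      using linear_map_comp[OF linear_map_integrand_inj[OF b] hq] by (simp add: integrand_def)
    show "g (?q (?inj b (pure F b b x v))) = h (?q (?inj b (pure F b b x v)))"
      if "x \<in> carrier (fobj i b)" "v \<in> carrier (fobj F b)" for x v
      using gen[OF b that] coend_gen_coset[OF b that] by (simp add: sum_pure_def)
    show "t \<in> carrier (tensor_left K A (fobj i b) (fobj F b))"
      using t by (simp add: integrand_def)
  qed
  obtain s where s: "s \<in> carrier ?S" "z = ?q s"
    using z by (auto simp: coend_def quot_module_simps(1))
  have "s \<in> {s \<in> carrier ?S. g (?q s) = h (?q s)}"
  proof (rule direct_sum_generated[OF ring_A left_module_integrand])
    show "submodule {s \<in> carrier ?S. g (?q s) = h (?q s)} A (direct_sum (Ob B) (\<lambda>b. integrand K A i F b b))"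
      using submodule_equalizer[OF left_module_integrand_sum V gq hq] by (simp add: integrand_sum_def)
    show "?inj b t \<in> {s \<in> carrier ?S. g (?q s) = h (?q s)}"
      if "b \<in> Ob B" "t \<in> carrier (integrand K A i F b b)" for b t
      using inj[OF that] linear_mapD(1)[OF linear_map_integrand_inj[OF that(1)] that(2)] by simp
    show "s \<in> carrier (direct_sum (Ob B) (\<lambda>b. integrand K A i F b b))"
      using s(1) by (simp add: integrand_sum_def)
  qed
  then show ?thesis using s(2) by simp
qed

text \<open>
  Linearity in the two variables gives a map on each summand \<open>i(b) \<otimes> F(b)\<close>, the direct sum glues
  these maps, and dinaturality says that the result vanishes on the relators of the coend.
\<close>

lemma coend_lift:
  assumes V: "left_module A V"
    and left: "\<And>b v. b \<in> Ob B \<Longrightarrow> v \<in> carrier (fobj F b) \<Longrightarrow> linear_map A (fobj i b) V (\<lambda>x. \<beta> b x v)"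
    and right: "\<And>b x. b \<in> Ob B \<Longrightarrow> x \<in> carrier (fobj i b) \<Longrightarrow>
      linear_map K (fobj F b) (scalars A V) (\<beta> b x)"
    and dinat: "\<And>b b' f x v. b \<in> Ob B \<Longrightarrow> b' \<in> Ob B \<Longrightarrow> f \<in> carrier (Hom B b b') \<Longrightarrow>
      x \<in> carrier (fobj i b) \<Longrightarrow> v \<in> carrier (fobj F b') \<Longrightarrow>
      \<beta> b' (farr i b b' f x) v = \<beta> b x (farr F b' b f v)"
  obtains u where "u \<in> linear_maps A (coend K A B i F) V"
    and "\<And>b x v. b \<in> Ob B \<Longrightarrow> x \<in> carrier (fobj i b) \<Longrightarrow> v \<in> carrier (fobj F b) \<Longrightarrow>
      u (coend_gen F b x v) = \<beta> b x v"
proof -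
  let ?S = "integrand_sum K A B i F" and ?q = "\<lambda>s. coend_rel K A B i F +>\<^bsub>integrand_sum K A B i F\<^esub> s"
  let ?inj = "sum_inj (Ob B) (\<lambda>b. integrand K A i F b b)"
  interpret V: left_module A V by (rule V)
  have "\<exists>h. linear_map A (integrand K A i F b b) V h \<and>
      (\<forall>x\<in>carrier (fobj i b). \<forall>v\<in>carrier (fobj F b). h (pure F b b x v) = \<beta> b x v)"
    if b: "b \<in> Ob B" for b
    by (rule tensor_left_lift[OF algebra i_module[OF b] F_module[OF b b] V left[OF b] right[OF b]])
      (auto simp: integrand_def)
  then obtain h where h: "\<And>b. b \<in> Ob B \<Longrightarrow> linear_map A (integrand K A i F b b) V (h b)"
    "\<And>b x v. b \<in> Ob B \<Longrightarrow> x \<in> carrier (fobj i b) \<Longrightarrow> v \<in> carrier (fobj F b) \<Longrightarrow>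
      h b (pure F b b x v) = \<beta> b x v"
    by metis
  obtain u0 where u0: "linear_map A ?S V u0"
    "\<And>b t. b \<in> Ob B \<Longrightarrow> t \<in> carrier (integrand K A i F b b) \<Longrightarrow> u0 (?inj b t) = h b t"
    unfolding integrand_sum_def
    by (rule direct_sum_lift[where I = "Ob B" and M = "\<lambda>b. integrand K A i F b b",
          OF ring_A left_module_integrand V h(1)]) (assumption, assumption, assumption, rule that[unfolded integrand_sum_def])
  have u0_pure: "u0 (sum_pure K A B i F b x v) = \<beta> b x v"
    if "b \<in> Ob B" "x \<in> carrier (fobj i b)" "v \<in> carrier (fobj F b)" for b x v
    using that by (simp add: sum_pure_def u0(2) pure_closed h(2))
  have vanish: "w \<ominus>\<^bsub>V\<^esub> w = \<zero>\<^bsub>V\<^esub>" if "w \<in> carrier V" for w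
    using that by (simp add: a_minus_def V.M.r_neg)
  have "u0 s \<in> {\<zero>\<^bsub>V\<^esub>}" if "s \<in> coend_relators" for s
    using that unfolding coend_relators_def
    by (auto simp: linear_map_minus[OF left_module_integrand_sum V u0(1)] sum_pure_closed u0_pure
        i_arrD(3) F_arrD(3) dinat vanish linear_mapD(1)[OF left])
  then have "u0 n = \<zero>\<^bsub>V\<^esub>" if "n \<in> coend_rel K A B i F" for n
    using linear_map_span[OF left_module_integrand_sum V u0(1) submodule_zero[OF V]
        coend_relators_closed, of n] that by (simp add: coend_rel_span)
  from quot_module_lift[OF left_module_integrand_sum V u0(1) submodule_coend_rel this]
  obtain u where u: "linear_map A (coend K A B i F) V u"
    "\<And>s. s \<in> carrier ?S \<Longrightarrow> u (?q s) = u0 s"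
    unfolding coend_def by blast
  have "(\<lambda>z\<in>carrier (coend K A B i F). u z) (coend_gen F b x v) = \<beta> b x v"
    if "b \<in> Ob B" "x \<in> carrier (fobj i b)" "v \<in> carrier (fobj F b)" for b x v
    using that coend_gen_closed[OF that]
    by (simp add: coend_gen_coset u(2) sum_pure_closed u0_pure)
  with restrict_linear_maps[OF left_module_coend u(1)] show ?thesis by (rule that)
qed

end

section \<open>Functoriality and universality of the coend\<close>

context
  fixes F :: "('o, 'm, 'k, 'f) presheaf" and G :: "('o, 'm, 'k, 'g) presheaf" and \<theta>
  assumes F: "psh F" and G: "psh G" and \<theta>: "\<theta> \<in> carrier (Hom_PSh K B F G)"
begin

lemma integrand_map:
  assumes "b \<in> Ob B"
  shows "linear_map A (integrand K A i F b b) (integrand K A i G b b) (integrand_map K A i F G \<theta> b)"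
    and "x \<in> carrier (fobj i b) \<Longrightarrow> v \<in> carrier (fobj F b) \<Longrightarrow>
      integrand_map K A i F G \<theta> b (pure F b b x v) = pure G b b x (\<theta> b v)"
  unfolding integrand_def integrand_map_def
  using tensor_left_map[OF algebra i_module F_module i_module F_module linear_map_ident
      linear_mapsD(2)[OF Hom_PShD(1)[OF \<theta>]], OF assms F assms assms assms G assms assms assms]
  by simp_all

text \<open>
  By naturality of \<open>\<theta>\<close>, the map of direct sums takes the relator given by \<open>f, x, v\<close> to the relator
  given by \<open>f, x, \<theta> v\<close>, so it descends to the coends.
\<close>

lemma coend_map_gen_linear:
  shows "coend_map K A B i F G \<theta> \<in> linear_maps A (coend K A B i F) (coend K A B i G)"
    and "b \<in> Ob B \<Longrightarrow> x \<in> carrier (fobj i b) \<Longrightarrow> v \<in> carrier (fobj F b) \<Longrightarrow>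
      coend_map K A B i F G \<theta> (coend_gen F b x v) = coend_gen G b x (\<theta> b v)"
proof -
  let ?SF = "integrand_sum K A B i F" and ?SG = "integrand_sum K A B i G"
  let ?H = "\<lambda>x. \<lambda>b\<in>Ob B. integrand_map K A i F G \<theta> b (x b)"
  note FS = left_module_integrand_sum[OF F] and GS = left_module_integrand_sum[OF G]
  have H: "linear_map A ?SF ?SG ?H"
    unfolding integrand_sum_def
    by (intro linear_map_direct_sum_map(1) ring_A left_module_integrand F G integrand_map(1))
  have H_pure: "?H (sum_pure K A B i F b x v) = sum_pure K A B i G b x (\<theta> b v)"
    if "b \<in> Ob B" "x \<in> carrier (fobj i b)" "v \<in> carrier (fobj F b)" for b x v
    unfolding sum_pure_def using that
    by (subst linear_map_direct_sum_map(2)[OF ring_A left_module_integrand[OF F]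
          left_module_integrand[OF G] integrand_map(1)]) (auto simp: integrand_map(2))
  have "?H s \<in> coend_rel K A B i G" if "s \<in> coend_relators F" for s
  proof -
    from that obtain b b' f x v where s: "s = sum_pure K A B i F b' (farr i b b' f x) v
        \<ominus>\<^bsub>?SF\<^esub> sum_pure K A B i F b x (farr F b' b f v)"
      and mem: "b \<in> Ob B" "b' \<in> Ob B" "f \<in> carrier (Hom B b b')"
        "x \<in> carrier (fobj i b)" "v \<in> carrier (fobj F b')"
      unfolding coend_relators_def[OF F] by blast
    have "?H s = sum_pure K A B i G b' (farr i b b' f x) (\<theta> b' v)
        \<ominus>\<^bsub>?SG\<^esub> sum_pure K A B i G b x (farr G b' b f (\<theta> b' v))"
      using mem unfolding s
      by (subst linear_map_minus[OF FS GS H])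
        (simp_all only: H_pure sum_pure_closed[OF F] i_arrD(3) F_arrD(3)[OF F] Hom_PShD(5)[OF \<theta>])
    then have "?H s \<in> coend_relators G"
      using mem Hom_PShD(2)[OF \<theta>] unfolding coend_relators_def[OF G] by blast
    then show ?thesis
      using span_module_superset unfolding coend_rel_span[OF G] by fast
  qed
  then have rel: "?H n \<in> coend_rel K A B i G" if "n \<in> coend_rel K A B i F" for n
    using linear_map_span[OF FS GS H submodule_coend_rel[OF G] coend_relators_closed[OF F], of n] that
    unfolding coend_rel_span[OF F] by blast
  note sub = submodule_coend_rel[OF F] submodule_coend_rel[OF G]
  show lin: "coend_map K A B i F G \<theta> \<in> linear_maps A (coend K A B i F) (coend K A B i G)"
    unfolding coend_map_def
    using linear_map_quot_map[OF FS GS H sub rel]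
    by (intro restrict_linear_maps left_module_coend F) (simp add: coend_def)
  show "b \<in> Ob B \<Longrightarrow> x \<in> carrier (fobj i b) \<Longrightarrow> v \<in> carrier (fobj F b) \<Longrightarrow>
      coend_map K A B i F G \<theta> (coend_gen F b x v) = coend_gen G b x (\<theta> b v)"
    using quot_map_coset[OF FS GS H sub rel sum_pure_closed[OF F]] coend_gen_closed[OF F]
      Hom_PShD(2)[OF \<theta>]
    by (simp add: coend_map_def coend_gen_coset[OF F] coend_gen_coset[OF G] H_pure)
qed

end

lemmas coend_map_linear = coend_map_gen_linear(1) and coend_map_gen = coend_map_gen_linear(2)

lemma coend_linear_maps_eqI:
  assumes F: "psh F" and V: "left_module A V"
    and "g \<in> linear_maps A (coend K A B i F) V" "h \<in> linear_maps A (coend K A B i F) V"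
    and "\<And>b x v. b \<in> Ob B \<Longrightarrow> x \<in> carrier (fobj i b) \<Longrightarrow> v \<in> carrier (fobj F b) \<Longrightarrow>
      g (coend_gen F b x v) = h (coend_gen F b x v)"
  shows "g = h"
  using linear_maps_eqI[OF assms(3,4)]
    coend_linear_ext[OF F V linear_mapsD(2)[OF assms(3)] linear_mapsD(2)[OF assms(4)] assms(5)]
  by blast

text \<open>
  The two composites in the definition of a cowedge are linear on \<open>i(b) \<otimes> F(b')\<close>, so their equality
  can be tested on pure tensors, where it is dinaturality in the form used by \<open>coend_lift\<close>.
\<close>

lemma cowedge_iff:
  assumes F: "psh F"
  shows "cowedge K A B i F V \<omega> \<longleftrightarrow> left_module A V \<and> \<omega> \<in> extensional (Ob B) \<and>
    (\<forall>b\<in>Ob B. \<omega> b \<in> linear_maps A (integrand K A i F b b) V) \<and>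
    (\<forall>b\<in>Ob B. \<forall>b'\<in>Ob B. \<forall>f\<in>carrier (Hom B b b'). \<forall>x\<in>carrier (fobj i b). \<forall>v\<in>carrier (fobj F b').
      \<omega> b' (pure F b' b' (farr i b b' f x) v) = \<omega> b (pure F b b x (farr F b' b f v)))"
    (is "_ \<longleftrightarrow> ?V \<and> ?ext \<and> ?lin \<and> ?dinat")
proof -
  have "(compose (carrier (integrand K A i F b b')) (\<omega> b') (integrand_left K A i F b b' f) =
        compose (carrier (integrand K A i F b b')) (\<omega> b) (integrand_right K A i F b b' f)) \<longleftrightarrow>
      (\<forall>x\<in>carrier (fobj i b). \<forall>v\<in>carrier (fobj F b').
        \<omega> b' (pure F b' b' (farr i b b' f x) v) = \<omega> b (pure F b b x (farr F b' b f v)))"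
    (is "?eq \<longleftrightarrow> ?gen")
    if lin: ?lin and mem: "b \<in> Ob B" "b' \<in> Ob B" "f \<in> carrier (Hom B b b')" for b b' f
  proof
    assume ?eq
    then show ?gen
      unfolding compose_eq_iff
      using pure_closed[OF F mem(1,2)] integrand_left(2)[OF F mem] integrand_right(2)[OF F mem] by metis
  next
    assume gen: ?gen
    have "\<omega> b' (integrand_left K A i F b b' f t) = \<omega> b (integrand_right K A i F b b' f t)"
      if t: "t \<in> carrier (integrand K A i F b b')" for t
    proof (rule tensor_left_linear_ext[OF algebra i_module[OF mem(1)] F_module[OF F mem(2) mem(2)],
          where g = "\<lambda>t. \<omega> b' (integrand_left K A i F b b' f t)"
            and h = "\<lambda>t. \<omega> b (integrand_right K A i F b b' f t)"])
      show "linear_map A (tensor_left K A (fobj i b) (fobj F b')) V (\<lambda>t. \<omega> b' (integrand_left K A i F b b' f t))"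
        using linear_map_comp[OF integrand_left(1)[OF F mem] linear_mapsD(2)[OF bspec[OF lin mem(2)]]]
        by (simp add: integrand_def)
      show "linear_map A (tensor_left K A (fobj i b) (fobj F b')) V (\<lambda>t. \<omega> b (integrand_right K A i F b b' f t))"
        using linear_map_comp[OF integrand_right(1)[OF F mem] linear_mapsD(2)[OF bspec[OF lin mem(1)]]]
        by (simp add: integrand_def)
      show "\<omega> b' (integrand_left K A i F b b' f (pure F b b' x v)) =
          \<omega> b (integrand_right K A i F b b' f (pure F b b' x v))"
        if "x \<in> carrier (fobj i b)" "v \<in> carrier (fobj F b')" for x v
        using that gen by (simp add: integrand_left(2)[OF F mem] integrand_right(2)[OF F mem])
      show "t \<in> carrier (tensor_left K A (fobj i b) (fobj F b'))"
        using t by (simp add: integrand_def)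
    qed
    then show ?eq unfolding compose_eq_iff by blast
  qed
  then show ?thesis
    unfolding cowedge_def PiE_def Pi_def Hom_Mod_simps by blast
qed

text \<open>
  Translates statements about the coend injections into statements about generators. Composing
  \<open>w\<close> with the identity restricts it to the carrier; \<open>w\<close> itself may be a composite map that is not
  extensional.
\<close>

lemma compose_coend_inj_iff:
  assumes F: "psh F" and V: "left_module A V" and b: "b \<in> Ob B"
    and u: "linear_map A (coend K A B i F) V u" and w: "linear_map A (integrand K A i F b b) V w"
  shows "compose (carrier (integrand K A i F b b)) u (coend_inj K A B i F b) =
      compose (carrier (integrand K A i F b b)) w (\<lambda>t. t) \<longleftrightarrow>
    (\<forall>x\<in>carrier (fobj i b). \<forall>v\<in>carrier (fobj F b). u (coend_gen F b x v) = w (pure F b b x v))"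
    (is "?eq \<longleftrightarrow> ?gen")
proof
  assume ?eq
  then show ?gen
    using pure_closed[OF F b b] by (simp add: compose_eq_iff coend_gen_def)
next
  assume gen: ?gen
  have "u (coend_inj K A B i F b t) = w t" if t: "t \<in> carrier (integrand K A i F b b)" for t
  proof (rule tensor_left_linear_ext[OF algebra i_module[OF b] F_module[OF F b b]])
    show "linear_map A (tensor_left K A (fobj i b) (fobj F b)) V (\<lambda>t. u (coend_inj K A B i F b t))"
      using linear_map_comp[OF linear_mapsD(2)[OF coend_inj_linear[OF F b]] u] by (simp add: integrand_def)
    show "linear_map A (tensor_left K A (fobj i b) (fobj F b)) V w"
      using w by (simp add: integrand_def)
    show "u (coend_inj K A B i F b (pure F b b x v)) = w (pure F b b x v)"
      if "x \<in> carrier (fobj i b)" "v \<in> carrier (fobj F b)" for x v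
      using gen that by (simp add: coend_gen_def)
    show "t \<in> carrier (tensor_left K A (fobj i b) (fobj F b))"
      using t by (simp add: integrand_def)
  qed
  then show ?eq unfolding compose_eq_iff by blast
qed

text \<open>
  The components of a cowedge restrict to a family on \<open>i(b) \<times> F(b)\<close> to which \<open>coend_lift\<close> applies.
\<close>

theorem coend_is_coend:
  assumes F: "psh F"
  shows "is_coend K A B i TYPE('v) F (coend K A B i F) (coend_inj K A B i F)"
  unfolding is_coend_def
proof (intro conjI allI impI)
  show "cowedge K A B i F (coend K A B i F) (coend_inj K A B i F)"
    unfolding cowedge_iff[OF F]
    using left_module_coend[OF F] coend_inj_linear[OF F] coend_gen_dinatural[OF F]
    by (auto simp: coend_gen_def) (simp add: coend_inj_def)
  fix V :: "('a, 'v) module" and \<omega>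
  assume "cowedge K A B i F V \<omega>"
  then have V: "left_module A V"
    and lin: "\<And>b. b \<in> Ob B \<Longrightarrow> \<omega> b \<in> linear_maps A (integrand K A i F b b) V"
    and dinat: "\<And>b b' f x v. b \<in> Ob B \<Longrightarrow> b' \<in> Ob B \<Longrightarrow> f \<in> carrier (Hom B b b') \<Longrightarrow>
      x \<in> carrier (fobj i b) \<Longrightarrow> v \<in> carrier (fobj F b') \<Longrightarrow>
      \<omega> b' (pure F b' b' (farr i b b' f x) v) = \<omega> b (pure F b b x (farr F b' b f v))"
    unfolding cowedge_iff[OF F] by blast+
  note w = linear_mapsD(2)[OF lin]
  have ident: "compose (carrier (integrand K A i F b b)) (\<omega> b) (\<lambda>t. t) = \<omega> b" if "b \<in> Ob B" for b
    using linear_mapsD(1)[OF lin[OF that]] by (auto simp: compose_def fun_eq_iff extensional_def)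
  have iff: "(\<forall>b\<in>Ob B. compose (carrier (integrand K A i F b b)) u (coend_inj K A B i F b) = \<omega> b) \<longleftrightarrow>
      (\<forall>b\<in>Ob B. \<forall>x\<in>carrier (fobj i b). \<forall>v\<in>carrier (fobj F b). u (coend_gen F b x v) = \<omega> b (pure F b b x v))"
    if "u \<in> linear_maps A (coend K A B i F) V" for u
    using compose_coend_inj_iff[OF F V _ linear_mapsD(2)[OF that] w] ident by simp
  obtain u where u: "u \<in> linear_maps A (coend K A B i F) V"
    "\<And>b x v. b \<in> Ob B \<Longrightarrow> x \<in> carrier (fobj i b) \<Longrightarrow> v \<in> carrier (fobj F b) \<Longrightarrow>
      u (coend_gen F b x v) = \<omega> b (pure F b b x v)"
  proof (rule coend_lift[OF F V, of "\<lambda>b x v. \<omega> b (pure F b b x v)"])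
    fix b v assume b: "b \<in> Ob B" and v: "v \<in> carrier (fobj F b)"
    show "linear_map A (fobj i b) V (\<lambda>x. \<omega> b (pure F b b x v))"
      by (rule linear_map_comp[OF pure_tensor_left_linear_left[OF algebra i_module[OF b] F_module[OF F b b] v]
            w[OF b, unfolded integrand_def]])
  next
    fix b x assume b: "b \<in> Ob B" and x: "x \<in> carrier (fobj i b)"
    show "linear_map K (fobj F b) (scalars A V) (\<lambda>v. \<omega> b (pure F b b x v))"
      by (rule linear_map_comp[OF pure_tensor_left_linear_right[OF algebra i_module[OF b] F_module[OF F b b] x]
            linear_map_scalars[OF algebra w[OF b, unfolded integrand_def]]])
  qed (simp_all add: dinat that)
  show "\<exists>!u. u \<in> carrier (Hom_Mod A (coend K A B i F) V) \<and>
      (\<forall>b\<in>Ob B. compose (carrier (integrand K A i F b b)) u (coend_inj K A B i F b) = \<omega> b)"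
  proof (rule ex1I[of _ u], intro conjI)
    show "u \<in> carrier (Hom_Mod A (coend K A B i F) V)" using u(1) by simp
    show "\<forall>b\<in>Ob B. compose (carrier (integrand K A i F b b)) u (coend_inj K A B i F b) = \<omega> b"
      using iff[OF u(1)] u(2) by blast
    fix u' assume u': "u' \<in> carrier (Hom_Mod A (coend K A B i F) V) \<and>
      (\<forall>b\<in>Ob B. compose (carrier (integrand K A i F b b)) u' (coend_inj K A B i F b) = \<omega> b)"
    then have l: "u' \<in> linear_maps A (coend K A B i F) V" by simp
    show "u' = u"
      using u' iff[OF l] u(2) by (intro coend_linear_maps_eqI[OF F V l u(1)]) auto
  qed
qed

text \<open>
  Both composites with a coend injection are linear on its summand, so the condition says that \<open>u\<close>
  and \<open>|\<theta>|\<close> agree on generators.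
\<close>

lemma coend_map_characterization:
  assumes F: "psh F" and G: "psh G" and t: "\<theta> \<in> carrier (Hom_PSh K B F G)"
    and u: "u \<in> linear_maps A (coend K A B i F) (coend K A B i G)"
  shows "u = coend_map K A B i F G \<theta> \<longleftrightarrow>
    (\<forall>b\<in>Ob B. compose (carrier (integrand K A i F b b)) u (coend_inj K A B i F b) =
      compose (carrier (integrand K A i F b b)) (coend_inj K A B i G b) (integrand_map K A i F G \<theta> b))"
proof -
  note GC = left_module_coend[OF G]
  have "compose (carrier (integrand K A i F b b)) (coend_inj K A B i G b) (integrand_map K A i F G \<theta> b) =
      compose (carrier (integrand K A i F b b)) (\<lambda>t. coend_inj K A B i G b (integrand_map K A i F G \<theta> b t)) (\<lambda>t. t)"
    for b by (simp add: compose_def)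
  moreover have "linear_map A (integrand K A i F b b) (coend K A B i G)
      (\<lambda>t. coend_inj K A B i G b (integrand_map K A i F G \<theta> b t))" if "b \<in> Ob B" for b
    by (rule linear_map_comp[OF integrand_map(1)[OF F G t that] linear_mapsD(2)[OF coend_inj_linear[OF G that]]])
  ultimately have "(\<forall>b\<in>Ob B. compose (carrier (integrand K A i F b b)) u (coend_inj K A B i F b) =
        compose (carrier (integrand K A i F b b)) (coend_inj K A B i G b) (integrand_map K A i F G \<theta> b)) \<longleftrightarrow>
      (\<forall>b\<in>Ob B. \<forall>x\<in>carrier (fobj i b). \<forall>v\<in>carrier (fobj F b).
        u (coend_gen F b x v) = coend_map K A B i F G \<theta> (coend_gen F b x v))"
    using compose_coend_inj_iff[OF F GC _ linear_mapsD(2)[OF u]]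
    by (simp add: integrand_map(2)[OF F G t] coend_map_gen[OF F G t] coend_gen_def[symmetric])
  then show ?thesis
    using coend_linear_maps_eqI[OF F GC u coend_map_linear[OF F G t]] by blast
qed

lemma realization_simps [simp]:
  "fobj (realization K A B i) = coend K A B i" "farr (realization K A B i) = coend_map K A B i"
  by (simp_all add: realization_def)

text \<open>
  Each law compares linear maps out of \<open>|F|\<close>, hence has to be checked on generators only. There
  linearity in \<open>\<theta>\<close> becomes linearity of \<open>coend_gen G b x\<close>.
\<close>

theorem linear_functor_realization:
  "linear_functor K (PShCat K B :: (('o, 'm, 'k, 'f) presheaf, _, _) lincat) (ModCat A) (realization K A B i)"
proof (intro linear_functor.intro linear_functor_axioms.intro)
  show "linear_category K (PShCat K B :: (('o, 'm, 'k, 'f) presheaf, _, _) lincat)"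
    by (rule linear_category_PShCat[OF K])
  show "linear_category K (ModCat A)"
    by (rule linear_category_ModCat[OF K algebra])
  note PSh = PShCat_simps ModCat_simps realization_simps
  fix F assume "F \<in> Ob (PShCat K B :: (('o, 'm, 'k, 'f) presheaf, _, _) lincat)"
  then have F: "psh F" by simp
  note FC = left_module_coend[OF F]
  show "fobj (realization K A B i) F \<in> Ob (ModCat A)"
    using FC by simp
  show "farr (realization K A B i) F F (Ident (PShCat K B) F) =
      Ident (ModCat A) (fobj (realization K A B i) F)"
    unfolding PSh
    by (intro coend_linear_maps_eqI[OF F FC] coend_map_linear F ident_Hom_PSh ident_linear_maps FC)
      (simp add: coend_map_gen[OF F F ident_Hom_PSh[OF F]] coend_gen_closed[OF F])
  fix G assume "G \<in> Ob (PShCat K B :: (('o, 'm, 'k, 'f) presheaf, _, _) lincat)"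
  then have G: "psh G" by simp
  note GC = left_module_coend[OF G] and map_linear = coend_map_linear[OF F G] and map_gen = coend_map_gen[OF F G]
  interpret H: left_module K "Hom_PSh K B F G" by (rule left_module_Hom_PSh[OF K F G])
  interpret L: left_module K "Hom_Mod A (coend K A B i F) (coend K A B i G)"
    by (rule left_module_Hom_Mod[OF algebra FC GC])
  show "linear_map K (Hom (PShCat K B) F G)
      (Hom (ModCat A) (fobj (realization K A B i) F) (fobj (realization K A B i) G))
      (farr (realization K A B i) F G)"
    unfolding PSh
  proof (rule linear_mapI)
    fix \<theta> assume t: "\<theta> \<in> carrier (Hom_PSh K B F G)"
    show "coend_map K A B i F G \<theta> \<in> carrier (Hom_Mod A (coend K A B i F) (coend K A B i G))"
      using map_linear[OF t] by simp
    fix \<eta> assume e: "\<eta> \<in> carrier (Hom_PSh K B F G)"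
    show "coend_map K A B i F G (\<theta> \<oplus>\<^bsub>Hom_PSh K B F G\<^esub> \<eta>) =
        coend_map K A B i F G \<theta> \<oplus>\<^bsub>Hom_Mod A (coend K A B i F) (coend K A B i G)\<^esub> coend_map K A B i F G \<eta>"
    proof (rule coend_linear_maps_eqI[OF F GC map_linear[OF H.M.a_closed[OF t e]]])
      show "coend_map K A B i F G \<theta> \<oplus>\<^bsub>Hom_Mod A (coend K A B i F) (coend K A B i G)\<^esub> coend_map K A B i F G \<eta>
          \<in> linear_maps A (coend K A B i F) (coend K A B i G)"
        using L.M.a_closed[unfolded Hom_Mod_simps(1), OF map_linear[OF t] map_linear[OF e]] .
      fix b x v assume m: "b \<in> Ob B" "x \<in> carrier (fobj i b)" "v \<in> carrier (fobj F b)"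
      show "coend_map K A B i F G (\<theta> \<oplus>\<^bsub>Hom_PSh K B F G\<^esub> \<eta>) (coend_gen F b x v) =
          (coend_map K A B i F G \<theta> \<oplus>\<^bsub>Hom_Mod A (coend K A B i F) (coend K A B i G)\<^esub> coend_map K A B i F G \<eta>)
            (coend_gen F b x v)"
        using m linear_mapD(2)[OF coend_gen_linear_right[OF G m(1,2)]] Hom_PShD(2)[OF t] Hom_PShD(2)[OF e]
        by (simp add: map_gen[OF H.M.a_closed[OF t e]] map_gen[OF t] map_gen[OF e] coend_gen_closed[OF F])
          (simp add: Hom_PSh_simps)
    qed
  next
    fix c \<theta> assume c: "c \<in> carrier K" and t: "\<theta> \<in> carrier (Hom_PSh K B F G)"
    show "coend_map K A B i F G (c \<odot>\<^bsub>Hom_PSh K B F G\<^esub> \<theta>) =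
        c \<odot>\<^bsub>Hom_Mod A (coend K A B i F) (coend K A B i G)\<^esub> coend_map K A B i F G \<theta>"
    proof (rule coend_linear_maps_eqI[OF F GC map_linear[OF H.smult_closed[OF c t]]])
      show "c \<odot>\<^bsub>Hom_Mod A (coend K A B i F) (coend K A B i G)\<^esub> coend_map K A B i F G \<theta>
          \<in> linear_maps A (coend K A B i F) (coend K A B i G)"
        using L.smult_closed[unfolded Hom_Mod_simps(1), OF c map_linear[OF t]] .
      fix b x v assume m: "b \<in> Ob B" "x \<in> carrier (fobj i b)" "v \<in> carrier (fobj F b)"
      show "coend_map K A B i F G (c \<odot>\<^bsub>Hom_PSh K B F G\<^esub> \<theta>) (coend_gen F b x v) =
          (c \<odot>\<^bsub>Hom_Mod A (coend K A B i F) (coend K A B i G)\<^esub> coend_map K A B i F G \<theta>) (coend_gen F b x v)"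
        using m c linear_mapD(3)[OF coend_gen_linear_right[OF G m(1,2)]] Hom_PShD(2)[OF t]
        by (simp add: map_gen[OF H.smult_closed[OF c t]] map_gen[OF t] coend_gen_closed[OF F])
          (simp add: Hom_PSh_simps)
    qed
  qed
  fix H \<theta> \<eta> assume "H \<in> Ob (PShCat K B :: (('o, 'm, 'k, 'f) presheaf, _, _) lincat)"
    and "\<theta> \<in> carrier (Hom (PShCat K B) F G)" "\<eta> \<in> carrier (Hom (PShCat K B) G H)"
  then have H: "psh H" and t: "\<theta> \<in> carrier (Hom_PSh K B F G)" and e: "\<eta> \<in> carrier (Hom_PSh K B G H)"
    by simp_all
  note te = nat_comp_closed[OF F t e]
  show "farr (realization K A B i) F H (Cmp (PShCat K B) F G H \<eta> \<theta>) =
      Cmp (ModCat A) (fobj (realization K A B i) F) (fobj (realization K A B i) G)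
        (fobj (realization K A B i) H) (farr (realization K A B i) G H \<eta>) (farr (realization K A B i) F G \<theta>)"
    unfolding PSh
  proof (rule coend_linear_maps_eqI[OF F left_module_coend[OF H] coend_map_linear[OF F H te]])
    show "compose (carrier (coend K A B i F)) (coend_map K A B i G H \<eta>) (coend_map K A B i F G \<theta>)
        \<in> linear_maps A (coend K A B i F) (coend K A B i H)"
      by (rule compose_linear_maps[OF FC map_linear[OF t] coend_map_linear[OF G H e]])
    fix b x v assume m: "b \<in> Ob B" "x \<in> carrier (fobj i b)" "v \<in> carrier (fobj F b)"
    show "coend_map K A B i F H (nat_comp B F \<eta> \<theta>) (coend_gen F b x v) =
        compose (carrier (coend K A B i F)) (coend_map K A B i G H \<eta>) (coend_map K A B i F G \<theta>) (coend_gen F b x v)"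
      using m Hom_PShD(2)[OF t]
      by (simp add: compose_def coend_gen_closed[OF F] coend_map_gen[OF F H te] map_gen[OF t]
          coend_map_gen[OF G H e])
  qed
qed


section \<open>The restricted Yoneda embedding\<close>

lemma yoneda_obj_simps [simp]:
  "fobj (yoneda_obj A i V) b = Hom_Mod A (fobj i b) V"
  "\<phi> \<in> linear_maps A (fobj i b') V \<Longrightarrow>
    farr (yoneda_obj A i V) b' b f \<phi> = compose (carrier (fobj i b)) \<phi> (farr i b b' f)"
  by (simp_all add: yoneda_obj_def compose_def)

lemma yoneda_simps [simp]:
  "fobj (yoneda A B i) V = yoneda_obj A i V"
  "b \<in> Ob B \<Longrightarrow> \<phi> \<in> linear_maps A (fobj i b) V \<Longrightarrow>
    farr (yoneda A B i) V W g b \<phi> = compose (carrier (fobj i b)) g \<phi>"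
  by (simp_all add: yoneda_def)

lemma Hom_Mod_linear_right:
  assumes M: "left_module A M" and V: "left_module A V" and W: "left_module A W"
    and g: "g \<in> linear_maps A V W"
  shows "linear_map K (Hom_Mod A M V) (Hom_Mod A M W) (\<lambda>\<phi>. compose (carrier M) g \<phi>)"
proof (rule linear_mapI)
  note gl = linear_mapsD[OF g]
  interpret V: left_module A V by (rule V)
  interpret L: left_module K "Hom_Mod A M V" by (rule left_module_Hom_Mod[OF algebra M V])
  show "compose (carrier M) g \<phi> \<in> carrier (Hom_Mod A M W)" if "\<phi> \<in> carrier (Hom_Mod A M V)" for \<phi>
    using that compose_linear_maps[OF M _ g] by simp
  show "compose (carrier M) g (\<phi> \<oplus>\<^bsub>Hom_Mod A M V\<^esub> \<psi>) =
      compose (carrier M) g \<phi> \<oplus>\<^bsub>Hom_Mod A M W\<^esub> compose (carrier M) g \<psi>"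
    if "\<phi> \<in> carrier (Hom_Mod A M V)" "\<psi> \<in> carrier (Hom_Mod A M V)" for \<phi> \<psi>
    using that by (simp add: compose_def gl linear_mapsD(3) cong: restrict_cong)
  show "compose (carrier M) g (c \<odot>\<^bsub>Hom_Mod A M V\<^esub> \<phi>) = c \<odot>\<^bsub>Hom_Mod A M W\<^esub> compose (carrier M) g \<phi>"
    if "c \<in> carrier K" "\<phi> \<in> carrier (Hom_Mod A M V)" for c \<phi>
    using gl(5)[OF scalar_closed[OF algebra that(1)] linear_mapsD(3)[OF that(2)[unfolded Hom_Mod_simps(1)]]]
    by (simp add: compose_def cong: restrict_cong)
qed

lemma Hom_Mod_linear_left:
  assumes L: "left_module A L" and f: "f \<in> linear_maps A L M"
  shows "linear_map K (Hom_Mod A M V) (Hom_Mod A L V) (\<lambda>\<phi>. compose (carrier L) \<phi> f)"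
proof (rule linear_mapI)
  show "compose (carrier L) \<phi> f \<in> carrier (Hom_Mod A L V)" if "\<phi> \<in> carrier (Hom_Mod A M V)" for \<phi>
    using that compose_linear_maps[OF L f] by simp
qed (simp_all add: compose_def linear_mapsD(3)[OF f] cong: restrict_cong)

lemma yoneda_obj_presheaf:
  fixes V :: "('a, 'v) module"
  assumes V: "left_module A V"
  shows "psh (yoneda_obj A i V)"
proof (intro linear_functor.intro linear_functor_axioms.intro, simp_all del: yoneda_obj_simps(2))
  show "linear_category K (op_cat B)"
    by (rule linear_category_op_cat[OF I.C.linear_category_axioms])
  show "linear_category K (VecCat K)" by (rule linear_category_VecCat[OF K])
  let ?Y = "yoneda_obj A i V"
  note restr = restrict_linear_maps[OF left_module_Hom_Mod[OF algebra i_module V]]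
  have arr: "farr ?Y b' b f = (\<lambda>\<phi>\<in>carrier (Hom_Mod A (fobj i b') V). compose (carrier (fobj i b)) \<phi> (farr i b b' f))"
    for b b' f by (simp add: yoneda_obj_def)
  fix b assume b: "b \<in> Ob B"
  show "module K (Hom_Mod A (fobj i b) V)"
    by (intro left_module_imp_module K left_module_Hom_Mod[OF algebra] i_module b V)
  show "farr ?Y b b (Ident B b) = (\<lambda>\<phi>\<in>linear_maps A (fobj i b) V. \<phi>)"
  proof -
    have "compose (carrier (fobj i b)) \<phi> (farr i b b (Ident B b)) = \<phi>"
      if "\<phi> \<in> linear_maps A (fobj i b) V" for \<phi>
      by (rule extensionalityI[OF compose_extensional linear_mapsD(1)[OF that]])
        (simp add: compose_def i_arr_ident b)
    then show ?thesis unfolding arr by (simp cong: restrict_cong)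
  qed
  fix b' assume b': "b' \<in> Ob B"
  have arr_lin: "farr ?Y b b' f \<in> linear_maps K (Hom_Mod A (fobj i b) V) (Hom_Mod A (fobj i b') V)"
    if f: "f \<in> carrier (Hom B b' b)" for f
    unfolding arr by (intro restr b b' Hom_Mod_linear_left i_module i_arr f)
  interpret L: left_module K "Hom_Vec K (Hom_Mod A (fobj i b) V) (Hom_Mod A (fobj i b') V)"
    by (intro left_module_Hom_Vec[OF K] left_module_Hom_Mod[OF algebra] i_module b b' V)
  interpret BH: module K "Hom B b' b" by (rule I.C.hom_space[OF b' b])
  show "linear_map K (Hom B b' b) (Hom_Vec K (Hom_Mod A (fobj i b) V) (Hom_Mod A (fobj i b') V)) (farr ?Y b b')"
  proof (rule linear_mapI)
    fix f assume f: "f \<in> carrier (Hom B b' b)"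
    show "farr ?Y b b' f \<in> carrier (Hom_Vec K (Hom_Mod A (fobj i b) V) (Hom_Mod A (fobj i b') V))"
      using arr_lin[OF f] by simp
    show "farr ?Y b b' (f \<oplus>\<^bsub>Hom B b' b\<^esub> g) =
        farr ?Y b b' f \<oplus>\<^bsub>Hom_Vec K (Hom_Mod A (fobj i b) V) (Hom_Mod A (fobj i b') V)\<^esub> farr ?Y b b' g"
      if g: "g \<in> carrier (Hom B b' b)" for g
      unfolding arr using b b' f g
      by (simp add: compose_def i_arr_add i_arrD(3) linear_mapsD(4) cong: restrict_cong)
  next
    fix c f assume c: "c \<in> carrier K" and f: "f \<in> carrier (Hom B b' b)"
    show "farr ?Y b b' (c \<odot>\<^bsub>Hom B b' b\<^esub> f) =
        c \<odot>\<^bsub>Hom_Vec K (Hom_Mod A (fobj i b) V) (Hom_Mod A (fobj i b') V)\<^esub> farr ?Y b b' f"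
      unfolding arr using b b' c f
      by (simp add: compose_def i_arr_smult i_arrD(3) linear_mapsD(5) scalar_closed[OF algebra] cong: restrict_cong)
  qed
  fix b'' f g assume b'': "b'' \<in> Ob B" and f: "f \<in> carrier (Hom B b' b)" and g: "g \<in> carrier (Hom B b'' b')"
  show "farr ?Y b b'' (Cmp B b'' b' b f g) =
      compose (linear_maps A (fobj i b) V) (farr ?Y b' b'' g) (farr ?Y b b' f)"
  proof -
    have "compose (carrier (fobj i b'')) \<phi> (farr i b'' b (Cmp B b'' b' b f g)) =
        compose (carrier (fobj i b'')) (compose (carrier (fobj i b')) \<phi> (farr i b' b f)) (farr i b'' b' g)"
      for \<phi> :: "'i \<Rightarrow> 'v"
      using b b' b'' f g by (simp add: compose_def i_arr_comp i_arrD(3) cong: restrict_cong)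
    moreover have "compose (carrier (fobj i b')) \<phi> (farr i b' b f) \<in> linear_maps A (fobj i b') V"
      if "\<phi> \<in> linear_maps A (fobj i b) V" for \<phi>
      by (rule compose_linear_maps[OF i_module[OF b'] i_arr[OF b' b f] that])
    ultimately show ?thesis
      unfolding arr by (simp add: compose_def[where A = "linear_maps A (fobj i b) V"] cong: restrict_cong)
  qed
qed

lemma yoneda_hom_eqI:
  assumes "\<theta> \<in> carrier (Hom_PSh K B F (yoneda_obj A i V))" "\<eta> \<in> carrier (Hom_PSh K B F (yoneda_obj A i V))"
    and "\<And>b v x. b \<in> Ob B \<Longrightarrow> v \<in> carrier (fobj F b) \<Longrightarrow> x \<in> carrier (fobj i b) \<Longrightarrow> \<theta> b v x = \<eta> b v x"
  shows "\<theta> = \<eta>"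
proof (rule Hom_PSh_eqI[OF assms(1,2)])
  fix b v assume b: "b \<in> Ob B" and v: "v \<in> carrier (fobj F b)"
  have "\<theta> b v \<in> linear_maps A (fobj i b) V" "\<eta> b v \<in> linear_maps A (fobj i b) V"
    using Hom_PShD(2)[OF assms(1) b v] Hom_PShD(2)[OF assms(2) b v] by simp_all
  then show "\<theta> b v = \<eta> b v" by (rule linear_maps_eqI) (rule assms(3)[OF b v])
qed

theorem linear_functor_yoneda:
  "linear_functor K (ModCat A :: (('a, 'v) module, _, _) lincat) (PShCat K B) (yoneda A B i)"
proof (intro linear_functor.intro linear_functor_axioms.intro)
  show "linear_category K (ModCat A :: (('a, 'v) module, _, _) lincat)"
    by (rule linear_category_ModCat[OF K algebra])
  show "linear_category K (PShCat K B :: (('o, 'm, 'k, 'i \<Rightarrow> 'v) presheaf, _, _) lincat)"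
    by (rule linear_category_PShCat[OF K])
  have arr: "farr (yoneda A B i) V W g = (\<lambda>b\<in>Ob B. \<lambda>\<phi>\<in>carrier (fobj (yoneda_obj A i V) b). compose (carrier (fobj i b)) g \<phi>)"
    for V W :: "('a, 'v) module" and g
    by (simp add: yoneda_def)
  fix V assume "V \<in> Ob (ModCat A :: (('a, 'v) module, _, _) lincat)"
  then have V: "left_module A V" by simp
  note VY = yoneda_obj_presheaf[OF V]
  show "fobj (yoneda A B i) V \<in> Ob (PShCat K B)" using VY by simp
  show "farr (yoneda A B i) V V (Ident (ModCat A) V) = Ident (PShCat K B) (fobj (yoneda A B i) V)"
  proof -
    have "compose (carrier (fobj i b)) (\<lambda>x\<in>carrier V. x) \<phi> = \<phi>"
      if "\<phi> \<in> linear_maps A (fobj i b) V" for b \<phi>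
      using linear_mapsD(1,3)[OF that] by (intro Id_compose) auto
    then show ?thesis unfolding arr by (simp cong: restrict_cong)
  qed
  have closed: "farr (yoneda A B i) V W g \<in> carrier (Hom_PSh K B (yoneda_obj A i V) (yoneda_obj A i W))"
    if W: "left_module A W" and g: "g \<in> linear_maps A V W" for W g
    unfolding arr
  proof (rule Hom_PShI)
    show "left_module K (fobj (yoneda_obj A i V) b)" if "b \<in> Ob B" for b
      by (rule presheafD(1)[OF VY that that])
    show "linear_map K (fobj (yoneda_obj A i V) b) (fobj (yoneda_obj A i W) b) (compose (carrier (fobj i b)) g)"
      if "b \<in> Ob B" for b
      using Hom_Mod_linear_right[OF i_module[OF that] V W g] by simp
    fix b b' f \<phi> assume m: "b \<in> Ob B" "b' \<in> Ob B" "f \<in> carrier (Hom B b b')"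
      and "\<phi> \<in> carrier (fobj (yoneda_obj A i V) b')"
    then have p: "\<phi> \<in> linear_maps A (fobj i b') V" by simp
    have "compose (carrier (fobj i b)) \<phi> (farr i b b' f) \<in> linear_maps A (fobj i b) V"
      by (rule compose_linear_maps[OF i_module[OF m(1)] i_arr[OF m] p])
    moreover have "compose (carrier (fobj i b')) g \<phi> \<in> linear_maps A (fobj i b') W"
      by (rule compose_linear_maps[OF i_module[OF m(2)] p g])
    ultimately show "farr (yoneda_obj A i V) b' b f \<phi> \<in> carrier (fobj (yoneda_obj A i V) b) \<and>
        compose (carrier (fobj i b)) g (farr (yoneda_obj A i V) b' b f \<phi>) =
        farr (yoneda_obj A i W) b' b f (compose (carrier (fobj i b')) g \<phi>)"
      using p m by (simp add: compose_def i_arrD(3) cong: restrict_cong)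
  qed
  fix W assume "W \<in> Ob (ModCat A :: (('a, 'v) module, _, _) lincat)"
  then have W: "left_module A W" by simp
  note WY = yoneda_obj_presheaf[OF W]
  interpret L: left_module K "Hom_Mod A V W" by (rule left_module_Hom_Mod[OF algebra V W])
  interpret P: left_module K "Hom_PSh K B (yoneda_obj A i V) (yoneda_obj A i W)"
    by (rule left_module_Hom_PSh[OF K VY WY])
  have app: "farr (yoneda A B i) V W g b \<phi> x = g (\<phi> x)"
    if "b \<in> Ob B" "\<phi> \<in> linear_maps A (fobj i b) V" "x \<in> carrier (fobj i b)" for b \<phi> x g
    using that by (simp add: compose_def)
  show "linear_map K (Hom (ModCat A) V W) (Hom (PShCat K B) (fobj (yoneda A B i) V) (fobj (yoneda A B i) W))
      (farr (yoneda A B i) V W)"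
    unfolding ModCat_simps PShCat_simps yoneda_simps(1)
  proof (rule linear_mapI)
    fix g assume g: "g \<in> carrier (Hom_Mod A V W)"
    note g' = g[unfolded Hom_Mod_simps(1)]
    show "farr (yoneda A B i) V W g \<in> carrier (Hom_PSh K B (yoneda_obj A i V) (yoneda_obj A i W))"
      by (rule closed[OF W g'])
    fix h assume h: "h \<in> carrier (Hom_Mod A V W)"
    note h' = h[unfolded Hom_Mod_simps(1)]
    show "farr (yoneda A B i) V W (g \<oplus>\<^bsub>Hom_Mod A V W\<^esub> h) = farr (yoneda A B i) V W g
        \<oplus>\<^bsub>Hom_PSh K B (yoneda_obj A i V) (yoneda_obj A i W)\<^esub> farr (yoneda A B i) V W h"
      by (rule yoneda_hom_eqI[OF closed[OF W L.M.a_closed[OF g h, unfolded Hom_Mod_simps(1)]]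
            P.M.a_closed[OF closed[OF W g'] closed[OF W h']]])
        (simp add: app linear_mapsD(3) Hom_PSh_simps del: yoneda_simps(2))
  next
    fix c g assume c: "c \<in> carrier K" and g: "g \<in> carrier (Hom_Mod A V W)"
    note g' = g[unfolded Hom_Mod_simps(1)]
    show "farr (yoneda A B i) V W (c \<odot>\<^bsub>Hom_Mod A V W\<^esub> g) =
        c \<odot>\<^bsub>Hom_PSh K B (yoneda_obj A i V) (yoneda_obj A i W)\<^esub> farr (yoneda A B i) V W g"
      by (rule yoneda_hom_eqI[OF closed[OF W L.smult_closed[OF c g, unfolded Hom_Mod_simps(1)]]
            P.smult_closed[OF c closed[OF W g']]])
        (simp add: app linear_mapsD(3) Hom_PSh_simps del: yoneda_simps(2))
  qed
  fix X g h assume "X \<in> Ob (ModCat A :: (('a, 'v) module, _, _) lincat)"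
    and "g \<in> carrier (Hom (ModCat A) V W)" "h \<in> carrier (Hom (ModCat A) W X)"
  then have g: "g \<in> linear_maps A V W" and h: "h \<in> linear_maps A W X" by simp_all
  have "compose (carrier (fobj i b)) (compose (carrier V) h g) \<phi> =
      compose (carrier (fobj i b)) h (compose (carrier (fobj i b)) g \<phi>)"
    if "\<phi> \<in> linear_maps A (fobj i b) V" for b \<phi>
    using linear_mapsD(3)[OF that] by (simp add: compose_def cong: restrict_cong)
  moreover have "compose (carrier (fobj i b)) g \<phi> \<in> linear_maps A (fobj i b) W"
    if "b \<in> Ob B" "\<phi> \<in> linear_maps A (fobj i b) V" for b \<phi>
    by (rule compose_linear_maps[OF i_module[OF that(1)] that(2) g])
  ultimately show "farr (yoneda A B i) V X (Cmp (ModCat A) V W X h g) =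
      Cmp (PShCat K B) (fobj (yoneda A B i) V) (fobj (yoneda A B i) W) (fobj (yoneda A B i) X)
        (farr (yoneda A B i) W X h) (farr (yoneda A B i) V W g)"
    unfolding arr
    by (simp add: nat_comp_def compose_def[where A = "linear_maps A (fobj i _) V"] cong: restrict_cong)
qed


section \<open>The adjunction\<close>

lemma adj_transpose_gen:
  "adj_transpose K A B i F V \<phi> =
    (\<lambda>b\<in>Ob B. \<lambda>v\<in>carrier (fobj F b). \<lambda>x\<in>carrier (fobj i b). \<phi> (coend_gen F b x v))"
  by (simp add: adj_transpose_def coend_gen_def)

lemma adj_transpose_apply:
  "b \<in> Ob B \<Longrightarrow> v \<in> carrier (fobj F b) \<Longrightarrow> x \<in> carrier (fobj i b) \<Longrightarrow>
    adj_transpose K A B i F V \<phi> b v x = \<phi> (coend_gen F b x v)"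
  by (simp add: adj_transpose_gen)

lemma adj_transpose_closed:
  assumes F: "psh F" and V: "left_module A V" and p: "\<phi> \<in> linear_maps A (coend K A B i F) V"
  shows "adj_transpose K A B i F V \<phi> \<in> carrier (Hom_PSh K B F (yoneda_obj A i V))"
  unfolding adj_transpose_gen
proof (rule Hom_PShI)
  have inner: "(\<lambda>x\<in>carrier (fobj i b). \<phi> (coend_gen F b x v)) \<in> linear_maps A (fobj i b) V"
    if "b \<in> Ob B" "v \<in> carrier (fobj F b)" for b v
    by (rule restrict_linear_maps[OF i_module[OF that(1)]
          linear_map_comp[OF coend_gen_linear_left[OF F that] linear_mapsD(2)[OF p]]])
  show "left_module K (fobj F b)" if "b \<in> Ob B" for b
    by (rule presheafD(1)[OF F that that])
  show "linear_map K (fobj F b) (fobj (yoneda_obj A i V) b)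
      (\<lambda>v. \<lambda>x\<in>carrier (fobj i b). \<phi> (coend_gen F b x v))" if b: "b \<in> Ob B" for b
  proof (rule linear_mapI)
    show "(\<lambda>x\<in>carrier (fobj i b). \<phi> (coend_gen F b x v)) \<in> carrier (fobj (yoneda_obj A i V) b)"
      if "v \<in> carrier (fobj F b)" for v
      using inner[OF b that] by simp
  qed (use linear_mapD[OF linear_map_comp[OF coend_gen_linear_right[OF F b]
          linear_map_scalars[OF algebra linear_mapsD(2)[OF p]]]] in \<open>simp_all cong: restrict_cong\<close>)
  fix b b' f v assume m: "b \<in> Ob B" "b' \<in> Ob B" "f \<in> carrier (Hom B b b')" and v: "v \<in> carrier (fobj F b')"
  show "farr F b' b f v \<in> carrier (fobj F b) \<and>
      (\<lambda>x\<in>carrier (fobj i b). \<phi> (coend_gen F b x (farr F b' b f v))) =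
      farr (yoneda_obj A i V) b' b f (\<lambda>x\<in>carrier (fobj i b'). \<phi> (coend_gen F b' x v))"
    using F_arrD(3)[OF F m v] inner[OF m(2) v] coend_gen_dinatural[OF F m _ v] i_arrD(3)[OF m]
    by (simp add: compose_def cong: restrict_cong)
qed

text \<open>
  A natural transformation \<open>\<theta> : F \<Rightarrow> Y V\<close> and an \<open>A\<close>-linear map out of \<open>|F|\<close> are the same data:
  both are families \<open>(x, v) \<mapsto> \<theta> b v x\<close>, \<open>A\<close>-linear in \<open>x\<close>, \<open>k\<close>-linear in \<open>v\<close> and dinatural in \<open>b\<close>.
\<close>

lemma adj_transpose_bij:
  assumes F: "psh F" and V: "left_module A V"
  shows "bij_betw (adj_transpose K A B i F V) (linear_maps A (coend K A B i F) V)
    (carrier (Hom_PSh K B F (yoneda_obj A i V)))"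
proof (rule bij_betwI')
  fix \<phi> \<psi> assume p: "\<phi> \<in> linear_maps A (coend K A B i F) V" "\<psi> \<in> linear_maps A (coend K A B i F) V"
  show "adj_transpose K A B i F V \<phi> = adj_transpose K A B i F V \<psi> \<longleftrightarrow> \<phi> = \<psi>"
  proof
    assume eq: "adj_transpose K A B i F V \<phi> = adj_transpose K A B i F V \<psi>"
    show "\<phi> = \<psi>"
    proof (rule coend_linear_maps_eqI[OF F V p])
      show "\<phi> (coend_gen F b x v) = \<psi> (coend_gen F b x v)"
        if "b \<in> Ob B" "x \<in> carrier (fobj i b)" "v \<in> carrier (fobj F b)" for b x v
        using adj_transpose_apply[OF that(1,3,2), of V] eq by metis
    qed
  qed simp
next
  show "adj_transpose K A B i F V \<phi> \<in> carrier (Hom_PSh K B F (yoneda_obj A i V))"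
    if "\<phi> \<in> linear_maps A (coend K A B i F) V" for \<phi>
    by (rule adj_transpose_closed[OF F V that])
next
  fix \<theta> assume t: "\<theta> \<in> carrier (Hom_PSh K B F (yoneda_obj A i V))"
  note tD = Hom_PShD[OF t, simplified]
  obtain \<phi> where p: "\<phi> \<in> linear_maps A (coend K A B i F) V"
    "\<And>b x v. b \<in> Ob B \<Longrightarrow> x \<in> carrier (fobj i b) \<Longrightarrow> v \<in> carrier (fobj F b) \<Longrightarrow>
      \<phi> (coend_gen F b x v) = \<theta> b v x"
  proof (rule coend_lift[OF F V, of "\<lambda>b x v. \<theta> b v x"])
    show "linear_map A (fobj i b) V (\<lambda>x. \<theta> b v x)" if "b \<in> Ob B" "v \<in> carrier (fobj F b)" for b v
      using linear_mapsD(2)[OF tD(2)[OF that]] .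
    show "linear_map K (fobj F b) (scalars A V) (\<lambda>v. \<theta> b v x)"
      if "b \<in> Ob B" "x \<in> carrier (fobj i b)" for b x
      using that by (intro linear_mapI) (simp_all add: tD(3,4) linear_mapsD(3)[OF tD(2)])
    show "\<theta> b' v (farr i b b' f x) = \<theta> b (farr F b' b f v) x"
      if "b \<in> Ob B" "b' \<in> Ob B" "f \<in> carrier (Hom B b b')" "x \<in> carrier (fobj i b)" "v \<in> carrier (fobj F b')"
      for b b' f x v
      using that Hom_PShD(5)[OF t that(1-3,5)] tD(2)[OF that(2,5)] by (simp add: compose_def)
  qed (rule that)
  have "\<theta> = adj_transpose K A B i F V \<phi>"
    by (rule yoneda_hom_eqI[OF t adj_transpose_closed[OF F V p(1)]]) (simp add: adj_transpose_apply p(2))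
  then show "\<exists>\<phi>\<in>linear_maps A (coend K A B i F) V. \<theta> = adj_transpose K A B i F V \<phi>"
    using p(1) by blast
qed

lemma adj_transpose_linear:
  assumes F: "psh F" and V: "left_module A V"
  shows "linear_map K (Hom_Mod A (coend K A B i F) V) (Hom_PSh K B F (yoneda_obj A i V))
    (adj_transpose K A B i F V)"
proof (rule linear_mapI)
  interpret L: left_module K "Hom_Mod A (coend K A B i F) V"
    by (rule left_module_Hom_Mod[OF algebra left_module_coend[OF F] V])
  interpret P: left_module K "Hom_PSh K B F (yoneda_obj A i V)"
    by (rule left_module_Hom_PSh[OF K F yoneda_obj_presheaf[OF V]])
  note closed = adj_transpose_closed[OF F V, folded Hom_Mod_simps(1)[of A "coend K A B i F" V]]
  show "adj_transpose K A B i F V \<phi> \<in> carrier (Hom_PSh K B F (yoneda_obj A i V))"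
    if "\<phi> \<in> carrier (Hom_Mod A (coend K A B i F) V)" for \<phi>
    by (rule closed[OF that])
  show "adj_transpose K A B i F V (\<phi> \<oplus>\<^bsub>Hom_Mod A (coend K A B i F) V\<^esub> \<psi>) =
      adj_transpose K A B i F V \<phi> \<oplus>\<^bsub>Hom_PSh K B F (yoneda_obj A i V)\<^esub> adj_transpose K A B i F V \<psi>"
    if "\<phi> \<in> carrier (Hom_Mod A (coend K A B i F) V)" "\<psi> \<in> carrier (Hom_Mod A (coend K A B i F) V)" for \<phi> \<psi>
    by (rule yoneda_hom_eqI[OF closed[OF L.M.a_closed[OF that]] P.M.a_closed[OF closed[OF that(1)] closed[OF that(2)]]])
      (simp add: adj_transpose_apply coend_gen_closed[OF F] Hom_PSh_simps)
  show "adj_transpose K A B i F V (c \<odot>\<^bsub>Hom_Mod A (coend K A B i F) V\<^esub> \<phi>) =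
      c \<odot>\<^bsub>Hom_PSh K B F (yoneda_obj A i V)\<^esub> adj_transpose K A B i F V \<phi>"
    if "c \<in> carrier K" "\<phi> \<in> carrier (Hom_Mod A (coend K A B i F) V)" for c \<phi>
    by (rule yoneda_hom_eqI[OF closed[OF L.smult_closed[OF that]] P.smult_closed[OF that(1) closed[OF that(2)]]])
      (simp add: adj_transpose_apply coend_gen_closed[OF F] Hom_PSh_simps)
qed

text \<open>
  Both naturality squares commute because either side sends \<open>b, v, x\<close> to the same value: it is
  \<open>\<phi> (coend_gen G b x (\<theta> b v))\<close> for naturality in the presheaf, and \<open>g (\<phi> (coend_gen F b x v))\<close> for
  naturality in the module.
\<close>

theorem adjunction_realization_yoneda:
  "adjunction K A B (realization K A B i :: (('o, 'm, 'k, 'f) presheaf, _, _, _) linfun)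
    (yoneda A B i :: (('a, 'v) module, _, _, _) linfun) (adj_transpose K A B i)"
  unfolding adjunction_def realization_simps yoneda_simps(1) PShCat_simps ModCat_simps mem_Collect_eq
proof (intro conjI ballI)
  show "linear_functor K (PShCat K B :: (('o, 'm, 'k, 'f) presheaf, _, _) lincat) (ModCat A) (realization K A B i)"
    by (rule linear_functor_realization)
  show "linear_functor K (ModCat A :: (('a, 'v) module, _, _) lincat) (PShCat K B) (yoneda A B i)"
    by (rule linear_functor_yoneda)
  fix F :: "('o, 'm, 'k, 'f) presheaf" and V :: "('a, 'v) module"
  assume "F \<in> Ob (PShCat K B)" and "V \<in> {V. left_module A V}"
  then have F: "psh F" and V: "left_module A V" by simp_all
  show "linear_map K (Hom_Mod A (coend K A B i F) V) (Hom_PSh K B F (yoneda_obj A i V)) (adj_transpose K A B i F V)"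
    by (rule adj_transpose_linear[OF F V])
  show "bij_betw (adj_transpose K A B i F V) (carrier (Hom_Mod A (coend K A B i F) V))
      (carrier (Hom_PSh K B F (yoneda_obj A i V)))"
    using adj_transpose_bij[OF F V] by simp
next
  fix F G :: "('o, 'm, 'k, 'f) presheaf" and V :: "('a, 'v) module" and \<theta> \<phi>
  assume "F \<in> Ob (PShCat K B)" "G \<in> Ob (PShCat K B)" "V \<in> {V. left_module A V}"
    and t: "\<theta> \<in> carrier (Hom_PSh K B F G)" and "\<phi> \<in> carrier (Hom_Mod A (coend K A B i G) V)"
  then have F: "psh F" and G: "psh G" and V: "left_module A V"
    and p: "\<phi> \<in> linear_maps A (coend K A B i G) V" by simp_all
  show "adj_transpose K A B i F V (compose (carrier (coend K A B i F)) \<phi> (coend_map K A B i F G \<theta>)) =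
      nat_comp B F (adj_transpose K A B i G V \<phi>) \<theta>"
    using Hom_PShD(2)[OF t]
    by (intro yoneda_hom_eqI[OF adj_transpose_closed[OF F V compose_linear_maps[OF left_module_coend[OF F]
              coend_map_linear[OF F G t] p]] nat_comp_closed[OF F t adj_transpose_closed[OF G V p]]])
      (simp add: adj_transpose_apply compose_def coend_gen_closed[OF F] coend_map_gen[OF F G t])
next
  fix F :: "('o, 'm, 'k, 'f) presheaf" and V W :: "('a, 'v) module" and g \<phi>
  assume "F \<in> Ob (PShCat K B)" "V \<in> {V. left_module A V}" "W \<in> {V. left_module A V}"
    and "g \<in> carrier (Hom_Mod A V W)" and "\<phi> \<in> carrier (Hom_Mod A (coend K A B i F) V)"
  then have F: "psh F" and V: "left_module A V" and W: "left_module A W" and g: "g \<in> linear_maps A V W"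
    and p: "\<phi> \<in> linear_maps A (coend K A B i F) V" by simp_all
  note Y = linear_functor.farr_linear[OF linear_functor_yoneda, of V W]
  have "farr (yoneda A B i) V W g \<in> carrier (Hom_PSh K B (yoneda_obj A i V) (yoneda_obj A i W))"
    using linear_mapD(1)[OF Y] V W g by simp
  note Yp = nat_comp_closed[OF F adj_transpose_closed[OF F V p] this]
  have "adj_transpose K A B i F V \<phi> b v \<in> linear_maps A (fobj i b) V"
    if "b \<in> Ob B" "v \<in> carrier (fobj F b)" for b v
    using Hom_PShD(2)[OF adj_transpose_closed[OF F V p] that] by simp
  then show "adj_transpose K A B i F W (compose (carrier (coend K A B i F)) g \<phi>) =
      nat_comp B F (farr (yoneda A B i) V W g) (adj_transpose K A B i F V \<phi>)"
    by (intro yoneda_hom_eqI[OF adj_transpose_closed[OF F W compose_linear_maps[OF left_module_coend[OF F] p g]] Yp])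
      (simp add: compose_def adj_transpose_apply coend_gen_closed[OF F])
qed

end

theorem theorem2p2:
  fixes K :: "'k ring" and A :: "('k, 'a) module" and B :: "('o, 'm, 'k) lincat"
    and i :: "('o, 'm, 'a, 'i) modfun"
  assumes "field K"
    and "assoc_algebra K A"
    and "linear_category K B"
    and "linear_functor K B (ModCat A) i"
  shows "adjunction K A B
      (realization K A B i :: (('o, 'm, 'k, 'f) presheaf, _, _, _) linfun)
      (yoneda A B i :: (('a, 'v) module, _, _, _) linfun)
      (adj_transpose K A B i)
    \<and> (\<forall>F \<in> Ob (PShCat K B :: (('o, 'm, 'k, 'f) presheaf, _, _) lincat).
        fobj (realization K A B i) F = coend K A B i F \<and>
        is_coend K A B i TYPE('v) F (coend K A B i F) (coend_inj K A B i F))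
    \<and> (\<forall>F \<in> Ob (PShCat K B :: (('o, 'm, 'k, 'f) presheaf, _, _) lincat). \<forall>G \<in> Ob (PShCat K B).
        \<forall>\<theta> \<in> carrier (Hom (PShCat K B) F G).
        \<forall>u \<in> carrier (Hom_Mod A (coend K A B i F) (coend K A B i G)).
          u = farr (realization K A B i) F G \<theta> \<longleftrightarrow>
          (\<forall>b \<in> Ob B.
            compose (carrier (integrand K A i F b b)) u (coend_inj K A B i F b) =
            compose (carrier (integrand K A i F b b)) (coend_inj K A B i G b)
              (integrand_map K A i F G \<theta> b)))"
proof -
  interpret module_functor K A B i
    using assms by (intro module_functor.intro) (auto simp: field_def domain_def)
  show ?thesis
  proof (intro conjI ballI)
    fix F :: "('o, 'm, 'k, 'f) presheaf"
    assume "F \<in> Ob (PShCat K B)"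
    then have F: "psh F" by simp
    show "fobj (realization K A B i) F = coend K A B i F" by simp
    show "is_coend K A B i TYPE('v) F (coend K A B i F) (coend_inj K A B i F)"
      by (rule coend_is_coend[OF F])
    fix G \<theta> u
    assume "G \<in> Ob (PShCat K B)" "\<theta> \<in> carrier (Hom (PShCat K B) F G)"
      and "u \<in> carrier (Hom_Mod A (coend K A B i F) (coend K A B i G))"
    then show "u = farr (realization K A B i) F G \<theta> \<longleftrightarrow> (\<forall>b \<in> Ob B.
        compose (carrier (integrand K A i F b b)) u (coend_inj K A B i F b) =
        compose (carrier (integrand K A i F b b)) (coend_inj K A B i G b) (integrand_map K A i F G \<theta> b))"
      using coend_map_characterization[OF F] by simp
  qed (rule adjunction_realization_yoneda)
qed

end
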